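(* Let $(H,\rho)$ be a proper $\delta$-hyperbolic metric space with Radon measure $\mathcal L$ positive on non-empty open sets, let $\mathcal Z$ be an Ancona process in $H$ with origin $o$, and let $\Gamma$ be a group acting properly discontinuously on $H$ by automorphisms of $(H,\rho,\mathcal L,\mathcal Z)$. Let $X\subseteq H$ be a $\Gamma$-invariant discrete subset containing $o$ and let $(X,\mu)$ be a $\Gamma$-invariant FLS-restriction of $\mathcal Z$. Suppose that $\Lambda_X\subseteq\Lambda_H^{\mathrm{rad}}$. Then there is a $\Gamma$-equivariant homeomorphism $\Lambda_X\to\partial_\mu X$ which extends the identity of $X$ continuously.
   Context: Gromov hyperbolicity: $(yz)_x=\frac12(\rho(x,y)+\rho(x,z)-\rho(y,z))$ is the Gromov product; $H$ (not necessarily geodesic) is $\delta$-hyperbolic if $(xy)_u\ge\min\{(xz)_u,(yz)_u\}-\delta$ for all $x,y,z,u\in H$. $\partial_{\mathrm{geo}}H$ is the Gromov boundary (equivalence classes of sequences with $(x_mx_n)_u\to\infty$), and $(\xi\eta)_u=\sup\liminf_{m,n}(x_my_n)_u$ for $\xi,\eta\in \bar H=H\cup\partial_{\mathrm{geo}}H$, the supremum over sequences $x_m\to\xi$, $y_n\to\eta$. For $X\subseteq H$, $\Lambda_X\subseteq\partial_{\mathrm{geo}}H$ is the set of limit points of $X$. A diverging sequence $(x_m)$ in $X$ converges radially to $\xi\in\partial_{\mathrm{geo}}H$ if $x_m\to\xi$ and $\limsup_m(u\xi)_{x_m}<\infty$ for some (any) $u\in H$; $\Lambda_X^{\mathrm{rad}}$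 is the set of $\xi$ to which some sequence in $X$ converges radially (here used with $X=H$). Markov processes: $\mathcal Z=((Z_t)_{t\in\mathbb K},(\mathbb P_x)_{x\in H})$ with $\mathbb K=\mathbb N_0$ ($H$ discrete) or $\mathbb K=[0,\infty)$ ($H$ path connected; "continuous" case) is an irreducible, time-homogeneous, strong Markov process; in the continuous case sample paths are almost surely continuous and $\mathcal Z$ is absolutely continuous: for $x\in V=B(x_0,r)$ with $0<2r<\mathrm{diam}\,H$, the exit time of $V$ is $\mathbb P_x$-a.s. finite and the Green kernel $G_V(x,A)=\int_{\mathbb K}\mathbb P_x[Z_t\in A,\ t\le\tau_{V^c}]\,dt$ (with $\tau_{V^c}$ the hitting time of $V^c$) is a finite Radon measure with density $G_V(x,y)$ with respect to $\mathcal L$, continuous off the diagonal of $V^2$. $G(x,A)=\int_{\mathbb K}\mathbb P_x[Z_t\in A]\,dt$ is the Green kernel on $H$ ($dt$ counting measure if $\mathbb K=\mathbb N_0$). $\mathcal Z$ is transient if $G(x,\cdot)$ is a Radon measure; in the continuous transient case $G$ is required to have a density $G(x,y)$ with the same properties; for $\mathbb K=\mathbb N_0$, $G(x,y)=G(x,\{y\})$. The Martin kernel is $K(x,y)=G(x,y)/G(o,y)$; in the continuous case the $K(\cdot,y)$ are assumed locally equicontinuous (for compact $C$, the family of $K(\cdot,y)$ with $\rho(y,C)\ge1$ is equicontinuous on $C$). The Martin boundary $\partial_{\mathcal Z}H$ is the set of limits of $K(\cdot,y_n)$ along divergent sequences $(y_n)$, and $H\cup\partial_{\mathcal Z}H$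 carries the compact Hausdorff topology given by locally uniform convergence of Martin kernels. Ancona process: with $B_x=B(x,1)$ the open unit ball and $a=C^{\pm1}$ meaning $C^{-1}\le a\le C$, a transient $\mathcal Z$ is an Ancona process if (A1) there are $\alpha>0$, $C_1\ge1$ such that $G(x,B_y)G(y,B_x)\le C_1e^{-\alpha\rho(x,y)}$ whenever $\rho(x,y)\ge2$, and $G(z,B_z)=C_1^{\pm1}$ for all $z$; (A2) for all $r,\varepsilon>0$ there is $C_2=C_2(r,\varepsilon)>0$ such that for all $x,y,z,u,v,w\in H$ with $\min\{\rho(x,y),\rho(x,z)\}>\varepsilon$ and $\max\{\rho(y,z),\rho(v,w)\}<r$: $G(x,y)\le C_2G(x,z)$ and $G(v,B_u)\le C_2G(w,B_u)$; (A3) for any $r\ge0$ there is $C_3=C_3(r)>0$ such that $G(x,B_y)\le C_3G(x,B_z)G(z,B_y)$ for all $x,y,z$ with $\rho(x,y)\ge2$ and $(xy)_z\le r$; (A4) there is a $\Gamma$-equivariant homeomorphism $\partial_{\mathrm{geo}}H\to\partial_{\mathcal Z}H$ which extends the identity of $H$ continuously. FLS-restriction: $\mu=(\mu_x)_{x\in X}$ is a $\Gamma$-equivariant family of probability measures on $X$ whose random walk is irreducible and transient, with Green kernel $g(x,y)=\sum_n\mu_x^{(n)}(y)$ and Martin kernel $k(x,y)=g(x,y)/g(o,y)$, such that $k(x,y)=K(x,y)$ for all $x,y\in X$ with $y\ne x,o$. $\partial_\mu X$ is the Martin boundary of the random walk, i.e. the set of pointwise limits of $k(\cdot,y_n)$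 along divergent sequences $(y_n)$ in $X$. That a map $\Lambda_X\to\partial_\mu X$ extends the identity of $X$ continuously means that its union with $\mathrm{id}_X$ is a continuous map $X\cup\Lambda_X\to X\cup\partial_\mu X$.
   Formalization: In (A4) the union of the boundary homeomorphism with the identity of H is assumed to be a homeomorphism of H with its Gromov boundary onto the Martin compactification, not only continuous; for non-geodesic H with non-compact Gromov bordification the claim fails without this. *)

theory Defs
  imports "HOL-Probability.Probability" "HOL-Algebra.Group_Action"
begin

section \<open>Gromov hyperbolic spaces\<close>

text \<open>The space H is the universe of a type of class \<open>metric_space\<close>; sets and functions on H
  are sets and functions on that type.\<close>

definition proper_space :: "'h::metric_space set \<Rightarrow> bool" where
  "proper_space S \<longleftrightarrow> (\<forall>x\<in>S. \<forall>r. compact (S \<inter> cball x r))"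

definition gromov_product :: "'h::metric_space \<Rightarrow> 'h \<Rightarrow> 'h \<Rightarrow> real" where
  "gromov_product u x y = (dist u x + dist u y - dist x y) / 2"

definition gromov_hyperbolic :: "real \<Rightarrow> 'h::metric_space set \<Rightarrow> bool" where
  "gromov_hyperbolic \<delta> S \<longleftrightarrow>
     (\<forall>x\<in>S. \<forall>y\<in>S. \<forall>z\<in>S. \<forall>u\<in>S.
        gromov_product u x y \<ge> min (gromov_product u x z) (gromov_product u y z) - \<delta>)"

definition gromov_equiv :: "((nat \<Rightarrow> 'h::metric_space) \<times> (nat \<Rightarrow> 'h)) set" where
  "gromov_equiv =
     (let far = (\<lambda>s t. \<forall>u. filterlim (\<lambda>(m, n). gromov_product u (s m) (t n)) at_top
                              (sequentially \<times>\<^sub>F sequentially))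
      in {(s, t). far s s \<and> far t t \<and> far s t})"

definition gromov_boundary :: "(nat \<Rightarrow> 'h::metric_space) set set" where
  "gromov_boundary = {s. (s, s) \<in> gromov_equiv} // gromov_equiv"

text \<open>Points of H together with a boundary are elements of a sum type: \<open>Inl x\<close> for \<open>x\<close> in H and
  \<open>Inr b\<close> for a boundary point \<open>b\<close>. A boundary point of \<open>gromov_boundary\<close> is the
  set of all sequences converging to it.\<close>

definition converges_to :: "(nat \<Rightarrow> 'h::metric_space) \<Rightarrow> 'h + (nat \<Rightarrow> 'h) set \<Rightarrow> bool" where
  "converges_to s p = (case p of Inl x \<Rightarrow> s \<longlonglongrightarrow> x | Inr \<xi> \<Rightarrow> s \<in> \<xi>)"

definition ext_gromov_product ::
    "'h::metric_space \<Rightarrow> 'h + (nat \<Rightarrow> 'h) set \<Rightarrow> 'h + (nat \<Rightarrow> 'h) set \<Rightarrow> ereal" where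
  "ext_gromov_product u p q =
     (SUP (s, t) \<in> {(s, t). converges_to s p \<and> converges_to t q}.
        Liminf (sequentially \<times>\<^sub>F sequentially) (\<lambda>(m, n). ereal (gromov_product u (s m) (t n))))"

text \<open>The topology on H and its Gromov boundary: H is open with its metric topology, and the sets
  of all \<open>p\<close> with \<open>(p\<xi>)\<^sub>u > R\<close> form a basis of neighbourhoods of a boundary point \<open>\<xi>\<close>.\<close>

definition gromov_topology :: "'h::metric_space \<Rightarrow> ('h + (nat \<Rightarrow> 'h) set) topology" where
  "gromov_topology u = topology (\<lambda>U.
     U \<subseteq> UNIV <+> gromov_boundary \<and> open (Inl -` U) \<and>
     (\<forall>\<xi>\<in>Inr -` U. \<exists>R::real.
        {p \<in> UNIV <+> gromov_boundary. ereal R < ext_gromov_product u p (Inr \<xi>)} \<subseteq> U))"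

lemma openin_gromov_topology:
  "openin (gromov_topology u) U \<longleftrightarrow>
     U \<subseteq> UNIV <+> gromov_boundary \<and> open (Inl -` U) \<and>
     (\<forall>\<xi>\<in>Inr -` U. \<exists>R::real.
        {p \<in> UNIV <+> gromov_boundary. ereal R < ext_gromov_product u p (Inr \<xi>)} \<subseteq> U)"
proof -
  define N where "N = (\<lambda>\<xi> (R::real).
    {p \<in> UNIV <+> gromov_boundary. ereal R < ext_gromov_product u p (Inr \<xi>)})"
  define \<T> where "\<T> = (\<lambda>U. U \<subseteq> UNIV <+> gromov_boundary \<and> open (Inl -` U) \<and>
     (\<forall>\<xi>\<in>Inr -` U. \<exists>R. N \<xi> R \<subseteq> U))"
  have N_max: "N \<xi> (max R1 R2) \<subseteq> N \<xi> R1 \<inter> N \<xi> R2" for \<xi> R1 R2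
  proof -
    have "ereal R1 \<le> ereal (max R1 R2)" "ereal R2 \<le> ereal (max R1 R2)" by simp_all
    then show ?thesis unfolding N_def by (blast intro: le_less_trans)
  qed
  have "\<T> (S \<inter> T)" if "\<T> S" "\<T> T" for S T
  proof -
    have "\<exists>R. N \<xi> R \<subseteq> S \<inter> T" if "\<xi> \<in> Inr -` (S \<inter> T)" for \<xi>
    proof -
      obtain R1 R2 where "N \<xi> R1 \<subseteq> S" "N \<xi> R2 \<subseteq> T"
        using \<open>\<T> S\<close> \<open>\<T> T\<close> \<open>\<xi> \<in> Inr -` (S \<inter> T)\<close> unfolding \<T>_def by blast
      with N_max[of \<xi> R1 R2] show ?thesis by blast
    qed
    then show ?thesis
      using that unfolding \<T>_def by (simp add: vimage_Int open_Int le_infI1)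
  qed
  moreover have "\<T> (\<Union>\<K>)" if "\<And>A. A \<in> \<K> \<Longrightarrow> \<T> A" for \<K>
  proof -
    have "open (Inl -` \<Union>\<K>)"
      using that unfolding \<T>_def vimage_Union by (intro open_UN) blast
    moreover have "\<exists>R. N \<xi> R \<subseteq> \<Union>\<K>" if "\<xi> \<in> Inr -` \<Union>\<K>" for \<xi>
    proof -
      obtain A where A: "A \<in> \<K>" "\<xi> \<in> Inr -` A" using \<open>\<xi> \<in> Inr -` \<Union>\<K>\<close> by blast
      with \<open>\<And>A. A \<in> \<K> \<Longrightarrow> \<T> A\<close> obtain R where "N \<xi> R \<subseteq> A" unfolding \<T>_def by meson
      with A show ?thesis by blast
    qed
    moreover have "\<Union>\<K> \<subseteq> UNIV <+> gromov_boundary"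
      using that unfolding \<T>_def by (intro Union_least) blast
    ultimately show ?thesis unfolding \<T>_def by blast
  qed
  ultimately have "istopology \<T>"
    unfolding istopology_def by simp
  then have "openin (topology \<T>) U = \<T> U"
    by (simp add: topology_inverse')
  then show ?thesis
    unfolding gromov_topology_def \<T>_def N_def .
qed

definition limit_set :: "'h::metric_space set \<Rightarrow> (nat \<Rightarrow> 'h) set set" where
  "limit_set X = {\<xi> \<in> gromov_boundary. \<exists>s. range s \<subseteq> X \<and> converges_to s (Inr \<xi>)}"

definition divergent_seq :: "(nat \<Rightarrow> 'h::topological_space) \<Rightarrow> bool" where
  "divergent_seq s \<longleftrightarrow> (\<forall>C. compact C \<longrightarrow> (\<forall>\<^sub>F n in sequentially. s n \<notin> C))"

definition radial_limit_set :: "'h::metric_space set \<Rightarrow> (nat \<Rightarrow> 'h) set set" where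
  "radial_limit_set X =
     {\<xi> \<in> gromov_boundary. \<exists>s. range s \<subseteq> X \<and> divergent_seq s \<and> converges_to s (Inr \<xi>) \<and>
        (\<exists>u. limsup (\<lambda>m. ext_gromov_product (s m) (Inl u) (Inr \<xi>)) < \<infinity>)}"


section \<open>Martin boundaries\<close>

text \<open>\<open>Y\<close> is the state space and \<open>\<C>\<close> a family of subsets of \<open>Y\<close>; convergence of kernels is uniform
  convergence on the members of \<open>\<C>\<close>. For the process, \<open>Y\<close> is H and \<open>\<C>\<close> consists of the compact
  sets (locally uniform convergence); for the random walk, \<open>Y\<close> is the discrete set X and \<open>\<C>\<close>
  consists of its finite subsets (pointwise convergence). Divergence always means leaving every
  compact subset of H.\<close>

definition martin_kernel :: "('h \<Rightarrow> 'h \<Rightarrow> real) \<Rightarrow> 'h \<Rightarrow> 'h \<Rightarrow> 'h \<Rightarrow> real" where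
  "martin_kernel G p x y = G x y / G p y"

definition martin_boundary ::
    "'h::topological_space set \<Rightarrow> 'h set set \<Rightarrow> ('h \<Rightarrow> 'h \<Rightarrow> real) \<Rightarrow> ('h \<Rightarrow> real) set" where
  "martin_boundary Y \<C> K =
     {\<kappa> \<in> extensional Y. \<exists>y. range y \<subseteq> Y \<and> divergent_seq y \<and>
        (\<forall>C\<in>\<C>. uniform_limit C (\<lambda>n x. K x (y n)) \<kappa> sequentially)}"

text \<open>A neighbourhood of a boundary point contains only those interior points outside \<open>C\<close>, as
  \<open>K x y\<close> is not controlled at \<open>x = y\<close>.\<close>

definition martin_nbhd ::
    "'h::topological_space set \<Rightarrow> 'h set set \<Rightarrow> ('h \<Rightarrow> 'h \<Rightarrow> real) \<Rightarrow>
     'h set \<Rightarrow> real \<Rightarrow> ('h \<Rightarrow> real) \<Rightarrow> ('h + ('h \<Rightarrow> real)) set" where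
  "martin_nbhd Y \<C> K C e \<kappa> =
     {y \<in> Y - C. \<forall>x\<in>C. \<bar>K x y - \<kappa> x\<bar> < e} <+>
     {\<kappa>' \<in> martin_boundary Y \<C> K. \<forall>x\<in>C. \<bar>\<kappa>' x - \<kappa> x\<bar> < e}"

definition martin_topology ::
    "'h::topological_space set \<Rightarrow> 'h set set \<Rightarrow> ('h \<Rightarrow> 'h \<Rightarrow> real) \<Rightarrow> ('h + ('h \<Rightarrow> real)) topology"
  where
  "martin_topology Y \<C> K = topology (\<lambda>U.
     U \<subseteq> Y <+> martin_boundary Y \<C> K \<and> openin (top_of_set Y) (Inl -` U) \<and>
     (\<forall>\<kappa>\<in>Inr -` U. \<exists>\<F>. finite \<F> \<and> \<F> \<subseteq> \<C> \<and> (\<exists>e>0. martin_nbhd Y \<C> K (\<Union>\<F>) e \<kappa> \<subseteq> U)))"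

lemma openin_martin_topology:
  "openin (martin_topology Y \<C> K) U \<longleftrightarrow>
     U \<subseteq> Y <+> martin_boundary Y \<C> K \<and> openin (top_of_set Y) (Inl -` U) \<and>
     (\<forall>\<kappa>\<in>Inr -` U. \<exists>\<F>. finite \<F> \<and> \<F> \<subseteq> \<C> \<and> (\<exists>e>0. martin_nbhd Y \<C> K (\<Union>\<F>) e \<kappa> \<subseteq> U))"
proof -
  define P where "P = (\<lambda>U \<kappa>. \<exists>\<F>. finite \<F> \<and> \<F> \<subseteq> \<C> \<and>
    (\<exists>e>0. martin_nbhd Y \<C> K (\<Union>\<F>) e \<kappa> \<subseteq> U))"
  define \<T> where "\<T> = (\<lambda>U. U \<subseteq> Y <+> martin_boundary Y \<C> K \<and>
     openin (top_of_set Y) (Inl -` U) \<and> (\<forall>\<kappa>\<in>Inr -` U. P U \<kappa>))"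
  have P_Int: "P (S \<inter> T) \<kappa>" if "P S \<kappa>" "P T \<kappa>" for S T \<kappa>
  proof -
    obtain F1 e1 where 1: "finite F1" "F1 \<subseteq> \<C>" "e1 > 0" "martin_nbhd Y \<C> K (\<Union>F1) e1 \<kappa> \<subseteq> S"
      using \<open>P S \<kappa>\<close> unfolding P_def by blast
    obtain F2 e2 where 2: "finite F2" "F2 \<subseteq> \<C>" "e2 > 0" "martin_nbhd Y \<C> K (\<Union>F2) e2 \<kappa> \<subseteq> T"
      using \<open>P T \<kappa>\<close> unfolding P_def by blast
    have "martin_nbhd Y \<C> K (\<Union>(F1 \<union> F2)) (min e1 e2) \<kappa>
            \<subseteq> martin_nbhd Y \<C> K (\<Union>F1) e1 \<kappa> \<inter> martin_nbhd Y \<C> K (\<Union>F2) e2 \<kappa>"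
      unfolding martin_nbhd_def by auto
    then have "martin_nbhd Y \<C> K (\<Union>(F1 \<union> F2)) (min e1 e2) \<kappa> \<subseteq> S \<inter> T"
      using 1 2 by blast
    moreover have "finite (F1 \<union> F2)" "F1 \<union> F2 \<subseteq> \<C>" "min e1 e2 > 0"
      using 1 2 by auto
    ultimately show ?thesis unfolding P_def by blast
  qed
  have P_mono: "P T \<kappa>" if "P S \<kappa>" "S \<subseteq> T" for S T \<kappa>
    using that unfolding P_def by (meson order_trans)
  have "\<T> (S \<inter> T)" if "\<T> S" "\<T> T" for S T
    using that P_Int unfolding \<T>_def by (simp add: vimage_Int openin_Int le_infI1)
  moreover have "\<T> (\<Union>\<K>)" if "\<And>A. A \<in> \<K> \<Longrightarrow> \<T> A" for \<K>
  proof -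
    have "openin (top_of_set Y) (Inl -` \<Union>\<K>)"
      using that unfolding \<T>_def vimage_Union by (intro openin_Union) blast
    moreover have "P (\<Union>\<K>) \<kappa>" if "\<kappa> \<in> Inr -` \<Union>\<K>" for \<kappa>
    proof -
      obtain A where A: "A \<in> \<K>" "\<kappa> \<in> Inr -` A" using \<open>\<kappa> \<in> Inr -` \<Union>\<K>\<close> by blast
      with \<open>\<And>A. A \<in> \<K> \<Longrightarrow> \<T> A\<close> have "P A \<kappa>" unfolding \<T>_def by blast
      then show ?thesis using P_mono Union_upper[OF \<open>A \<in> \<K>\<close>] by blast
    qed
    moreover have "\<Union>\<K> \<subseteq> Y <+> martin_boundary Y \<C> K"
      using that unfolding \<T>_def by (intro Union_least) blast
    ultimately show ?thesis unfolding \<T>_def by blast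
  qed
  ultimately have "istopology \<T>"
    unfolding istopology_def by simp
  then have "openin (topology \<T>) U = \<T> U"
    by (simp add: topology_inverse')
  then show ?thesis
    unfolding martin_topology_def \<T>_def P_def .
qed


section \<open>Markov processes\<close>

datatype clock_kind = Discrete_Time | Continuous_Time

fun times :: "clock_kind \<Rightarrow> real set" where
  "times Discrete_Time = \<nat>"
| "times Continuous_Time = {0..}"

fun time_measure :: "clock_kind \<Rightarrow> real measure" where
  "time_measure Discrete_Time = count_space \<nat>"
| "time_measure Continuous_Time = restrict_space lborel {0..}"

text \<open>\<open>sample_space\<close> only provides the underlying measurable space; the measures are \<open>law Z x\<close>,
  the law of the process started at \<open>x\<close>.\<close>

record ('w, 'h) process =
  clock :: clock_kind
  sample_space :: "'w measure"
  law :: "'h \<Rightarrow> 'w measure"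
  pos :: "real \<Rightarrow> 'w \<Rightarrow> 'h"

abbreviation samples :: "('w, 'h) process \<Rightarrow> 'w set" where
  "samples Z \<equiv> space (sample_space Z)"

definition natural_filtration :: "('w, 'h::topological_space) process \<Rightarrow> ennreal \<Rightarrow> 'w measure" where
  "natural_filtration Z s =
     sigma (samples Z)
       {pos Z t -` A \<inter> samples Z | t A. t \<in> times (clock Z) \<and> ennreal t \<le> s \<and> A \<in> sets borel}"

lemma filtration_natural: "filtration (samples Z) (natural_filtration Z)"
proof
  show "space (natural_filtration Z s) = samples Z" for s
    unfolding natural_filtration_def by (rule space_measure_of) auto
  show "sets (natural_filtration Z s) \<subseteq> sets (natural_filtration Z t)" if "s \<le> t" for s t
    unfolding natural_filtration_def using that
    by (intro sigma_sets_mono' sets_measure_of[THEN equalityD1, THEN order_trans]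
        | subst sets_measure_of | fastforce)+
qed

text \<open>The strong Markov property at a stopping time T with values in the time set or \<open>\<infinity>\<close>: on the event
  \<open>T < \<infinity>\<close>, the conditional law of the position at time \<open>T + t\<close> given the past of T is the law at
  time \<open>t\<close> of the process started at the position at time T. In continuous time paths are
  continuous only almost surely, so the events need only be measurable for the completions of
  the laws.\<close>

definition strong_markov :: "('w, 'h::topological_space) process \<Rightarrow> bool" where
  "strong_markov Z \<longleftrightarrow>
     (\<forall>T x t A E.
        stopping_time (natural_filtration Z) T \<and>
        (\<forall>\<omega>\<in>samples Z. T \<omega> = \<infinity> \<or> enn2real (T \<omega>) \<in> times (clock Z)) \<and>
        t \<in> times (clock Z) \<and> A \<in> sets borel \<and>
        E \<in> sets (filtration.pre_sigma (samples Z) (natural_filtration Z) T) \<longrightarrow>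
        emeasure (completion (law Z x)) {\<omega> \<in> E. T \<omega> < \<infinity> \<and> pos Z (enn2real (T \<omega>) + t) \<omega> \<in> A} =
        (\<integral>\<^sup>+\<omega>. emeasure (law Z (pos Z (enn2real (T \<omega>)) \<omega>)) {\<omega>' \<in> samples Z. pos Z t \<omega>' \<in> A}
                * indicator {\<omega> \<in> E. T \<omega> < \<infinity>} \<omega> \<partial>completion (law Z x)))"

definition strong_markov_process :: "('w, 'h::topological_space) process \<Rightarrow> bool" where
  "strong_markov_process Z \<longleftrightarrow>
     (\<forall>x. prob_space (law Z x) \<and> sets (law Z x) = sets (sample_space Z)) \<and>
     (\<forall>t\<in>times (clock Z). pos Z t \<in> sample_space Z \<rightarrow>\<^sub>M borel) \<and>
     (\<forall>t\<in>times (clock Z). \<forall>A\<in>sets borel.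
        (\<lambda>x. emeasure (law Z x) {\<omega> \<in> samples Z. pos Z t \<omega> \<in> A}) \<in> borel_measurable borel) \<and>
     (\<forall>x. AE \<omega> in law Z x. pos Z 0 \<omega> = x) \<and>
     strong_markov Z"

definition irreducible_process :: "('w, 'h::topological_space) process \<Rightarrow> bool" where
  "irreducible_process Z \<longleftrightarrow>
     (\<forall>x U. open U \<and> U \<noteq> {} \<longrightarrow>
        (\<exists>t\<in>times (clock Z). emeasure (law Z x) {\<omega> \<in> samples Z. pos Z t \<omega> \<in> U} > 0))"

definition radon_measure :: "'h::topological_space measure \<Rightarrow> bool" where
  "radon_measure M \<longleftrightarrow>
     sets M = sets borel \<and> (\<forall>C. compact C \<longrightarrow> emeasure M C < \<infinity>) \<and>
     (\<forall>A\<in>sets borel. emeasure M A = (SUP C \<in> {C. compact C \<and> C \<subseteq> A}. emeasure M C))"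

definition green :: "('w, 'h) process \<Rightarrow> 'h \<Rightarrow> 'h set \<Rightarrow> ennreal" where
  "green Z x A =
     (\<integral>\<^sup>+t. emeasure (law Z x) {\<omega> \<in> samples Z. pos Z t \<omega> \<in> A} \<partial>time_measure (clock Z))"

definition hitting_time :: "('w, 'h) process \<Rightarrow> 'h set \<Rightarrow> 'w \<Rightarrow> ennreal" where
  "hitting_time Z A \<omega> = (INF t \<in> {t \<in> times (clock Z). pos Z t \<omega> \<in> A}. ennreal t)"

definition killed_green :: "('w, 'h) process \<Rightarrow> 'h set \<Rightarrow> 'h \<Rightarrow> 'h set \<Rightarrow> ennreal" where
  "killed_green Z V x A =
     (\<integral>\<^sup>+t. emeasure (completion (law Z x))
            {\<omega> \<in> samples Z. pos Z t \<omega> \<in> A \<and> ennreal t \<le> hitting_time Z (- V) \<omega>}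
        \<partial>time_measure (clock Z))"

text \<open>Density on V times V, continuous off the diagonal. The values \<open>D x x\<close> are arbitrary real
  numbers; in the interesting case the density is infinite there.\<close>

definition kernel_density ::
    "'h::topological_space measure \<Rightarrow> 'h set \<Rightarrow> ('h \<Rightarrow> 'h set \<Rightarrow> ennreal) \<Rightarrow> ('h \<Rightarrow> 'h \<Rightarrow> real) \<Rightarrow> bool"
  where
  "kernel_density L V \<gamma> D \<longleftrightarrow>
     (\<forall>x\<in>V. \<forall>y\<in>V. 0 \<le> D x y) \<and>
     (\<forall>x\<in>V. \<forall>A\<in>sets borel. \<gamma> x A = (\<integral>\<^sup>+y. ennreal (D x y) * indicator (A \<inter> V) y \<partial>L)) \<and>
     continuous_on {(x, y). x \<in> V \<and> y \<in> V \<and> x \<noteq> y} (\<lambda>(x, y). D x y)"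

text \<open>The condition \<open>\<exists>a b. 2 * r < dist a b\<close> says that \<open>2 r\<close> is less than the diameter of H; the
  constant \<open>diameter\<close> is not usable for unbounded spaces.\<close>

definition absolutely_continuous_process ::
    "'h::metric_space measure \<Rightarrow> ('w, 'h) process \<Rightarrow> bool" where
  "absolutely_continuous_process L Z \<longleftrightarrow>
     (\<forall>x0 r. 0 < r \<and> (\<exists>a b :: 'h. 2 * r < dist a b) \<longrightarrow>
        (\<forall>x\<in>ball x0 r. AE \<omega> in law Z x. hitting_time Z (- ball x0 r) \<omega> < \<infinity>) \<and>
        (\<forall>x\<in>ball x0 r. \<exists>N. radon_measure N \<and> finite_measure N \<and>
           (\<forall>A\<in>sets borel. emeasure N A = killed_green Z (ball x0 r) x A)) \<and>
        (\<exists>D. kernel_density L (ball x0 r) (killed_green Z (ball x0 r)) D))"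

definition admissible_process :: "'h::metric_space measure \<Rightarrow> ('w, 'h) process \<Rightarrow> bool" where
  "admissible_process L Z \<longleftrightarrow>
     strong_markov_process Z \<and> irreducible_process Z \<and>
     (case clock Z of
        Discrete_Time \<Rightarrow> Isolated.discrete (UNIV :: 'h set)
      | Continuous_Time \<Rightarrow>
          path_connected (UNIV :: 'h set) \<and>
          (\<forall>x. AE \<omega> in law Z x. continuous_on {0..} (\<lambda>t. pos Z t \<omega>)) \<and>
          absolutely_continuous_process L Z)"

definition transient_process :: "('w, 'h::topological_space) process \<Rightarrow> bool" where
  "transient_process Z \<longleftrightarrow>
     (\<forall>x. \<exists>N. radon_measure N \<and> (\<forall>A\<in>sets borel. emeasure N A = green Z x A))"

definition green_function ::
    "'h::topological_space measure \<Rightarrow> ('w, 'h) process \<Rightarrow> ('h \<Rightarrow> 'h \<Rightarrow> real) \<Rightarrow> bool" where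
  "green_function L Z G \<longleftrightarrow>
     (case clock Z of
        Discrete_Time \<Rightarrow> (\<forall>x y. 0 \<le> G x y \<and> ennreal (G x y) = green Z x {y})
      | Continuous_Time \<Rightarrow> kernel_density L UNIV (green Z) G)"

definition locally_equicontinuous_kernels :: "('h::metric_space \<Rightarrow> 'h \<Rightarrow> real) \<Rightarrow> bool" where
  "locally_equicontinuous_kernels K \<longleftrightarrow>
     (\<forall>C. compact C \<longrightarrow> (\<forall>x\<in>C. \<forall>e>0. \<exists>d>0. \<forall>x'\<in>C. dist x x' < d \<longrightarrow>
        (\<forall>y. infdist y C \<ge> 1 \<longrightarrow> \<bar>K x y - K x' y\<bar> < e)))"

text \<open>\<open>Z\<close> is a transient process with Green function \<open>G\<close> and \<open>K\<close> is its Martin kernel with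
  respect to \<open>p\<close>.\<close>

definition transient_setting ::
    "'h::metric_space measure \<Rightarrow> ('w, 'h) process \<Rightarrow> ('h \<Rightarrow> 'h \<Rightarrow> real) \<Rightarrow> 'h \<Rightarrow> bool" where
  "transient_setting L Z G p \<longleftrightarrow>
     admissible_process L Z \<and> transient_process Z \<and> green_function L Z G \<and>
     (clock Z = Continuous_Time \<longrightarrow> locally_equicontinuous_kernels (martin_kernel G p))"


section \<open>Group actions\<close>

definition properly_discontinuous ::
    "('g, 'b) monoid_scheme \<Rightarrow> ('g \<Rightarrow> 'h::topological_space \<Rightarrow> 'h) \<Rightarrow> bool" where
  "properly_discontinuous \<Gamma> \<phi> \<longleftrightarrow>
     (\<forall>C. compact C \<longrightarrow> finite {g \<in> carrier \<Gamma>. \<phi> g ` C \<inter> C \<noteq> {}})"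

text \<open>Invariance of the process means that, under the law started at \<open>x\<close>, the image process under
  \<open>h\<close> has on path space the same distribution as the process started at \<open>h x\<close>.\<close>

definition process_automorphism ::
    "'h::metric_space measure \<Rightarrow> ('w, 'h) process \<Rightarrow> ('h \<Rightarrow> 'h) \<Rightarrow> bool" where
  "process_automorphism L Z h \<longleftrightarrow>
     bij h \<and> (\<forall>x y. dist (h x) (h y) = dist x y) \<and> distr L L h = L \<and>
     (\<forall>x. distr (law Z x) (PiM (times (clock Z)) (\<lambda>_. borel))
             (\<lambda>\<omega>. \<lambda>t\<in>times (clock Z). h (pos Z t \<omega>)) =
          distr (law Z (h x)) (PiM (times (clock Z)) (\<lambda>_. borel))
             (\<lambda>\<omega>. \<lambda>t\<in>times (clock Z). pos Z t \<omega>))"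

definition gromov_act :: "('h \<Rightarrow> 'h) \<Rightarrow> (nat \<Rightarrow> 'h) set \<Rightarrow> (nat \<Rightarrow> 'h) set" where
  "gromov_act h \<xi> = (\<lambda>s. h \<circ> s) ` \<xi>"

text \<open>The action of \<open>g\<close> on a Martin boundary sends the limit of \<open>K(\<cdot>, y\<^sub>n)\<close> to the limit of
  \<open>K(\<cdot>, g y\<^sub>n)\<close>. Since \<open>G(g x, g y) = G(x, y)\<close>, we have
  \<open>K(x, g y) = K(h x, y) / K(h p, y)\<close> with \<open>h\<close> the inverse of \<open>g\<close>.\<close>

definition martin_act ::
    "('g, 'b) monoid_scheme \<Rightarrow> ('g \<Rightarrow> 'h \<Rightarrow> 'h) \<Rightarrow> 'h set \<Rightarrow> 'h \<Rightarrow> 'g \<Rightarrow> ('h \<Rightarrow> real) \<Rightarrow> 'h \<Rightarrow> real" where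
  "martin_act \<Gamma> \<phi> Y p g \<kappa> = (\<lambda>x\<in>Y. \<kappa> (\<phi> (inv\<^bsub>\<Gamma>\<^esub> g) x) / \<kappa> (\<phi> (inv\<^bsub>\<Gamma>\<^esub> g) p))"

definition equivariant_on ::
    "('g, 'b) monoid_scheme \<Rightarrow> ('g \<Rightarrow> 'a \<Rightarrow> 'a) \<Rightarrow> ('g \<Rightarrow> 'c \<Rightarrow> 'c) \<Rightarrow> 'a set \<Rightarrow> ('a \<Rightarrow> 'c) \<Rightarrow> bool" where
  "equivariant_on \<Gamma> \<alpha> \<beta> S f \<longleftrightarrow> (\<forall>g\<in>carrier \<Gamma>. \<forall>\<xi>\<in>S. f (\<alpha> g \<xi>) = \<beta> g (f \<xi>))"


section \<open>Ancona processes\<close>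

text \<open>The map \<open>map_sum id f\<close> is the union of the identity of H with the boundary map \<open>f\<close>. In the last
  condition both the homeomorphism of the boundaries and its inverse extend the identity of H
  continuously, that is, \<open>map_sum id f\<close> is a homeomorphism of H with its Gromov boundary onto the
  Martin compactification. If H with its Gromov boundary is known to be compact, this is
  equivalent to continuity of the bijection \<open>map_sum id f\<close>.\<close>

definition ancona_process ::
    "('g, 'b) monoid_scheme \<Rightarrow> ('g \<Rightarrow> 'h \<Rightarrow> 'h) \<Rightarrow> 'h::metric_space measure \<Rightarrow> ('w, 'h) process \<Rightarrow>
     ('h \<Rightarrow> 'h \<Rightarrow> real) \<Rightarrow> 'h \<Rightarrow> bool" where
  "ancona_process \<Gamma> \<phi> L Z G p \<longleftrightarrow>
     transient_setting L Z G p \<and>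
     (\<exists>\<alpha>>0. \<exists>C1\<ge>1.
        (\<forall>x y. dist x y \<ge> 2 \<longrightarrow>
           green Z x (ball y 1) * green Z y (ball x 1) \<le> ennreal (C1 * exp (- \<alpha> * dist x y))) \<and>
        (\<forall>z. ennreal (1 / C1) \<le> green Z z (ball z 1) \<and> green Z z (ball z 1) \<le> ennreal C1)) \<and>
     (\<forall>r>0. \<forall>\<epsilon>>0. \<exists>C2>0. \<forall>x y z u v w.
        min (dist x y) (dist x z) > \<epsilon> \<and> max (dist y z) (dist v w) < r \<longrightarrow>
        G x y \<le> C2 * G x z \<and>
        green Z v (ball u 1) \<le> ennreal C2 * green Z w (ball u 1)) \<and>
     (\<forall>r\<ge>0. \<exists>C3>0. \<forall>x y z. dist x y \<ge> 2 \<and> gromov_product z x y \<le> r \<longrightarrow>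
        green Z x (ball y 1) \<le> ennreal C3 * green Z x (ball z 1) * green Z z (ball y 1)) \<and>
     (let K = martin_kernel G p; M = martin_topology UNIV (Collect compact) K in
      \<exists>f. equivariant_on \<Gamma> (\<lambda>g. gromov_act (\<phi> g)) (martin_act \<Gamma> \<phi> UNIV p) gromov_boundary f \<and>
          homeomorphic_map
            (subtopology (gromov_topology p) (Inr ` gromov_boundary))
            (subtopology M (Inr ` martin_boundary UNIV (Collect compact) K)) (map_sum id f) \<and>
          homeomorphic_map (gromov_topology p) M (map_sum id f))"


section \<open>Random walks\<close>

primrec walk :: "('h \<Rightarrow> 'h pmf) \<Rightarrow> nat \<Rightarrow> 'h \<Rightarrow> 'h pmf" where
  "walk \<mu> 0 x = return_pmf x"
| "walk \<mu> (Suc n) x = bind_pmf (walk \<mu> n x) \<mu>"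

definition irreducible_walk :: "'h set \<Rightarrow> ('h \<Rightarrow> 'h pmf) \<Rightarrow> bool" where
  "irreducible_walk X \<mu> \<longleftrightarrow> (\<forall>x\<in>X. \<forall>y\<in>X. \<exists>n. pmf (walk \<mu> n x) y > 0)"

definition transient_walk :: "'h set \<Rightarrow> ('h \<Rightarrow> 'h pmf) \<Rightarrow> bool" where
  "transient_walk X \<mu> \<longleftrightarrow> (\<forall>x\<in>X. \<forall>y\<in>X. summable (\<lambda>n. pmf (walk \<mu> n x) y))"

definition walk_green :: "('h \<Rightarrow> 'h pmf) \<Rightarrow> 'h \<Rightarrow> 'h \<Rightarrow> real" where
  "walk_green \<mu> x y = (\<Sum>n. pmf (walk \<mu> n x) y)"

definition FLS_restriction ::
    "('g, 'b) monoid_scheme \<Rightarrow> ('g \<Rightarrow> 'h \<Rightarrow> 'h) \<Rightarrow> ('h \<Rightarrow> 'h \<Rightarrow> real) \<Rightarrow> 'h \<Rightarrow>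
     'h set \<Rightarrow> ('h \<Rightarrow> 'h pmf) \<Rightarrow> bool" where
  "FLS_restriction \<Gamma> \<phi> G p X \<mu> \<longleftrightarrow>
     (\<forall>x\<in>X. set_pmf (\<mu> x) \<subseteq> X) \<and>
     (\<forall>g\<in>carrier \<Gamma>. \<forall>x\<in>X. \<mu> (\<phi> g x) = map_pmf (\<phi> g) (\<mu> x)) \<and>
     irreducible_walk X \<mu> \<and> transient_walk X \<mu> \<and>
     (\<forall>x\<in>X. \<forall>y\<in>X. y \<noteq> x \<and> y \<noteq> p \<longrightarrow>
        martin_kernel (walk_green \<mu>) p x y = martin_kernel G p x y)"

definition finite_subsets :: "'h set \<Rightarrow> 'h set set" where
  "finite_subsets X = {F. finite F \<and> F \<subseteq> X}"

definition walk_boundary :: "'h::topological_space \<Rightarrow> 'h set \<Rightarrow> ('h \<Rightarrow> 'h pmf) \<Rightarrow> ('h \<Rightarrow> real) set" where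
  "walk_boundary p X \<mu> =
     martin_boundary X (finite_subsets X) (martin_kernel (walk_green \<mu>) p)"

definition walk_topology ::
    "'h::topological_space \<Rightarrow> 'h set \<Rightarrow> ('h \<Rightarrow> 'h pmf) \<Rightarrow> ('h + ('h \<Rightarrow> real)) topology" where
  "walk_topology p X \<mu> =
     martin_topology X (finite_subsets X) (martin_kernel (walk_green \<mu>) p)"

end

theory Submission
  imports Defs "HOL-Complex_Analysis.Great_Picard"
begin

text \<open>By (A4) every point \<open>\<xi>\<close> of the Gromov boundary of H is a Martin kernel \<open>K(\<cdot>,\<xi>)\<close> on H, and the map
  sends \<open>\<xi>\<close> in the limit set of X to the restriction of this kernel to X. Since \<open>k = K\<close> on X off the
  diagonal, the restriction is a limit of the kernels of the random walk. Conversely, by (A2) and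
  Arzela-Ascoli, a divergent sequence in X has a subsequence along which \<open>K\<close> converges on H, and (A4)
  turns this into convergence to a point of the Gromov boundary. This gives surjectivity and
  the continuity of both directions, once the map is injective.

  Injectivity compares \<open>K(\<cdot>,\<xi>)\<close> and \<open>K(\<cdot>,\<eta>)\<close> at points \<open>x\<close> of X close to \<open>\<xi>\<close>. If \<open>z\<close> is a radial
  point for \<open>\<xi>\<close> such that \<open>p\<close>, \<open>z\<close>, \<open>x\<close> are almost aligned, then their quotient is at least a constant times
  \<open>1 / (G(p,z) G(z,p))\<close>, which is unbounded as \<open>z\<close> tends to \<open>\<xi>\<close>. The upper bounds on the
  Green function here are (A3); the lower bound \<open>G(x,z) G(z,y) \<le> C G(x,y)\<close> comes from the strong
  Markov property.\<close>

subsection \<open>Gromov products\<close>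

text \<open>H need not be geodesic, so there are no rays to follow. Points of H between
  \<open>p\<close> and \<xi>, up to a bounded error, are provided by radiality; the other arguments
  about position rest on the four-point inequality and its additive losses. The points that tell two
  kernels apart are taken from a sequence in X, while the radial points may lie anywhere in H. This
  is why the kernels still separate after restriction to X.

  (A3) and the Markov decomposition concern Green values of unit balls, whereas \<open>K\<close> is
  a quotient of the density \<open>G\<close>. The two are compared by averaging \<open>G x\<close>
  over the unit ball around the second argument; the mass of that ball depends on the second
  argument alone and cancels in \<open>K\<close>.

  On the topological side, continuity is tested on open sets whose interior part is the complement
  of a closed set, and boundary points are replaced by nearby points of X whenever a sequence has to
  converge.\<close>

definition gromov_far :: "'h::metric_space \<Rightarrow> (nat \<Rightarrow> 'h) \<Rightarrow> (nat \<Rightarrow> 'h) \<Rightarrow> bool" where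
  "gromov_far u s t \<longleftrightarrow> (\<forall>R. \<exists>N. \<forall>m\<ge>N. \<forall>n\<ge>N. R < gromov_product u (s m) (t n))"

lemma gromov_product_commute: "gromov_product u x y = gromov_product u y x"
  by (simp add: gromov_product_def dist_commute)

lemma gromov_product_le_dist: "gromov_product u x y \<le> dist u x"
  using dist_triangle[of u y x] by (simp add: gromov_product_def)

lemma gromov_product_lipschitz: "gromov_product u x y \<le> gromov_product u x' y + dist x x'"
  using dist_triangle[of u x x'] dist_triangle[of x' y x]
  by (simp add: gromov_product_def dist_commute field_simps)

lemma gromov_product_base: "gromov_product u x y \<le> gromov_product v x y + dist u v"
  using dist_triangle[of u x v] dist_triangle[of u y v]
  by (simp add: gromov_product_def dist_commute field_simps)

lemma gromov_far_base: "gromov_far u s t \<Longrightarrow> gromov_far v s t"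
  unfolding gromov_far_def
proof (intro allI)
  fix R assume *: "\<forall>R. \<exists>N. \<forall>m\<ge>N. \<forall>n\<ge>N. R < gromov_product u (s m) (t n)"
  then obtain N where "\<forall>m\<ge>N. \<forall>n\<ge>N. R + dist u v < gromov_product u (s m) (t n)" by blast
  then have "\<forall>m\<ge>N. \<forall>n\<ge>N. R < gromov_product v (s m) (t n)"
    using gromov_product_base[of u _ _ v] by (smt (verit))
  then show "\<exists>N. \<forall>m\<ge>N. \<forall>n\<ge>N. R < gromov_product v (s m) (t n)" by blast
qed

lemma gromov_far_commute: "gromov_far u s t \<Longrightarrow> gromov_far u t s"
  unfolding gromov_far_def by (metis gromov_product_commute)

lemma filterlim_prod_sequentially_iff_gromov_far:
  "filterlim (\<lambda>(m, n). gromov_product u (s m) (t n)) at_top (sequentially \<times>\<^sub>F sequentially) \<longleftrightarrow>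
     gromov_far u s t"
proof -
  have "(\<forall>\<^sub>F x in sequentially \<times>\<^sub>F sequentially. R < (case x of (m, n) \<Rightarrow> gromov_product u (s m) (t n)))
    \<longleftrightarrow> (\<exists>N. \<forall>m\<ge>N. \<forall>n\<ge>N. R < gromov_product u (s m) (t n))" for R
    unfolding eventually_prod_sequentially by auto
  then show ?thesis
    unfolding filterlim_at_top_dense gromov_far_def by simp
qed

text \<open>One base point suffices, since moving it changes a Gromov product by at most the
  distance moved.\<close>

lemma gromov_equiv_iff:
  "(s, t) \<in> gromov_equiv \<longleftrightarrow> gromov_far p s s \<and> gromov_far p t t \<and> gromov_far p s t"
  unfolding gromov_equiv_def Let_def filterlim_prod_sequentially_iff_gromov_far
  using gromov_far_base by auto

lemma gromov_hyperbolicD: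
  assumes "gromov_hyperbolic \<delta> (UNIV :: 'h::metric_space set)"
  shows "min (gromov_product u x z) (gromov_product u z y) - \<delta> \<le> gromov_product u (x::'h) y"
  using assms unfolding gromov_hyperbolic_def by (metis UNIV_I gromov_product_commute)

section \<open>Consequences of the four-point inequality: boundary classes and products at the
  boundary\<close>

context
  fixes \<delta> :: real
  assumes hyp: "gromov_hyperbolic \<delta> (UNIV :: 'h::metric_space set)"
begin

lemma hyperbolicity_constant_nonneg: "0 \<le> \<delta>"
  using gromov_hyperbolicD[OF hyp, of undefined undefined undefined undefined]
  by (simp add: gromov_product_def)

text \<open>Transitivity is where hyperbolicity enters the equivalence relation: one late term of
  \<open>t\<close> serves as the third point, at the cost of \<delta>.\<close>

lemma gromov_far_trans:
  fixes s t r :: "nat \<Rightarrow> 'h"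
  assumes "gromov_far u s t" "gromov_far u t r"
  shows "gromov_far u s r"
  unfolding gromov_far_def
proof
  fix R
  obtain N1 where 1: "\<forall>m\<ge>N1. \<forall>n\<ge>N1. R + \<delta> < gromov_product u (s m) (t n)"
    using assms(1) unfolding gromov_far_def by blast
  obtain N2 where 2: "\<forall>m\<ge>N2. \<forall>n\<ge>N2. R + \<delta> < gromov_product u (t m) (r n)"
    using assms(2) unfolding gromov_far_def by blast
  have "R < gromov_product u (s m) (r n)" if "m \<ge> max N1 N2" "n \<ge> max N1 N2" for m n
  proof -
    have "R + \<delta> < gromov_product u (s m) (t (max N1 N2))" "R + \<delta> < gromov_product u (t (max N1 N2)) (r n)"
      using 1 2 that by auto
    then show ?thesis
      using gromov_hyperbolicD[OF hyp, of u "s m" "t (max N1 N2)" "r n"] by linarith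
  qed
  then show "\<exists>N. \<forall>m\<ge>N. \<forall>n\<ge>N. R < gromov_product u (s m) (r n)" by blast
qed

lemma equiv_gromov_equiv: "equiv {s. (s, s) \<in> (gromov_equiv :: ((nat \<Rightarrow> 'h) \<times> _) set)} gromov_equiv"
proof (rule equivI)
  show "gromov_equiv \<subseteq> {s. (s, s) \<in> (gromov_equiv :: ((nat \<Rightarrow> 'h) \<times> _) set)} \<times> {s. (s, s) \<in> gromov_equiv}"
    by (auto simp: gromov_equiv_iff[of _ _ undefined])
  show "refl_on {s. (s, s) \<in> (gromov_equiv :: ((nat \<Rightarrow> 'h) \<times> _) set)} gromov_equiv"
    by (auto simp: refl_on_def)
  show "sym (gromov_equiv :: ((nat \<Rightarrow> 'h) \<times> _) set)"
    by (auto simp: sym_def gromov_equiv_iff[of _ _ undefined] intro: gromov_far_commute)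
  show "trans (gromov_equiv :: ((nat \<Rightarrow> 'h) \<times> _) set)"
    by (auto simp: trans_def gromov_equiv_iff[of _ _ undefined] intro: gromov_far_trans)
qed

lemma gromov_boundary_far:
  assumes "\<xi> \<in> gromov_boundary" "s \<in> \<xi>" "t \<in> \<xi>"
  shows "gromov_far u s (t :: nat \<Rightarrow> 'h)"
proof -
  have "(s, t) \<in> gromov_equiv"
    using assms quotient_eq_iff[OF equiv_gromov_equiv, of \<xi> \<xi> s t]
    unfolding gromov_boundary_def by blast
  then show ?thesis by (simp add: gromov_equiv_iff[of _ _ u])
qed

lemma gromov_far_self:
  fixes s t :: "nat \<Rightarrow> 'h"
  assumes "gromov_far u s t"
  shows "gromov_far u s s"
  using assms gromov_far_commute gromov_far_trans by blast

lemma gromov_boundary_mem: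
  assumes "\<xi> \<in> gromov_boundary" "s \<in> \<xi>" "gromov_far u s (t :: nat \<Rightarrow> 'h)"
  shows "t \<in> \<xi>"
proof -
  have "(s, t) \<in> gromov_equiv"
    using assms(3) gromov_far_self[OF assms(3)] gromov_far_self[OF gromov_far_commute[OF assms(3)]]
    by (simp add: gromov_equiv_iff[of _ _ u])
  then show ?thesis
    using assms in_quotient_imp_closed[OF equiv_gromov_equiv] unfolding gromov_boundary_def by blast
qed

lemma gromov_boundary_eq:
  assumes "\<xi> \<in> gromov_boundary" "\<eta> \<in> gromov_boundary" "s \<in> \<xi>" "t \<in> \<eta>" "gromov_far u s (t :: nat \<Rightarrow> 'h)"
  shows "\<xi> = \<eta>"
proof -
  have "(s, t) \<in> gromov_equiv"
    using assms(5) gromov_far_self[OF assms(5)] gromov_far_self[OF gromov_far_commute[OF assms(5)]]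
    by (simp add: gromov_equiv_iff[of _ _ u])
  then show ?thesis
    using assms quotient_eq_iff[OF equiv_gromov_equiv, of \<xi> \<eta> s t] unfolding gromov_boundary_def by blast
qed

lemma converges_to_ex:
  assumes "q \<in> UNIV <+> (gromov_boundary :: (nat \<Rightarrow> 'h) set set)"
  obtains s where "converges_to s q"
proof (cases q)
  case (Inl x)
  then have "converges_to (\<lambda>_. x) q" by (simp add: converges_to_def)
  with that show ?thesis by blast
next
  case (Inr \<xi>)
  then have "\<xi> \<noteq> {}"
    using assms in_quotient_imp_non_empty[OF equiv_gromov_equiv] unfolding gromov_boundary_def by blast
  with Inr that show ?thesis by (auto simp: converges_to_def)
qed

text \<open>Two sequences with the same limit are interchangeable in a Gromov product. At a boundary
  point this holds only below the level \<open>R\<close> up to which the two sequences have come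
  together, at the cost of \<delta>; at an interior point the terms are eventually within distance
  1, which accounts for the \<open>1\<close>.\<close>

lemma converges_to_close:
  assumes "q \<in> UNIV <+> (gromov_boundary :: (nat \<Rightarrow> 'h) set set)" "converges_to s q" "converges_to t q"
  shows "\<exists>N. \<forall>m\<ge>N. \<forall>n\<ge>N. \<forall>y. min (gromov_product u (t n) y) R - (\<delta> + 1) \<le> gromov_product u (s m) y"
proof (cases q)
  case (Inl x)
  then have "s \<longlonglongrightarrow> x" "t \<longlonglongrightarrow> x" using assms by (auto simp: converges_to_def)
  then obtain N1 N2 where N: "\<forall>m\<ge>N1. dist (s m) x < 1/2" "\<forall>m\<ge>N2. dist (t m) x < 1/2"
    unfolding lim_sequentially by (meson half_gt_zero zero_less_one)
  have "min (gromov_product u (t n) y) R - (\<delta> + 1) \<le> gromov_product u (s m) y"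
    if "m \<ge> max N1 N2" "n \<ge> max N1 N2" for m n y
  proof -
    have "dist (t n) (s m) \<le> 1"
      using N that dist_triangle[of "t n" "s m" x] by (smt (verit) dist_commute field_sum_of_halves max.bounded_iff)
    then show ?thesis
      using gromov_product_lipschitz[of u "t n" y "s m"] hyperbolicity_constant_nonneg by linarith
  qed
  then show ?thesis by blast
next
  case (Inr \<xi>)
  then have "gromov_far u s t" using assms gromov_boundary_far by (auto simp: converges_to_def)
  then obtain N where N: "\<forall>m\<ge>N. \<forall>n\<ge>N. R < gromov_product u (s m) (t n)"
    unfolding gromov_far_def by blast
  have "min (gromov_product u (t n) y) R - (\<delta> + 1) \<le> gromov_product u (s m) y"
    if "m \<ge> N" "n \<ge> N" for m n y
  proof -
    have "R < gromov_product u (s m) (t n)" using N that by blast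
    then show ?thesis
      using gromov_hyperbolicD[OF hyp, of u "s m" "t n" y] by linarith
  qed
  then show ?thesis by blast
qed

lemma ext_gromov_product_ge:
  fixes s t :: "nat \<Rightarrow> 'h"
  assumes "converges_to s q" "converges_to t r"
    and "\<forall>m\<ge>N. \<forall>n\<ge>N. R \<le> gromov_product u (s m) (t n)"
  shows "ereal R \<le> ext_gromov_product u q r"
proof -
  have "ereal R \<le> Liminf (sequentially \<times>\<^sub>F sequentially) (\<lambda>(m, n). ereal (gromov_product u (s m) (t n)))"
    using assms(3) by (intro Liminf_bounded) (auto simp: eventually_prod_sequentially)
  also have "\<dots> \<le> ext_gromov_product u q r"
    unfolding ext_gromov_product_def using assms(1,2) by (intro SUP_upper2[of "(s, t)"]) auto
  finally show ?thesis .
qed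

text \<open>The supremum is seen by some pair of sequences; any other pair sees it up to a constant.
  Each of the two replacements costs \<open>\<delta> + 1\<close> by
  \<open>converges_to_close\<close>, and one more unit makes the inequality strict.\<close>

lemma ext_gromov_product_gtD:
  fixes s t :: "nat \<Rightarrow> 'h"
  assumes q: "q \<in> UNIV <+> gromov_boundary" and r: "r \<in> UNIV <+> gromov_boundary"
    and gt: "ereal R < ext_gromov_product u q r"
    and s: "converges_to s q" and t: "converges_to t r"
  shows "\<exists>N. \<forall>m\<ge>N. \<forall>n\<ge>N. R - (2 * \<delta> + 3) < gromov_product u (s m) (t n)"
proof -
  from gt obtain s' t' where s't': "converges_to s' q" "converges_to t' r"
    and "ereal R < Liminf (sequentially \<times>\<^sub>F sequentially) (\<lambda>(m, n). ereal (gromov_product u (s' m) (t' n)))"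
    unfolding ext_gromov_product_def by (auto simp: less_SUP_iff)
  then have "eventually (\<lambda>(m, n). R < gromov_product u (s' m) (t' n)) (sequentially \<times>\<^sub>F sequentially)"
    by (auto dest!: less_LiminfD elim!: eventually_mono)
  then obtain N1 where 1: "\<forall>m\<ge>N1. \<forall>n\<ge>N1. R < gromov_product u (s' m) (t' n)"
    unfolding eventually_prod_sequentially by auto
  obtain N2 where 2: "\<forall>m\<ge>N2. \<forall>n\<ge>N2. \<forall>y. min (gromov_product u (s' n) y) R - (\<delta> + 1) \<le> gromov_product u (s m) y"
    using converges_to_close[OF q s s't'(1)] by blast
  obtain N3 where 3: "\<forall>m\<ge>N3. \<forall>n\<ge>N3. \<forall>y. min (gromov_product u (t' n) y) R - (\<delta> + 1) \<le> gromov_product u (t m) y"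
    using converges_to_close[OF r t s't'(2)] by blast
  define N where "N = max N1 (max N2 N3)"
  have "R - (2 * \<delta> + 3) < gromov_product u (s m) (t n)" if "m \<ge> N" "n \<ge> N" for m n
  proof -
    have "R < gromov_product u (s' N) (t' N)" using 1 unfolding N_def by auto
    moreover have "min (gromov_product u (s' N) (t' N)) R - (\<delta> + 1) \<le> gromov_product u (s m) (t' N)"
      using 2 that unfolding N_def by auto
    moreover have "min (gromov_product u (t' N) (s m)) R - (\<delta> + 1) \<le> gromov_product u (t n) (s m)"
      using 3 that unfolding N_def by auto
    ultimately show ?thesis
      using gromov_product_commute[of u "t' N" "s m"] gromov_product_commute[of u "t n" "s m"]
        hyperbolicity_constant_nonneg by linarith
  qed
  then show ?thesis by blast
qed

text \<open>The loss is \<open>2 * \<delta> + 3\<close> for passing to chosen sequences, \<delta>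
  for the four-point inequality and 1 for strictness after taking the supremum again.\<close>

lemma ext_gromov_product_ultra:
  fixes a b c :: "'h + (nat \<Rightarrow> 'h) set"
  assumes "a \<in> UNIV <+> gromov_boundary" "b \<in> UNIV <+> gromov_boundary" "c \<in> UNIV <+> gromov_boundary"
    and "ereal R < ext_gromov_product u a b" "ereal R < ext_gromov_product u b c"
  shows "ereal (R - (3 * \<delta> + 4)) < ext_gromov_product u a c"
proof -
  obtain s t r where str: "converges_to s a" "converges_to t b" "converges_to r c"
    using assms converges_to_ex by metis
  obtain N1 where 1: "\<forall>m\<ge>N1. \<forall>n\<ge>N1. R - (2 * \<delta> + 3) < gromov_product u (s m) (t n)"
    using ext_gromov_product_gtD[OF assms(1,2,4) str(1,2)] by blast
  obtain N2 where 2: "\<forall>m\<ge>N2. \<forall>n\<ge>N2. R - (2 * \<delta> + 3) < gromov_product u (t m) (r n)"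
    using ext_gromov_product_gtD[OF assms(2,3,5) str(2,3)] by blast
  have "R - (3 * \<delta> + 3) \<le> gromov_product u (s m) (r n)" if "m \<ge> max N1 N2" "n \<ge> max N1 N2" for m n
  proof -
    have "R - (2 * \<delta> + 3) < gromov_product u (s m) (t (max N1 N2))"
      "R - (2 * \<delta> + 3) < gromov_product u (t (max N1 N2)) (r n)"
      using 1 2 that by auto
    then show ?thesis
      using gromov_hyperbolicD[OF hyp, of u "s m" "t (max N1 N2)" "r n"] by linarith
  qed
  then have "ereal (R - (3 * \<delta> + 3)) \<le> ext_gromov_product u a c"
    using ext_gromov_product_ge[OF str(1,3), of "max N1 N2"] by blast
  then show ?thesis by (rule less_le_trans[rotated]) simp
qed

lemma ext_gromov_product_commute:
  "ext_gromov_product u a b = ext_gromov_product u b (a :: 'h + (nat \<Rightarrow> 'h) set)"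
proof -
  have *: "ext_gromov_product u a b \<le> ext_gromov_product u b a" for a b :: "'h + (nat \<Rightarrow> 'h) set"
    unfolding ext_gromov_product_def
  proof (rule SUP_mono, clarify)
    fix s t :: "nat \<Rightarrow> 'h" assume st: "converges_to s a" "converges_to t b"
    have "sequentially \<times>\<^sub>F sequentially = filtermap prod.swap (sequentially \<times>\<^sub>F (sequentially :: nat filter))"
      by (rule filter_eqI)
         (auto simp: eventually_filtermap eventually_prod_sequentially)
    then have "Liminf (sequentially \<times>\<^sub>F sequentially) (\<lambda>(m, n). ereal (gromov_product u (s m) (t n)))
      = Liminf (filtermap prod.swap (sequentially \<times>\<^sub>F sequentially)) (\<lambda>(m, n). ereal (gromov_product u (s m) (t n)))"
      by simp
    also have "\<dots> = Liminf (sequentially \<times>\<^sub>F sequentially) (\<lambda>(m, n). ereal (gromov_product u (t m) (s n)))"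
      by (subst Liminf_filtermap_eq)
         (auto simp: split_beta gromov_product_commute[of u "s _"] intro!: arg_cong[where f = "Liminf _"])
    finally show "\<exists>m\<in>{(s, t). converges_to s b \<and> converges_to t a}.
        Liminf (sequentially \<times>\<^sub>F sequentially) (\<lambda>(m, n). ereal (gromov_product u (s m) (t n)))
        \<le> (case m of (s, t) \<Rightarrow> Liminf (sequentially \<times>\<^sub>F sequentially) (\<lambda>(m, n). ereal (gromov_product u (s m) (t n))))"
      using st by (intro bexI[of _ "(t, s)"]) auto
  qed
  show ?thesis by (rule antisym) (rule *)+
qed

lemma ext_gromov_product_tends:
  assumes "\<xi> \<in> gromov_boundary" "s \<in> \<xi>"
  shows "\<forall>\<^sub>F n in sequentially. ereal R < ext_gromov_product u (Inl (s n :: 'h)) (Inr \<xi>)"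
proof -
  obtain N where N: "\<forall>m\<ge>N. \<forall>n\<ge>N. R + 1 < gromov_product u (s m) (s n)"
    using gromov_boundary_far[OF assms(1,2,2)] unfolding gromov_far_def by blast
  have "ereal R < ext_gromov_product u (Inl (s m)) (Inr \<xi>)" if "m \<ge> N" for m
  proof -
    have "ereal (R + 1) \<le> ext_gromov_product u (Inl (s m)) (Inr \<xi>)"
      using N that assms
      by (intro ext_gromov_product_ge[of "\<lambda>_. s m" _ s _ N]) (auto simp: converges_to_def intro: less_imp_le)
    then show ?thesis by (rule less_le_trans[rotated]) simp
  qed
  then show ?thesis unfolding eventually_sequentially by blast
qed

text \<open>Converse of \<open>ext_gromov_product_tends\<close>: entering all basic neighbourhoods
  of \<xi> is the same as belonging to the class \<xi>.\<close>

lemma gromov_boundary_memI: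
  fixes x :: "nat \<Rightarrow> 'h"
  assumes \<xi>: "\<xi> \<in> gromov_boundary"
    and x: "\<And>R. \<forall>\<^sub>F n in sequentially. ereal R < ext_gromov_product u (Inl (x n)) (Inr \<xi>)"
  shows "x \<in> \<xi>"
proof -
  obtain s where s: "s \<in> \<xi>"
    using converges_to_ex[of "Inr \<xi>"] \<xi> by (auto simp: converges_to_def)
  have "gromov_far u s x"
    unfolding gromov_far_def
  proof
    fix R
    obtain N1 where N1: "\<forall>n\<ge>N1. ereal (R + 3 * \<delta> + 3) < ext_gromov_product u (Inl (x n)) (Inr \<xi>)"
      using x unfolding eventually_sequentially by blast
    obtain N2 where N2: "\<forall>m\<ge>N2. \<forall>n\<ge>N2. R + \<delta> < gromov_product u (s m) (s n)"
      using gromov_boundary_far[OF \<xi> s s] unfolding gromov_far_def by blast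
    have "R < gromov_product u (s m) (x n)" if "m \<ge> max N1 N2" "n \<ge> max N1 N2" for m n
    proof -
      have "ereal (R + 3 * \<delta> + 3) < ext_gromov_product u (Inl (x n)) (Inr \<xi>)" using N1 that by auto
      then obtain N3 where N3: "\<forall>m\<ge>N3. \<forall>k\<ge>N3. R + 3 * \<delta> + 3 - (2 * \<delta> + 3) < gromov_product u (x n) (s k)"
        using ext_gromov_product_gtD[of "Inl (x n)" "Inr \<xi>" "R + 3 * \<delta> + 3" u "\<lambda>_. x n" s] \<xi> s
        by (auto simp: converges_to_def)
      \<comment> \<open>\<open>N3\<close> depends on \<open>n\<close>. This is harmless, because
        \<open>s (max N2 N3)\<close> is only the middle point of a four-point inequality for this
        one \<open>n\<close>.\<close>
      have "R + 3 * \<delta> + 3 - (2 * \<delta> + 3) < gromov_product u (x n) (s (max N2 N3))"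
        using N3 by (meson max.cobounded2)
      then have "R + \<delta> < gromov_product u (x n) (s (max N2 N3))" by simp
      moreover have "R + \<delta> < gromov_product u (s m) (s (max N2 N3))" using N2 that by auto
      ultimately show ?thesis
        using gromov_hyperbolicD[OF hyp, of u "s m" "s (max N2 N3)" "x n"]
          gromov_product_commute[of u "s (max N2 N3)" "x n"]
        by linarith
    qed
    then show "\<exists>N. \<forall>m\<ge>N. \<forall>n\<ge>N. R < gromov_product u (s m) (x n)" by blast
  qed
  then show ?thesis using gromov_boundary_mem[OF \<xi> s] by blast
qed

text \<open>The negation of \<open>gromov_far\<close> bounds the product only for some late pairs.
  By hyperbolicity a single large product among late pairs would make all of them large; passing
  from \<open>(m, n)\<close> to \<open>(k, l)\<close> takes two four-point inequalities, hence
  \<open>2 * \<delta>\<close>.\<close>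

lemma gromov_product_eventually_bounded:
  fixes s t :: "nat \<Rightarrow> 'h"
  assumes "\<xi> \<in> gromov_boundary" "\<eta> \<in> gromov_boundary" "s \<in> \<xi>" "t \<in> \<eta>" "\<xi> \<noteq> \<eta>"
  obtains r N where "\<And>m n. m \<ge> N \<Longrightarrow> n \<ge> N \<Longrightarrow> gromov_product u (s m) (t n) \<le> r"
proof -
  have "\<not> gromov_far u s t" using assms gromov_boundary_eq by blast
  then obtain R where R: "\<And>N. \<exists>m\<ge>N. \<exists>n\<ge>N. gromov_product u (s m) (t n) \<le> R"
    unfolding gromov_far_def by (meson not_less)
  obtain N1 where 1: "\<forall>m\<ge>N1. \<forall>n\<ge>N1. R + 2 * \<delta> < gromov_product u (s m) (s n)"
    using gromov_boundary_far[OF assms(1,3,3)] unfolding gromov_far_def by blast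
  obtain N2 where 2: "\<forall>m\<ge>N2. \<forall>n\<ge>N2. R + \<delta> < gromov_product u (t m) (t n)"
    using gromov_boundary_far[OF assms(2,4,4)] unfolding gromov_far_def by blast
  have "gromov_product u (s m) (t n) \<le> R + 2 * \<delta>" if "m \<ge> max N1 N2" "n \<ge> max N1 N2" for m n
  proof (rule ccontr)
    assume "\<not> ?thesis"
    then have gt: "R + 2 * \<delta> < gromov_product u (s m) (t n)" by simp
    obtain k l where kl: "k \<ge> max N1 N2" "l \<ge> max N1 N2" "gromov_product u (s k) (t l) \<le> R"
      using R by blast
    have "R + 2 * \<delta> < gromov_product u (s k) (s m)" "R + \<delta> < gromov_product u (t n) (t l)"
      using 1 2 kl that by auto
    then show False
      using gromov_hyperbolicD[OF hyp, of u "s k" "s m" "t n"] gromov_hyperbolicD[OF hyp, of u "s k" "t n" "t l"] gt kl(3)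
      by (smt (verit))
  qed
  then show ?thesis using that by blast
qed

end

section \<open>Carriers of the two topologies\<close>

lemma topspace_gromov_topology: "topspace (gromov_topology u) = UNIV <+> gromov_boundary"
proof
  show "topspace (gromov_topology u) \<subseteq> UNIV <+> gromov_boundary"
    using openin_gromov_topology[of u "topspace (gromov_topology u)"] by simp
  have "openin (gromov_topology u) (UNIV <+> gromov_boundary)"
  proof -
    have "(Inl -` (UNIV <+> (gromov_boundary :: (nat \<Rightarrow> 'a) set set)) :: 'a set) = UNIV" by auto
    then show ?thesis unfolding openin_gromov_topology by auto
  qed
  then show "UNIV <+> gromov_boundary \<subseteq> topspace (gromov_topology u)" by (rule openin_subset)
qed

lemma topspace_martin_topology: "topspace (martin_topology Y \<C> K) = Y <+> martin_boundary Y \<C> K"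
proof
  show "topspace (martin_topology Y \<C> K) \<subseteq> Y <+> martin_boundary Y \<C> K"
    using openin_martin_topology[of Y \<C> K "topspace (martin_topology Y \<C> K)"] by simp
  have "openin (martin_topology Y \<C> K) (Y <+> martin_boundary Y \<C> K)"
  proof -
    have "Inl -` (Y <+> martin_boundary Y \<C> K) = Y" by auto
    moreover have "martin_nbhd Y \<C> K (\<Union>{}) 1 \<kappa> \<subseteq> Y <+> martin_boundary Y \<C> K" for \<kappa>
      unfolding martin_nbhd_def by auto
    ultimately show ?thesis unfolding openin_martin_topology
      by (metis empty_subsetI finite.emptyI openin_subtopology_self order_refl zero_less_one)
  qed
  then show "Y <+> martin_boundary Y \<C> K \<subseteq> topspace (martin_topology Y \<C> K)" by (rule openin_subset)
qed

subsection \<open>Divergent sequences\<close>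

lemma divergent_seq_dist:
  fixes x :: "nat \<Rightarrow> 'h::metric_space"
  assumes "proper_space (UNIV :: 'h set)"
  shows "divergent_seq x \<longleftrightarrow> (\<forall>R. \<forall>\<^sub>F n in sequentially. R < dist p (x n))"
proof
  assume x: "divergent_seq x"
  show "\<forall>R. \<forall>\<^sub>F n in sequentially. R < dist p (x n)"
  proof
    fix R
    have "compact (cball p R)" using assms unfolding proper_space_def by simp
    then have "\<forall>\<^sub>F n in sequentially. x n \<notin> cball p R" using x unfolding divergent_seq_def by blast
    then show "\<forall>\<^sub>F n in sequentially. R < dist p (x n)" by (simp add: not_le)
  qed
next
  assume x: "\<forall>R. \<forall>\<^sub>F n in sequentially. R < dist p (x n)"
  show "divergent_seq x"
    unfolding divergent_seq_def
  proof (intro allI impI)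
    fix C :: "'h set" assume "compact C"
    then have "bounded C" by (rule compact_imp_bounded)
    then obtain R where "\<forall>y\<in>C. dist p y \<le> R" using bounded_any_center[of C p] by blast
    then show "\<forall>\<^sub>F n in sequentially. x n \<notin> C"
      using spec[OF x, of R] by (auto elim!: eventually_mono)
  qed
qed

lemma divergent_seq_subseq: "divergent_seq x \<Longrightarrow> strict_mono r \<Longrightarrow> divergent_seq (x \<circ> r)"
  unfolding divergent_seq_def by (auto dest: eventually_subseq simp: o_def)

lemma gromov_far_divergent:
  fixes x :: "nat \<Rightarrow> 'h::metric_space"
  assumes "proper_space (UNIV :: 'h set)" "gromov_far p x x"
  shows "divergent_seq x"
proof -
  have "\<forall>\<^sub>F n in sequentially. R < dist p (x n)" for R
  proof -
    obtain N where "\<forall>m\<ge>N. \<forall>n\<ge>N. R < gromov_product p (x m) (x n)"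
      using assms(2) unfolding gromov_far_def by blast
    then show ?thesis
      unfolding eventually_sequentially using gromov_product_le_dist[of p] by (meson less_le_trans)
  qed
  then show ?thesis using divergent_seq_dist[OF assms(1)] by blast
qed

text \<open>A divergent sequence has no accumulation point, so any selection of its terms can be
  removed from an open set without destroying openness.\<close>

lemma divergent_seq_closed:
  fixes x :: "nat \<Rightarrow> 'h::metric_space"
  assumes "proper_space (UNIV :: 'h set)" "divergent_seq x"
  shows "closed (x ` I)"
  unfolding closed_sequential_limits
proof (intro allI impI, elim conjE)
  fix y l assume y: "\<forall>n. y n \<in> x ` I" and lim: "y \<longlonglongrightarrow> l"
  have "\<forall>\<^sub>F n in sequentially. 1 < dist l (x n)"
    using assms divergent_seq_dist by blast
  then obtain N where N: "\<forall>n\<ge>N. 1 < dist l (x n)" unfolding eventually_sequentially by blast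
  have "\<forall>\<^sub>F n in sequentially. dist (y n) l < 1" using lim by (simp add: tendstoD)
  then have "\<forall>\<^sub>F n in sequentially. y n \<in> x ` (I \<inter> {..<N})"
  proof (rule eventually_mono)
    fix n assume n: "dist (y n) l < 1"
    obtain i where i: "i \<in> I" "y n = x i" using y by blast
    have "i < N" using N n i by (metis dist_commute not_less not_less_iff_gr_or_eq)
    then show "y n \<in> x ` (I \<inter> {..<N})" using i by blast
  qed
  moreover have "closed (x ` (I \<inter> {..<N}))" by (intro finite_imp_closed) simp
  ultimately have "l \<in> x ` (I \<inter> {..<N})"
    using lim by (intro Lim_in_closed_set) auto
  then show "l \<in> x ` I" by blast
qed

lemma gromov_boundary_divergent:
  fixes x :: "nat \<Rightarrow> 'h::metric_space"
  assumes "gromov_hyperbolic \<delta> (UNIV :: 'h set)" "proper_space (UNIV :: 'h set)"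
    "\<xi> \<in> gromov_boundary" "x \<in> \<xi>"
  shows "divergent_seq x"
  using gromov_far_divergent[OF assms(2)] gromov_boundary_far[OF assms(1,3,4,4)] by blast

subsection \<open>Integration over the time set\<close>

lemma space_time_measure: "space (time_measure c) = times c"
  by (cases c) (auto simp: space_restrict_space)

lemma sigma_finite_time_measure: "sigma_finite_measure (time_measure c)"
proof (cases c)
  case Discrete_Time
  have "countable (\<nat> :: real set)" unfolding Nats_def by simp
  then show ?thesis using Discrete_Time by (simp add: sigma_finite_measure_count_space_countable)
next
  case Continuous_Time
  then show ?thesis
    by (simp add: sigma_finite_measure_restrict_space sigma_finite_lborel)
qed

lemma times_nonneg: "t \<in> times c \<Longrightarrow> 0 \<le> t"
  by (cases c) (auto elim: Nats_cases)

lemma times_add: "s \<in> times c \<Longrightarrow> t \<in> times c \<Longrightarrow> s + t \<in> times c"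
  by (cases c) auto

lemma times_diff: "s \<in> times c \<Longrightarrow> t \<in> times c \<Longrightarrow> s \<le> t \<Longrightarrow> t - s \<in> times c"
  by (cases c) (auto elim!: Nats_cases simp: of_nat_diff[symmetric] simp del: of_nat_diff)

text \<open>Translation invariance of counting and Lebesgue measure; the cut-off keeps the shifted
  time in the time set. It converts time counted from the start into time counted from a
  visit.\<close>

lemma nn_integral_time_shift:
  assumes a: "a \<in> times c" and D: "D \<in> borel_measurable (time_measure c)"
  shows "(\<integral>\<^sup>+t. (if a \<le> t then D (t - a) else 0) \<partial>time_measure c) = (\<integral>\<^sup>+t. D t \<partial>time_measure c)"
proof (cases c)
  case Discrete_Time
  have bij: "bij_betw (\<lambda>s. s + a) \<nat> {t \<in> \<nat>. a \<le> t}"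
  proof (rule bij_betwI[where g = "\<lambda>t. t - a"])
    show "(\<lambda>t. t - a) \<in> {t \<in> \<nat>. a \<le> t} \<rightarrow> \<nat>"
      using times_diff[of a c] a Discrete_Time by auto
    show "(\<lambda>s. s + a) \<in> \<nat> \<rightarrow> {t \<in> \<nat>. a \<le> t}"
      using times_add[of _ c a] times_nonneg[of _ c] a Discrete_Time by auto
  qed auto
  have "(\<integral>\<^sup>+t. (if a \<le> t then D (t - a) else 0) \<partial>count_space \<nat>)
      = (\<integral>\<^sup>+t. (if a \<le> t then D (t - a) else 0) \<partial>count_space {t \<in> \<nat>. a \<le> t})"
    by (rule nn_integral_count_space_eq) auto
  also have "\<dots> = (\<integral>\<^sup>+s. (if a \<le> s + a then D (s + a - a) else 0) \<partial>count_space \<nat>)"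
    by (rule nn_integral_bij_count_space[OF bij, symmetric])
  also have "\<dots> = (\<integral>\<^sup>+s. D s \<partial>count_space \<nat>)"
    by (intro nn_integral_cong) (auto elim: Nats_cases)
  finally show ?thesis using Discrete_Time by simp
next
  case Continuous_Time
  have a0: "0 \<le> a" using a Continuous_Time by simp
  define g where "g = (\<lambda>s. D s * indicator {0..} s)"
  have g: "g \<in> borel_measurable borel"
    using D Continuous_Time unfolding g_def
    by (simp add: borel_measurable_restrict_space_iff_ennreal)
  have "(\<integral>\<^sup>+t. (if a \<le> t then D (t - a) else 0) \<partial>restrict_space lborel {0..})
      = (\<integral>\<^sup>+t. (if a \<le> t then D (t - a) else 0) * indicator {0..} t \<partial>lborel)"
    by (rule nn_integral_restrict_space) simp
  also have "\<dots> = (\<integral>\<^sup>+t. g (- a + 1 * t) \<partial>lborel)"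
    using a0 by (intro nn_integral_cong) (auto simp: g_def indicator_def)
  also have "\<dots> = (\<integral>\<^sup>+t. g t \<partial>lborel)"
    using nn_integral_real_affine[OF g, of 1 "- a"] by simp
  also have "\<dots> = (\<integral>\<^sup>+t. D t \<partial>restrict_space lborel {0..})"
    unfolding g_def by (rule nn_integral_restrict_space[symmetric]) simp
  finally show ?thesis using Continuous_Time by simp
qed

subsection \<open>Transition probabilities\<close>

definition trans_prob :: "('w, 'h) process \<Rightarrow> 'h \<Rightarrow> real \<Rightarrow> 'h set \<Rightarrow> ennreal" where
  "trans_prob Z x t A = emeasure (law Z x) {\<omega> \<in> samples Z. pos Z t \<omega> \<in> A}"

text \<open>The grid times \<open>j * h\<close> stand in for the hitting time of \<open>B\<close>.
  The event belongs to the past of the deterministic time \<open>j * h\<close>, so the Markov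
  property at constant times applies to it.\<close>

definition first_visit :: "('w, 'h) process \<Rightarrow> real \<Rightarrow> 'h set \<Rightarrow> nat \<Rightarrow> 'w set" where
  "first_visit Z h B j = {\<omega> \<in> samples Z. pos Z (real j * h) \<omega> \<in> B \<and> (\<forall>i<j. pos Z (real i * h) \<omega> \<notin> B)}"

definition visit_prob ::
    "('w, 'h) process \<Rightarrow> 'h \<Rightarrow> real \<Rightarrow> 'h set \<Rightarrow> 'h set \<Rightarrow> nat \<Rightarrow> real \<Rightarrow> ennreal" where
  "visit_prob Z x h B A j s = emeasure (law Z x) {\<omega> \<in> first_visit Z h B j. pos Z (real j * h + s) \<omega> \<in> A}"

text \<open>Here \<open>t\<close> counts from the start, while \<open>s\<close> in
  \<open>visit_prob\<close> counts from the first visit.\<close>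

definition visited_prob :: "('w, 'h) process \<Rightarrow> 'h \<Rightarrow> real \<Rightarrow> 'h set \<Rightarrow> 'h set \<Rightarrow> real \<Rightarrow> ennreal" where
  "visited_prob Z x h B A t = emeasure (law Z x)
     {\<omega> \<in> samples Z. pos Z t \<omega> \<in> A \<and> (\<exists>j. real j * h \<le> t \<and> pos Z (real j * h) \<omega> \<in> B)}"

lemma green_eq: "green Z x A = (\<integral>\<^sup>+t. trans_prob Z x t A \<partial>time_measure (clock Z))"
  by (simp add: green_def trans_prob_def)

lemma grid_floor_tendsto:
  assumes "0 \<le> (t::real)"
  shows "(\<lambda>n. real (nat \<lfloor>t * real (Suc n)\<rfloor>) / real (Suc n)) \<longlonglongrightarrow> t"
proof (rule tendsto_sandwich)
  show "\<forall>\<^sub>F n in sequentially. t - 1 / real (Suc n) \<le> real (nat \<lfloor>t * real (Suc n)\<rfloor>) / real (Suc n)"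
  proof (intro always_eventually allI)
    fix n
    have "t * real (Suc n) - 1 \<le> real (nat \<lfloor>t * real (Suc n)\<rfloor>)" using assms by linarith
    then have "(t * real (Suc n) - 1) / real (Suc n) \<le> real (nat \<lfloor>t * real (Suc n)\<rfloor>) / real (Suc n)"
      by (rule divide_right_mono) simp
    then show "t - 1 / real (Suc n) \<le> real (nat \<lfloor>t * real (Suc n)\<rfloor>) / real (Suc n)"
      by (simp add: diff_divide_distrib del: of_nat_Suc)
  qed
  show "\<forall>\<^sub>F n in sequentially. real (nat \<lfloor>t * real (Suc n)\<rfloor>) / real (Suc n) \<le> t"
    using assms by (intro always_eventually allI) (simp add: divide_le_eq)
  show "(\<lambda>n. t - 1 / real (Suc n)) \<longlonglongrightarrow> t"
    using tendsto_diff[OF tendsto_const[of t] LIMSEQ_inverse_real_of_nat] by (simp add: inverse_eq_divide)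
qed simp

lemma disjoint_first_visit: "disjoint_family (first_visit Z h B)"
  unfolding disjoint_family_on_def first_visit_def
  by (auto simp: disjoint_iff) (metis linorder_neqE_nat)

lemma first_visit_ex:
  assumes "\<omega> \<in> samples Z" "0 \<le> h"
  shows "(\<exists>j. real j * h \<le> t \<and> \<omega> \<in> first_visit Z h B j) \<longleftrightarrow> (\<exists>j. real j * h \<le> t \<and> pos Z (real j * h) \<omega> \<in> B)"
proof
  assume "\<exists>j. real j * h \<le> t \<and> pos Z (real j * h) \<omega> \<in> B"
  then obtain j where j: "real j * h \<le> t" "pos Z (real j * h) \<omega> \<in> B" by blast
  define k where "k = (LEAST i. pos Z (real i * h) \<omega> \<in> B)"
  have "pos Z (real k * h) \<omega> \<in> B" unfolding k_def using j(2) by (rule LeastI)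
  moreover have "pos Z (real i * h) \<omega> \<notin> B" if "i < k" for i
    using that unfolding k_def by (rule not_less_Least)
  moreover have "k \<le> j" unfolding k_def using j(2) by (rule Least_le)
  then have "real k * h \<le> real j * h" using \<open>0 \<le> h\<close> by (intro mult_right_mono) auto
  ultimately show "\<exists>j. real j * h \<le> t \<and> \<omega> \<in> first_visit Z h B j"
    using j assms unfolding first_visit_def by (intro exI[of _ k]) auto
qed (auto simp: first_visit_def)

context
  fixes L :: "'h::metric_space measure" and Z :: "('w, 'h) process"
  assumes adm: "admissible_process L Z"
begin

lemma admissible_strong_markov: "strong_markov_process Z"
  using adm by (simp add: admissible_process_def)

lemma law_admissible: "prob_space (law Z x)" "sets (law Z x) = sets (sample_space Z)" "space (law Z x) = samples Z"
proof -
  show "prob_space (law Z x)" and sets: "sets (law Z x) = sets (sample_space Z)"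
    using admissible_strong_markov unfolding strong_markov_process_def by blast+
  show "space (law Z x) = samples Z" using sets by (rule sets_eq_imp_space_eq)
qed

lemma pos_measurable: "t \<in> times (clock Z) \<Longrightarrow> pos Z t \<in> sample_space Z \<rightarrow>\<^sub>M borel"
  using admissible_strong_markov unfolding strong_markov_process_def by blast

lemma pos_measurable_law: "t \<in> times (clock Z) \<Longrightarrow> pos Z t \<in> law Z x \<rightarrow>\<^sub>M borel"
  using pos_measurable by (simp add: measurable_cong_sets[OF law_admissible(2) refl])

lemma pos_sets_law: "t \<in> times (clock Z) \<Longrightarrow> A \<in> sets borel \<Longrightarrow> {\<omega> \<in> samples Z. pos Z t \<omega> \<in> A} \<in> sets (law Z x)"
  using measurable_sets_Collect[OF pos_measurable_law, of t "\<lambda>y. y \<in> A" x] by (simp add: law_admissible(3))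

lemma trans_prob_measurable:
  "t \<in> times (clock Z) \<Longrightarrow> A \<in> sets borel \<Longrightarrow> (\<lambda>x. trans_prob Z x t A) \<in> borel_measurable borel"
  using admissible_strong_markov unfolding strong_markov_process_def trans_prob_def by blast

lemma trans_prob_nn_integral:
  assumes "t \<in> times (clock Z)" "A \<in> sets borel"
  shows "trans_prob Z x t A = (\<integral>\<^sup>+\<omega>. indicator A (pos Z t \<omega>) \<partial>law Z x)"
proof -
  have "trans_prob Z x t A = (\<integral>\<^sup>+\<omega>. indicator {\<omega> \<in> samples Z. pos Z t \<omega> \<in> A} \<omega> \<partial>law Z x)"
    unfolding trans_prob_def using pos_sets_law[OF assms] by simp
  also have "\<dots> = (\<integral>\<^sup>+\<omega>. indicator A (pos Z t \<omega>) \<partial>law Z x)"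
    by (intro nn_integral_cong) (auto simp: indicator_def law_admissible(3))
  finally show ?thesis .
qed

lemma indicator_pos_measurable:
  "t \<in> times (clock Z) \<Longrightarrow> A \<in> sets borel \<Longrightarrow>
    (\<lambda>\<omega>. indicator A (pos Z t \<omega>) :: ennreal) \<in> borel_measurable (law Z x)"
  using pos_measurable_law by (intro measurable_compose[OF pos_measurable_law] borel_measurable_indicator) auto

text \<open>Path continuity makes \<open>trans_prob\<close> of a ball lower semicontinuous in time; the slightly
  smaller balls turn this into a limit along a countable set of times.\<close>

lemma trans_prob_ball_limit:
  assumes clk: "clock Z = Continuous_Time" and s: "\<And>n. 0 \<le> s n" and t: "s \<longlonglongrightarrow> t"
  shows "trans_prob Z x t (ball y r) =
    (SUP k. liminf (\<lambda>n. trans_prob Z x (s n) (ball y (r - 1 / real (Suc k)))))"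
proof (rule antisym)
  have t0: "0 \<le> t" using s t by (meson LIMSEQ_le_const)
  have tm: "t \<in> times (clock Z)" "s n \<in> times (clock Z)" for n using t0 s clk by auto
  have cont: "AE \<omega> in law Z x. (\<lambda>n. pos Z (s n) \<omega>) \<longlonglongrightarrow> pos Z t \<omega>"
  proof -
    have "AE \<omega> in law Z x. continuous_on {0..} (\<lambda>t. pos Z t \<omega>)"
      using adm clk unfolding admissible_process_def by simp
    then show ?thesis
      by (rule AE_mp) (use s t0 in \<open>auto intro!: AE_I2 continuous_on_tendsto_compose[OF _ t]\<close>)
  qed
  have union: "{\<omega> \<in> samples Z. pos Z t \<omega> \<in> ball y r}
      = (\<Union>k. {\<omega> \<in> samples Z. pos Z t \<omega> \<in> ball y (r - 1 / real (Suc k))})"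
  proof -
    have "(\<exists>k. d < r - 1 / real (Suc k)) \<longleftrightarrow> d < r" for d
    proof
      assume "d < r"
      then obtain k where "1 / real (Suc k) < r - d"
        using reals_Archimedean[of "r - d"] by (auto simp: inverse_eq_divide)
      then show "\<exists>k. d < r - 1 / real (Suc k)" by (intro exI[of _ k]) linarith
    next
      assume "\<exists>k. d < r - 1 / real (Suc k)"
      then obtain k where "d < r - 1 / real (Suc k)" ..
      moreover have "0 < 1 / real (Suc k)" by simp
      ultimately show "d < r" by linarith
    qed
    then show ?thesis by auto
  qed
  have "trans_prob Z x t (ball y r)
      = (SUP k. emeasure (law Z x) {\<omega> \<in> samples Z. pos Z t \<omega> \<in> ball y (r - 1 / real (Suc k))})"
    unfolding trans_prob_def union
  proof (rule SUP_emeasure_incseq[symmetric])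
    show "range (\<lambda>k. {\<omega> \<in> samples Z. pos Z t \<omega> \<in> ball y (r - 1 / real (Suc k))}) \<subseteq> sets (law Z x)"
      by (intro image_subsetI pos_sets_law[OF tm(1)]) simp
    show "incseq (\<lambda>k. {\<omega> \<in> samples Z. pos Z t \<omega> \<in> ball y (r - 1 / real (Suc k))})"
    proof (rule incseq_SucI)
      fix k
      have "1 / real (Suc (Suc k)) \<le> 1 / real (Suc k)" by (intro divide_left_mono) auto
      then show "{\<omega> \<in> samples Z. pos Z t \<omega> \<in> ball y (r - 1 / real (Suc k))}
          \<subseteq> {\<omega> \<in> samples Z. pos Z t \<omega> \<in> ball y (r - 1 / real (Suc (Suc k)))}"
        by auto
    qed
  qed
  also have "\<dots> \<le> (SUP k. liminf (\<lambda>n. trans_prob Z x (s n) (ball y (r - 1 / real (Suc k)))))"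
  proof (rule SUP_mono, rule bexI[OF _ UNIV_I])
    fix k :: nat
    define U where "U = ball y (r - 1 / real (Suc k))"
    have U: "open U" "U \<in> sets borel" unfolding U_def by auto
    have "emeasure (law Z x) {\<omega> \<in> samples Z. pos Z t \<omega> \<in> U} = (\<integral>\<^sup>+\<omega>. indicator U (pos Z t \<omega>) \<partial>law Z x)"
      using trans_prob_nn_integral[OF tm(1) U(2)] by (simp add: trans_prob_def)
    also have "\<dots> \<le> (\<integral>\<^sup>+\<omega>. liminf (\<lambda>n. indicator U (pos Z (s n) \<omega>)) \<partial>law Z x)"
    proof (rule nn_integral_mono_AE)
      show "AE \<omega> in law Z x. (indicator U (pos Z t \<omega>) :: ennreal) \<le> liminf (\<lambda>n. indicator U (pos Z (s n) \<omega>))"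
        using cont
      proof eventually_elim
        fix \<omega> assume lim: "(\<lambda>n. pos Z (s n) \<omega>) \<longlonglongrightarrow> pos Z t \<omega>"
        show "(indicator U (pos Z t \<omega>) :: ennreal) \<le> liminf (\<lambda>n. indicator U (pos Z (s n) \<omega>))"
        proof (cases "pos Z t \<omega> \<in> U")
          case True
          then have "\<forall>\<^sub>F n in sequentially. pos Z (s n) \<omega> \<in> U"
            using topological_tendstoD[OF lim U(1)] by simp
          then show ?thesis
            using True by (intro Liminf_bounded) (auto elim!: eventually_mono)
        qed simp
      qed
    qed
    also have "\<dots> \<le> liminf (\<lambda>n. \<integral>\<^sup>+\<omega>. indicator U (pos Z (s n) \<omega>) \<partial>law Z x)"
      using indicator_pos_measurable[OF tm(2) U(2)] by (rule nn_integral_liminf)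
    also have "\<dots> = liminf (\<lambda>n. trans_prob Z x (s n) U)"
      using trans_prob_nn_integral[OF tm(2) U(2)] by simp
    finally show "emeasure (law Z x) {\<omega> \<in> samples Z. pos Z t \<omega> \<in> ball y (r - 1 / real (Suc k))}
        \<le> liminf (\<lambda>n. trans_prob Z x (s n) (ball y (r - 1 / real (Suc k))))"
      unfolding U_def .
  qed
  finally show "trans_prob Z x t (ball y r)
    \<le> (SUP k. liminf (\<lambda>n. trans_prob Z x (s n) (ball y (r - 1 / real (Suc k)))))" .
  show "(SUP k. liminf (\<lambda>n. trans_prob Z x (s n) (ball y (r - 1 / real (Suc k)))))
    \<le> trans_prob Z x t (ball y r)"
  proof (rule SUP_least)
    fix k :: nat
    define U where "U = ball y (r - 1 / real (Suc k))"
    have U: "U \<in> sets borel" unfolding U_def by auto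
    have "liminf (\<lambda>n. trans_prob Z x (s n) U) \<le> limsup (\<lambda>n. trans_prob Z x (s n) U)"
      by (rule Liminf_le_Limsup) simp
    also have "\<dots> = limsup (\<lambda>n. \<integral>\<^sup>+\<omega>. indicator U (pos Z (s n) \<omega>) \<partial>law Z x)"
      using trans_prob_nn_integral[OF tm(2) U] by simp
    also have "\<dots> \<le> (\<integral>\<^sup>+\<omega>. limsup (\<lambda>n. indicator U (pos Z (s n) \<omega>)) \<partial>law Z x)"
    proof (rule nn_integral_limsup[where w = "\<lambda>_. 1"])
      show "(\<integral>\<^sup>+\<omega>. 1 \<partial>law Z x) < \<infinity>"
        using prob_space.emeasure_space_1[OF law_admissible(1)[of x]] by simp
    qed (use indicator_pos_measurable[OF tm(2) U] in \<open>auto simp: indicator_def\<close>)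
    also have "\<dots> \<le> (\<integral>\<^sup>+\<omega>. indicator (ball y r) (pos Z t \<omega>) \<partial>law Z x)"
    proof (rule nn_integral_mono_AE)
      show "AE \<omega> in law Z x. limsup (\<lambda>n. indicator U (pos Z (s n) \<omega>)) \<le> (indicator (ball y r) (pos Z t \<omega>) :: ennreal)"
        using cont
      proof eventually_elim
        fix \<omega> assume lim: "(\<lambda>n. pos Z (s n) \<omega>) \<longlonglongrightarrow> pos Z t \<omega>"
        show "limsup (\<lambda>n. indicator U (pos Z (s n) \<omega>)) \<le> (indicator (ball y r) (pos Z t \<omega>) :: ennreal)"
        proof (cases "pos Z t \<omega> \<in> ball y r")
          case True
          then show ?thesis by (intro Limsup_bounded) (auto simp: indicator_def)
        next
          \<comment> \<open>Outside \<open>ball y r\<close> the limit lies in the complement of a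
            strictly smaller closed ball. This complement is open, so the path is eventually in it;
            that is the purpose of the shrunken radii.\<close>
          case False
          moreover have "0 < 1 / real (Suc k)" by simp
          ultimately have "pos Z t \<omega> \<in> - cball y (r - 1 / real (Suc k))"
            unfolding mem_ball mem_cball Compl_iff by linarith
          then have "\<forall>\<^sub>F n in sequentially. pos Z (s n) \<omega> \<in> - cball y (r - 1 / real (Suc k))"
            by (intro topological_tendstoD[OF lim]) auto
          then have "\<forall>\<^sub>F n in sequentially. (indicator U (pos Z (s n) \<omega>) :: ennreal) \<le> 0"
            by eventually_elim (auto simp: U_def)
          then have "limsup (\<lambda>n. indicator U (pos Z (s n) \<omega>) :: ennreal) \<le> 0"
            by (rule Limsup_bounded)
          then show ?thesis by simp
        qed
      qed
    qed
    also have "\<dots> = trans_prob Z x t (ball y r)"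
      by (rule trans_prob_nn_integral[symmetric]) (use tm in auto)
    finally show "liminf (\<lambda>n. trans_prob Z x (s n) (ball y (r - 1 / real (Suc k)))) \<le> trans_prob Z x t (ball y r)"
      unfolding U_def .
  qed
qed

text \<open>Joint measurability is what Fubini needs. Rounding time down to a grid leaves countably
  many times, for each of which measurability in \<open>x\<close> is given;
  \<open>trans_prob_ball_limit\<close> passes to the limit.\<close>

lemma trans_prob_ball_measurable:
  "(\<lambda>(t, x). trans_prob Z x t (ball y r)) \<in> borel_measurable (time_measure (clock Z) \<Otimes>\<^sub>M borel)"
proof (cases "clock Z")
  case Discrete_Time
  have "countable (\<nat> :: real set)" unfolding Nats_def by simp
  then have "(\<lambda>(t, x). trans_prob Z x t (ball y r)) \<in> borel_measurable (count_space \<nat> \<Otimes>\<^sub>M borel)"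
    by (rule measurable_pair_measure_countable1) (simp add: trans_prob_measurable Discrete_Time)
  then show ?thesis using Discrete_Time by simp
next
  case Continuous_Time
  define M where "M = time_measure (clock Z) \<Otimes>\<^sub>M (borel :: 'h measure)"
  have fst_M[measurable]: "fst \<in> M \<rightarrow>\<^sub>M borel"
  proof -
    have "(\<lambda>t. t) \<in> time_measure (clock Z) \<rightarrow>\<^sub>M borel"
      using Continuous_Time by (simp add: measurable_restrict_space1)
    then show ?thesis unfolding M_def by (rule measurable_compose[OF measurable_fst])
  qed
  have snd_M: "snd \<in> M \<rightarrow>\<^sub>M borel" unfolding M_def by simp
  define s where "s = (\<lambda>n t. real (nat \<lfloor>t * real (Suc n)\<rfloor>) / real (Suc n))"
  have meas: "(\<lambda>z. trans_prob Z (snd z) (s n (fst z)) (ball y \<rho>)) \<in> borel_measurable M" for n \<rho>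
    unfolding s_def
  proof (rule measurable_compose_countable[where g = "\<lambda>z. nat \<lfloor>fst z * real (Suc n)\<rfloor>"])
    show "(\<lambda>z. trans_prob Z (snd z) (real i / real (Suc n)) (ball y \<rho>)) \<in> borel_measurable M" for i
      by (rule measurable_compose[OF snd_M], rule trans_prob_measurable) (use Continuous_Time in auto)
    show "(\<lambda>z. nat \<lfloor>fst z * real (Suc n)\<rfloor>) \<in> M \<rightarrow>\<^sub>M count_space UNIV"
      by measurable
  qed
  have "(\<lambda>z. SUP k. liminf (\<lambda>n. trans_prob Z (snd z) (s n (fst z)) (ball y (r - 1 / real (Suc k)))))
      \<in> borel_measurable M"
    using meas by (intro borel_measurable_SUP borel_measurable_liminf) auto
  moreover have "(\<lambda>(t, x). trans_prob Z x t (ball y r)) z =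
      (SUP k. liminf (\<lambda>n. trans_prob Z (snd z) (s n (fst z)) (ball y (r - 1 / real (Suc k)))))"
    if "z \<in> space M" for z
  proof -
    have "0 \<le> fst z"
      using that Continuous_Time unfolding M_def by (auto simp: space_pair_measure space_restrict_space)
    then have "(\<lambda>n. s n (fst z)) \<longlonglongrightarrow> fst z" "\<And>n. 0 \<le> s n (fst z)"
      unfolding s_def using grid_floor_tendsto by auto
    then show ?thesis
      using trans_prob_ball_limit[OF Continuous_Time] by (simp add: split_beta)
  qed
  ultimately have "(\<lambda>(t, x). trans_prob Z x t (ball y r)) \<in> borel_measurable M"
    by (subst measurable_cong)
  then show ?thesis unfolding M_def .
qed

text \<open>A constant time is a stopping time, and both \<open>E\<close> and the event for the
  position are measurable before completion. The strong Markov property thus becomes the simple one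
  for the laws themselves.\<close>

lemma markov_constant_time:
  assumes a: "a \<in> times (clock Z)" and t: "t \<in> times (clock Z)" and A: "A \<in> sets borel"
    and E: "E \<in> sets (natural_filtration Z (ennreal a))"
  shows "emeasure (law Z x) {\<omega> \<in> E. pos Z (a + t) \<omega> \<in> A} =
    (\<integral>\<^sup>+\<omega>. trans_prob Z (pos Z a \<omega>) t A * indicator E \<omega> \<partial>law Z x)"
proof -
  interpret filtration "samples Z" "natural_filtration Z" by (rule filtration_natural)
  have a0: "0 \<le> a" using a by (rule times_nonneg)
  have strong_markov: "strong_markov Z" using admissible_strong_markov unfolding strong_markov_process_def by blast
  have T: "stopping_time (natural_filtration Z) (\<lambda>_. ennreal a)"
    unfolding stopping_time_def by simp
  have E': "E \<in> sets (pre_sigma (\<lambda>_. ennreal a))"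
  proof (rule sets_pre_sigmaI[OF T])
    fix s
    show "{\<omega> \<in> E. ennreal a \<le> s} \<in> sets (natural_filtration Z s)"
      using sets_F_mono[of "ennreal a" s] E by (cases "ennreal a \<le> s") auto
  qed
  have sub: "E \<in> sets (law Z x)"
  proof -
    have "sets (natural_filtration Z (ennreal a)) \<subseteq> sets (sample_space Z)"
      unfolding natural_filtration_def
    proof (subst sets_measure_of)
      show "sigma_sets (samples Z) {pos Z t -` A \<inter> samples Z |t A. t \<in> times (clock Z) \<and> ennreal t \<le> ennreal a \<and> A \<in> sets borel}
        \<subseteq> sets (sample_space Z)"
        by (rule sets.sigma_sets_subset) (auto intro: measurable_sets[OF pos_measurable])
    qed auto
    then show ?thesis using E law_admissible(2) by auto
  qed
  have "emeasure (completion (law Z x)) {\<omega> \<in> E. ennreal a < \<infinity> \<and> pos Z (enn2real (ennreal a) + t) \<omega> \<in> A} =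
        (\<integral>\<^sup>+\<omega>. emeasure (law Z (pos Z (enn2real (ennreal a)) \<omega>)) {\<omega>' \<in> samples Z. pos Z t \<omega>' \<in> A}
                * indicator {\<omega> \<in> E. ennreal a < \<infinity>} \<omega> \<partial>completion (law Z x))"
    using strong_markov[unfolded strong_markov_def, rule_format, of "\<lambda>_. ennreal a" t A E x] T a t A E' a0
    by simp
  then have eq: "emeasure (completion (law Z x)) {\<omega> \<in> E. pos Z (a + t) \<omega> \<in> A} =
      (\<integral>\<^sup>+\<omega>. trans_prob Z (pos Z a \<omega>) t A * indicator E \<omega> \<partial>law Z x)"
    using a0 by (simp add: nn_integral_completion trans_prob_def)
  have "{\<omega> \<in> E. pos Z (a + t) \<omega> \<in> A} = E \<inter> {\<omega> \<in> samples Z. pos Z (a + t) \<omega> \<in> A}"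
    using sets.sets_into_space[OF sub] by (auto simp: law_admissible(3))
  also have "\<dots> \<in> sets (law Z x)"
    using sub pos_sets_law[OF times_add[OF a t] A] by blast
  finally show ?thesis using eq by simp
qed

subsection \<open>Decomposition at the first visit of a time grid\<close>

lemma first_visit_in_filtration:
  assumes h: "\<And>j. real j * h \<in> times (clock Z)" "0 \<le> h" and B: "B \<in> sets borel"
  shows "first_visit Z h B j \<in> sets (natural_filtration Z (ennreal (real j * h)))"
proof -
  have vis: "{\<omega> \<in> samples Z. pos Z (real i * h) \<omega> \<in> B} \<in> sets (natural_filtration Z (ennreal (real j * h)))"
    if "i \<le> j" for i
  proof -
    have "real i * h \<le> real j * h" using that h by (intro mult_right_mono) auto
    then have "pos Z (real i * h) -` B \<inter> samples Z \<in> sets (natural_filtration Z (ennreal (real j * h)))"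
      unfolding natural_filtration_def using h B
      by (subst sets_measure_of) (auto intro!: sigma_sets.Basic exI[of _ "real i * h"] ennreal_leI)
    then show ?thesis by (simp add: vimage_def Int_def conj_commute)
  qed
  have sp: "space (natural_filtration Z s) = samples Z" for s
    using filtration_natural by (rule filtration.space_F)
  have "first_visit Z h B j = {\<omega> \<in> samples Z. pos Z (real j * h) \<omega> \<in> B}
      - (\<Union>i<j. {\<omega> \<in> samples Z. pos Z (real i * h) \<omega> \<in> B})"
    unfolding first_visit_def by auto
  also have "\<dots> \<in> sets (natural_filtration Z (ennreal (real j * h)))"
    using vis by (intro sets.Diff sets.finite_UN) auto
  finally show ?thesis .
qed

lemma first_visit_sets:
  assumes h: "\<And>j. real j * h \<in> times (clock Z)" and B: "B \<in> sets borel"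
  shows "first_visit Z h B j \<in> sets (law Z x)"
proof -
  have "first_visit Z h B j = {\<omega> \<in> samples Z. pos Z (real j * h) \<omega> \<in> B}
      - (\<Union>i<j. {\<omega> \<in> samples Z. pos Z (real i * h) \<omega> \<in> B})"
    unfolding first_visit_def by auto
  also have "\<dots> \<in> sets (law Z x)"
    using pos_sets_law[OF h B] by (intro sets.Diff sets.finite_UN) auto
  finally show ?thesis .
qed

end

lemma time_shift_measurable:
  assumes a: "a \<in> times c" and D: "D \<in> borel_measurable (time_measure c)"
  shows "(\<lambda>t. if a \<le> t then D (t - a) else (0::ennreal)) \<in> borel_measurable (time_measure c)"
proof (cases c)
  case Continuous_Time
  \<comment> \<open>The maximum keeps the argument in the time set, where \<open>D\<close> is known
    to be measurable; for \<open>a \<le> t\<close> it changes nothing.\<close>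
  have "(\<lambda>t. max 0 (t - a)) \<in> restrict_space lborel {0..} \<rightarrow>\<^sub>M restrict_space lborel {0..}"
    by (intro measurable_restrict_space2 measurable_restrict_space1) auto
  then have "(\<lambda>t. D (max 0 (t - a))) \<in> borel_measurable (restrict_space lborel {0..})"
    using D Continuous_Time by (auto intro: measurable_compose)
  moreover have "Measurable.pred (restrict_space lborel {0..}) (\<lambda>t. a \<le> t)"
    by (intro measurable_restrict_space1) auto
  ultimately have "(\<lambda>t. if a \<le> t then D (max 0 (t - a)) else 0) \<in> borel_measurable (restrict_space lborel {0..})"
    unfolding pred_def by (intro measurable_If) auto
  also have "(\<lambda>t. if a \<le> t then D (max 0 (t - a)) else 0) = (\<lambda>t. if a \<le> t then D (t - a) else 0)"
    by (auto simp: fun_eq_iff max_def)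
  finally show ?thesis using Continuous_Time by simp
qed simp

context
  fixes L :: "'h::metric_space measure" and Z :: "('w, 'h) process"
  assumes adm: "admissible_process L Z"
begin

lemma green_ball_measurable: "(\<lambda>x. green Z x (ball y r)) \<in> borel_measurable borel"
proof -
  interpret sigma_finite_measure "time_measure (clock Z)" by (rule sigma_finite_time_measure)
  have "(\<lambda>(x, t). trans_prob Z x t (ball y r)) \<in> borel_measurable (borel \<Otimes>\<^sub>M time_measure (clock Z))"
    using measurable_compose[OF measurable_pair_swap' trans_prob_ball_measurable[OF adm, of y r]]
    by (simp add: split_beta)
  then show ?thesis unfolding green_eq by (rule borel_measurable_nn_integral)
qed

context
  fixes x y :: 'h and r h :: real and B :: "'h set"
  assumes h: "\<And>j. real j * h \<in> times (clock Z)" "0 \<le> h" and B: "B \<in> sets borel"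
begin

text \<open>Restart the process at the time \<open>j * h\<close> by the Markov property, then
  exchange the integrals: the time spent in the ball after the visit integrates to the Green value
  at the position of the visit.\<close>

lemma visit_prob_integral:
  "visit_prob Z x h B (ball y r) j \<in> borel_measurable (time_measure (clock Z))"
  "(\<integral>\<^sup>+s. visit_prob Z x h B (ball y r) j s \<partial>time_measure (clock Z)) =
    (\<integral>\<^sup>+\<omega>. green Z (pos Z (real j * h) \<omega>) (ball y r) * indicator (first_visit Z h B j) \<omega> \<partial>law Z x)"
proof -
  define T where "T = time_measure (clock Z)"
  define M where "M = law Z x"
  interpret T: sigma_finite_measure T unfolding T_def by (rule sigma_finite_time_measure)
  interpret M: prob_space M unfolding M_def by (rule law_admissible(1)[OF adm])
  interpret TM: pair_sigma_finite T M ..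
  define f where "f = (\<lambda>s \<omega>. trans_prob Z (pos Z (real j * h) \<omega>) s (ball y r) * indicator (first_visit Z h B j) \<omega>)"
  have E: "first_visit Z h B j \<in> sets M" unfolding M_def by (rule first_visit_sets[OF adm h(1) B])
  have pos: "pos Z (real j * h) \<in> M \<rightarrow>\<^sub>M borel" unfolding M_def by (rule pos_measurable_law[OF adm h(1)])
  have "(\<lambda>p. (fst p, pos Z (real j * h) (snd p))) \<in> T \<Otimes>\<^sub>M M \<rightarrow>\<^sub>M T \<Otimes>\<^sub>M borel"
    by (intro measurable_Pair measurable_fst measurable_compose[OF measurable_snd pos])
  from measurable_compose[OF this, of "\<lambda>(t, x). trans_prob Z x t (ball y r)"]
  have "(\<lambda>p. trans_prob Z (pos Z (real j * h) (snd p)) (fst p) (ball y r)) \<in> borel_measurable (T \<Otimes>\<^sub>M M)"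
    using trans_prob_ball_measurable[OF adm] unfolding T_def by (simp add: split_beta)
  moreover have "(\<lambda>p. indicator (first_visit Z h B j) (snd p) :: ennreal) \<in> borel_measurable (T \<Otimes>\<^sub>M M)"
    using E by (intro measurable_compose[OF measurable_snd]) auto
  ultimately have f: "case_prod f \<in> borel_measurable (T \<Otimes>\<^sub>M M)"
    unfolding f_def split_beta by (rule borel_measurable_times_ennreal)
  have eq: "visit_prob Z x h B (ball y r) j s = (\<integral>\<^sup>+\<omega>. f s \<omega> \<partial>M)" if "s \<in> times (clock Z)" for s
    unfolding visit_prob_def f_def M_def
    by (rule markov_constant_time[OF adm h(1) that _ first_visit_in_filtration[OF adm h B]]) simp
  have "(\<lambda>s. \<integral>\<^sup>+\<omega>. f s \<omega> \<partial>M) \<in> borel_measurable T"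
    using f by (rule M.borel_measurable_nn_integral)
  then show "visit_prob Z x h B (ball y r) j \<in> borel_measurable (time_measure (clock Z))"
    unfolding T_def by (subst measurable_cong[OF eq]) (simp_all add: space_time_measure)
  have "(\<integral>\<^sup>+s. visit_prob Z x h B (ball y r) j s \<partial>T) = (\<integral>\<^sup>+s. \<integral>\<^sup>+\<omega>. f s \<omega> \<partial>M \<partial>T)"
    by (intro nn_integral_cong eq) (simp add: T_def space_time_measure)
  also have "\<dots> = (\<integral>\<^sup>+\<omega>. \<integral>\<^sup>+s. f s \<omega> \<partial>T \<partial>M)"
    using TM.Fubini'[OF f] by simp
  also have "\<dots> = (\<integral>\<^sup>+\<omega>. green Z (pos Z (real j * h) \<omega>) (ball y r) * indicator (first_visit Z h B j) \<omega> \<partial>M)"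
    by (intro nn_integral_cong) (auto simp: f_def green_eq T_def indicator_def)
  finally show "(\<integral>\<^sup>+s. visit_prob Z x h B (ball y r) j s \<partial>time_measure (clock Z)) =
    (\<integral>\<^sup>+\<omega>. green Z (pos Z (real j * h) \<omega>) (ball y r) * indicator (first_visit Z h B j) \<omega> \<partial>law Z x)"
    unfolding T_def M_def .
qed

text \<open>The event is partitioned by the index of the first visit. If some visit occurs by time
  \<open>t\<close>, so does the first one.\<close>

lemma visited_prob_eq:
  assumes t: "t \<in> times (clock Z)"
  shows "visited_prob Z x h B (ball y r) t = (\<Sum>j. if real j * h \<le> t then visit_prob Z x h B (ball y r) j (t - real j * h) else 0)"
proof -
  define S where "S = (\<lambda>j. if real j * h \<le> t then {\<omega> \<in> first_visit Z h B j. pos Z t \<omega> \<in> ball y r} else {})"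
  have "S j \<in> sets (law Z x)" for j
  proof -
    have "{\<omega> \<in> first_visit Z h B j. pos Z t \<omega> \<in> ball y r}
        = first_visit Z h B j \<inter> {\<omega> \<in> samples Z. pos Z t \<omega> \<in> ball y r}"
      unfolding first_visit_def by auto
    also have "\<dots> \<in> sets (law Z x)"
      using first_visit_sets[OF adm h(1) B] pos_sets_law[OF adm t, of "ball y r"] by (intro sets.Int) auto
    finally show ?thesis unfolding S_def by simp
  qed
  then have S: "range S \<subseteq> sets (law Z x)" by blast
  have dis: "disjoint_family S"
  proof (rule disjoint_family_subset[OF disjoint_first_visit[of Z h B]])
    show "S i \<subseteq> first_visit Z h B i" for i unfolding S_def by auto
  qed
  have "{\<omega> \<in> samples Z. pos Z t \<omega> \<in> ball y r \<and> (\<exists>j. real j * h \<le> t \<and> pos Z (real j * h) \<omega> \<in> B)} = (\<Union>j. S j)"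
  proof -
    have "(\<Union>j. S j) = {\<omega> \<in> samples Z. pos Z t \<omega> \<in> ball y r \<and> (\<exists>j. real j * h \<le> t \<and> \<omega> \<in> first_visit Z h B j)}"
      unfolding S_def first_visit_def by (auto split: if_splits)
    then show ?thesis
      using first_visit_ex[OF _ h(2), of _ Z t B] by (simp cong: conj_cong)
  qed
  then have "visited_prob Z x h B (ball y r) t = emeasure (law Z x) (\<Union>j. S j)"
    unfolding visited_prob_def by simp
  also have "\<dots> = (\<Sum>j. emeasure (law Z x) (S j))"
    by (rule suminf_emeasure[OF S dis, symmetric])
  also have "\<dots> = (\<Sum>j. if real j * h \<le> t then visit_prob Z x h B (ball y r) j (t - real j * h) else 0)"
    by (intro suminf_cong) (simp add: S_def visit_prob_def)
  finally show ?thesis .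
qed

lemma visited_prob_measurable: "visited_prob Z x h B (ball y r) \<in> borel_measurable (time_measure (clock Z))"
proof -
  have "(\<lambda>t. \<Sum>j. if real j * h \<le> t then visit_prob Z x h B (ball y r) j (t - real j * h) else 0)
      \<in> borel_measurable (time_measure (clock Z))"
    by (intro borel_measurable_suminf_order time_shift_measurable h visit_prob_integral)
  then show ?thesis
    by (subst measurable_cong[OF visited_prob_eq]) (simp_all add: space_time_measure)
qed

lemma visited_prob_integral:
  "(\<integral>\<^sup>+t. visited_prob Z x h B (ball y r) t \<partial>time_measure (clock Z)) =
    (\<Sum>j. \<integral>\<^sup>+\<omega>. green Z (pos Z (real j * h) \<omega>) (ball y r) * indicator (first_visit Z h B j) \<omega> \<partial>law Z x)"
proof -
  have "(\<integral>\<^sup>+t. visited_prob Z x h B (ball y r) t \<partial>time_measure (clock Z)) =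
      (\<integral>\<^sup>+t. (\<Sum>j. if real j * h \<le> t then visit_prob Z x h B (ball y r) j (t - real j * h) else 0) \<partial>time_measure (clock Z))"
    by (intro nn_integral_cong visited_prob_eq) (simp add: space_time_measure)
  also have "\<dots> = (\<Sum>j. \<integral>\<^sup>+t. (if real j * h \<le> t then visit_prob Z x h B (ball y r) j (t - real j * h) else 0) \<partial>time_measure (clock Z))"
    by (intro nn_integral_suminf time_shift_measurable h visit_prob_integral)
  also have "\<dots> = (\<Sum>j. \<integral>\<^sup>+s. visit_prob Z x h B (ball y r) j s \<partial>time_measure (clock Z))"
    by (intro suminf_cong nn_integral_time_shift h visit_prob_integral)
  finally show ?thesis unfolding visit_prob_integral .
qed

text \<open>The first-visit events are disjoint, so their sum is the probability of ever meeting
  \<open>B\<close> on the grid. This number also occurs in \<open>visited_prob_lower\<close> and is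
  eliminated between the two bounds, which leaves constants independent of \<open>h\<close>.\<close>

lemma visited_prob_upper:
  assumes "\<And>w. w \<in> B \<Longrightarrow> green Z w (ball y r) \<le> c"
  shows "(\<integral>\<^sup>+t. visited_prob Z x h B (ball y r) t \<partial>time_measure (clock Z)) \<le> c * (\<Sum>j. emeasure (law Z x) (first_visit Z h B j))"
proof -
  have "(\<integral>\<^sup>+\<omega>. green Z (pos Z (real j * h) \<omega>) (ball y r) * indicator (first_visit Z h B j) \<omega> \<partial>law Z x)
      \<le> c * emeasure (law Z x) (first_visit Z h B j)" for j
  proof -
    have "(\<integral>\<^sup>+\<omega>. green Z (pos Z (real j * h) \<omega>) (ball y r) * indicator (first_visit Z h B j) \<omega> \<partial>law Z x)
        \<le> (\<integral>\<^sup>+\<omega>. c * indicator (first_visit Z h B j) \<omega> \<partial>law Z x)"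
      using assms by (intro nn_integral_mono) (auto simp: indicator_def first_visit_def)
    also have "\<dots> = c * emeasure (law Z x) (first_visit Z h B j)"
      by (rule nn_integral_cmult_indicator[OF first_visit_sets[OF adm h(1) B]])
    finally show ?thesis .
  qed
  then have "(\<integral>\<^sup>+t. visited_prob Z x h B (ball y r) t \<partial>time_measure (clock Z)) \<le> (\<Sum>j. c * emeasure (law Z x) (first_visit Z h B j))"
    unfolding visited_prob_integral by (intro suminf_le) auto
  then show ?thesis by simp
qed

text \<open>Time spent in the ball after a visit of \<open>B\<close> is part of the total time spent
  there, which is the Green value at \<open>x\<close>.\<close>

lemma visited_prob_lower:
  assumes "\<And>w. w \<in> B \<Longrightarrow> a \<le> c * green Z w (ball y r)"
  shows "(\<Sum>j. emeasure (law Z x) (first_visit Z h B j)) * a \<le> c * green Z x (ball y r)"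
proof -
  have "emeasure (law Z x) (first_visit Z h B j) * a
      \<le> c * (\<integral>\<^sup>+\<omega>. green Z (pos Z (real j * h) \<omega>) (ball y r) * indicator (first_visit Z h B j) \<omega> \<partial>law Z x)" for j
  proof -
    have E: "first_visit Z h B j \<in> sets (law Z x)" by (rule first_visit_sets[OF adm h(1) B])
    have "emeasure (law Z x) (first_visit Z h B j) * a = (\<integral>\<^sup>+\<omega>. a * indicator (first_visit Z h B j) \<omega> \<partial>law Z x)"
      by (simp add: nn_integral_cmult_indicator[OF E] mult.commute)
    also have "\<dots> \<le> (\<integral>\<^sup>+\<omega>. c * (green Z (pos Z (real j * h) \<omega>) (ball y r) * indicator (first_visit Z h B j) \<omega>) \<partial>law Z x)"
      using assms by (intro nn_integral_mono) (auto simp: indicator_def first_visit_def)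
    also have "\<dots> = c * (\<integral>\<^sup>+\<omega>. green Z (pos Z (real j * h) \<omega>) (ball y r) * indicator (first_visit Z h B j) \<omega> \<partial>law Z x)"
      using E by (intro nn_integral_cmult borel_measurable_times_ennreal borel_measurable_indicator
          measurable_compose[OF pos_measurable_law[OF adm h(1)] green_ball_measurable])
    finally show ?thesis .
  qed
  then have "(\<Sum>j. emeasure (law Z x) (first_visit Z h B j) * a)
      \<le> (\<Sum>j. c * (\<integral>\<^sup>+\<omega>. green Z (pos Z (real j * h) \<omega>) (ball y r) * indicator (first_visit Z h B j) \<omega> \<partial>law Z x))"
    by (intro suminf_le) auto
  then have "(\<Sum>j. emeasure (law Z x) (first_visit Z h B j)) * a \<le> c * (\<integral>\<^sup>+t. visited_prob Z x h B (ball y r) t \<partial>time_measure (clock Z))"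
    unfolding visited_prob_integral by simp
  also have "(\<integral>\<^sup>+t. visited_prob Z x h B (ball y r) t \<partial>time_measure (clock Z)) \<le> green Z x (ball y r)"
    unfolding green_eq
  proof (rule nn_integral_mono)
    fix t assume "t \<in> space (time_measure (clock Z))"
    then have "t \<in> times (clock Z)" by (simp add: space_time_measure)
    then show "visited_prob Z x h B (ball y r) t \<le> trans_prob Z x t (ball y r)"
      unfolding visited_prob_def trans_prob_def
      using pos_sets_law[OF adm, of t "ball y r"] by (intro emeasure_mono) auto
  qed
  then have "c * (\<integral>\<^sup>+t. visited_prob Z x h B (ball y r) t \<partial>time_measure (clock Z)) \<le> c * green Z x (ball y r)"
    by (rule mult_left_mono) simp
  finally show ?thesis .
qed

end

text \<open>A continuous path that is in the open ball at time \<open>t\<close> is in it at grid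
  times close to \<open>t\<close> once the mesh is small. Fatou's lemma, over paths and then over
  time, gives the estimate. In discrete time mesh 1 already contains \<open>t\<close>.\<close>

lemma visited_prob_limit:
  obtains h where "\<And>k j. real j * h k \<in> times (clock Z)" "\<And>k. 0 \<le> h k"
    "green Z x (ball z r) \<le> liminf (\<lambda>k. \<integral>\<^sup>+t. visited_prob Z x (h k) (ball z r) (ball z r) t \<partial>time_measure (clock Z))"
proof -
  define h where "h = (\<lambda>k. case clock Z of Discrete_Time \<Rightarrow> 1 | Continuous_Time \<Rightarrow> 1 / real (Suc k))"
  have h: "real j * h k \<in> times (clock Z)" "0 \<le> h k" for j k
    unfolding h_def by (cases "clock Z"; simp)+
  let ?B = "ball z r"
  have "green Z x ?B \<le> (\<integral>\<^sup>+t. liminf (\<lambda>k. visited_prob Z x (h k) ?B ?B t) \<partial>time_measure (clock Z))"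
    unfolding green_eq
  proof (rule nn_integral_mono)
    fix t assume "t \<in> space (time_measure (clock Z))"
    then have t: "t \<in> times (clock Z)" by (simp add: space_time_measure)
    define V where "V = (\<lambda>k. {\<omega> \<in> samples Z. pos Z t \<omega> \<in> ?B \<and> (\<exists>j. real j * h k \<le> t \<and> pos Z (real j * h k) \<omega> \<in> ?B)})"
    have V: "V k \<in> sets (law Z x)" for k
    proof -
      have "V k = {\<omega> \<in> samples Z. pos Z t \<omega> \<in> ?B} \<inter>
          (\<Union>j\<in>{j. real j * h k \<le> t}. {\<omega> \<in> samples Z. pos Z (real j * h k) \<omega> \<in> ?B})"
        unfolding V_def by auto
      also have "\<dots> \<in> sets (law Z x)"
        by (intro sets.Int sets.countable_UN'' pos_sets_law[OF adm] t h) simp_all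
      finally show ?thesis .
    qed
    have ev: "AE \<omega> in law Z x. \<omega> \<in> samples Z \<longrightarrow> pos Z t \<omega> \<in> ?B \<longrightarrow> (\<forall>\<^sub>F k in sequentially. \<omega> \<in> V k)"
    proof (cases "clock Z")
      case Discrete_Time
      then obtain j where "t = real j" using t by (auto elim: Nats_cases)
      then show ?thesis unfolding V_def h_def using Discrete_Time by (auto intro!: AE_I2 exI[of _ j])
    next
      case Continuous_Time
      then have t0: "0 \<le> t" using t by simp
      have "AE \<omega> in law Z x. continuous_on {0..} (\<lambda>t. pos Z t \<omega>)"
        using adm Continuous_Time unfolding admissible_process_def by simp
      then show ?thesis
      proof eventually_elim
        fix \<omega> assume cont: "continuous_on {0..} (\<lambda>t. pos Z t \<omega>)"
        show "\<omega> \<in> samples Z \<longrightarrow> pos Z t \<omega> \<in> ?B \<longrightarrow> (\<forall>\<^sub>F k in sequentially. \<omega> \<in> V k)"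
        proof (intro impI)
          assume \<omega>: "\<omega> \<in> samples Z" "pos Z t \<omega> \<in> ?B"
          \<comment> \<open>Time is rounded down, so that the grid time does not exceed
            \<open>t\<close>.\<close>
          have "(\<lambda>k. pos Z (real (nat \<lfloor>t * real (Suc k)\<rfloor>) / real (Suc k)) \<omega>) \<longlonglongrightarrow> pos Z t \<omega>"
            using t0 by (intro continuous_on_tendsto_compose[OF cont grid_floor_tendsto]) auto
          then have "\<forall>\<^sub>F k in sequentially. pos Z (real (nat \<lfloor>t * real (Suc k)\<rfloor>) / real (Suc k)) \<omega> \<in> ?B"
            using \<omega>(2) by (rule topological_tendstoD[OF _ open_ball])
          then show "\<forall>\<^sub>F k in sequentially. \<omega> \<in> V k"
          proof eventually_elim
            fix k assume k: "pos Z (real (nat \<lfloor>t * real (Suc k)\<rfloor>) / real (Suc k)) \<omega> \<in> ?B"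
            have "real (nat \<lfloor>t * real (Suc k)\<rfloor>) / real (Suc k) \<le> t"
              using t0 by (simp add: divide_le_eq)
            then show "\<omega> \<in> V k"
              unfolding V_def h_def using \<omega> k Continuous_Time
              by (auto intro!: exI[of _ "nat \<lfloor>t * real (Suc k)\<rfloor>"])
          qed
        qed
      qed
    qed
    have "trans_prob Z x t ?B = (\<integral>\<^sup>+\<omega>. indicator ?B (pos Z t \<omega>) \<partial>law Z x)"
      by (rule trans_prob_nn_integral[OF adm t]) simp
    also have "\<dots> \<le> (\<integral>\<^sup>+\<omega>. liminf (\<lambda>k. indicator (V k) \<omega>) \<partial>law Z x)"
    proof (rule nn_integral_mono_AE)
      show "AE \<omega> in law Z x. (indicator ?B (pos Z t \<omega>) :: ennreal) \<le> liminf (\<lambda>k. indicator (V k) \<omega>)"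
        using ev AE_space
      proof eventually_elim
        fix \<omega> assume \<omega>: "\<omega> \<in> samples Z \<longrightarrow> pos Z t \<omega> \<in> ?B \<longrightarrow> (\<forall>\<^sub>F k in sequentially. \<omega> \<in> V k)"
          "\<omega> \<in> space (law Z x)"
        show "(indicator ?B (pos Z t \<omega>) :: ennreal) \<le> liminf (\<lambda>k. indicator (V k) \<omega>)"
        proof (cases "pos Z t \<omega> \<in> ?B")
          case True
          then have "\<forall>\<^sub>F k in sequentially. \<omega> \<in> V k" using \<omega> law_admissible(3)[OF adm] by blast
          then show ?thesis using True by (intro Liminf_bounded) (auto elim!: eventually_mono)
        qed simp
      qed
    qed
    also have "\<dots> \<le> liminf (\<lambda>k. \<integral>\<^sup>+\<omega>. indicator (V k) \<omega> \<partial>law Z x)"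
      using V by (intro nn_integral_liminf) auto
    also have "\<dots> = liminf (\<lambda>k. visited_prob Z x (h k) ?B ?B t)"
      using V by (simp add: visited_prob_def V_def)
    finally show "trans_prob Z x t ?B \<le> liminf (\<lambda>k. visited_prob Z x (h k) ?B ?B t)" .
  qed
  also have "\<dots> \<le> liminf (\<lambda>k. \<integral>\<^sup>+t. visited_prob Z x (h k) ?B ?B t \<partial>time_measure (clock Z))"
    by (rule nn_integral_liminf) (rule visited_prob_measurable[OF h], simp)
  finally show ?thesis using that h by blast
qed

text \<open>Splitting at the first visit of the ball around \<open>z\<close> gives the bound opposite to (A3). The
  hitting time of the ball is not a stopping time of the natural filtration, hence the grids.\<close>

lemma green_ball_supermultiplicative:
  assumes c1: "\<And>w. w \<in> ball z r \<Longrightarrow> green Z w (ball z r) \<le> c1"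
    and c2: "\<And>w. w \<in> ball z r \<Longrightarrow> green Z z (ball y s) \<le> c2 * green Z w (ball y s)"
  shows "green Z x (ball z r) * green Z z (ball y s) \<le> c1 * c2 * green Z x (ball y s)"
proof -
  obtain h where h: "\<And>k j. real j * h k \<in> times (clock Z)" "\<And>k. 0 \<le> h k"
    and lim: "green Z x (ball z r) \<le> liminf (\<lambda>k. \<integral>\<^sup>+t. visited_prob Z x (h k) (ball z r) (ball z r) t \<partial>time_measure (clock Z))"
    using visited_prob_limit by blast
  define I where "I = (\<lambda>k. \<integral>\<^sup>+t. visited_prob Z x (h k) (ball z r) (ball z r) t \<partial>time_measure (clock Z))"
  have I: "I k * green Z z (ball y s) \<le> c1 * c2 * green Z x (ball y s)" for k
  proof -
    define P where "P = (\<Sum>j. emeasure (law Z x) (first_visit Z (h k) (ball z r) j))"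
    have "I k \<le> c1 * P"
      unfolding I_def P_def by (rule visited_prob_upper[OF h]) (use c1 in auto)
    then have "I k * green Z z (ball y s) \<le> c1 * P * green Z z (ball y s)"
      by (rule mult_right_mono) simp
    also have "\<dots> = c1 * (P * green Z z (ball y s))" by (simp add: mult.assoc)
    also have "\<dots> \<le> c1 * (c2 * green Z x (ball y s))"
      unfolding P_def by (intro mult_left_mono visited_prob_lower[OF h]) (use c2 in auto)
    finally show ?thesis by (simp add: mult.assoc)
  qed
  have "green Z x (ball z r) \<le> (SUP k. I k)"
  proof -
    have "green Z x (ball z r) \<le> liminf I" using lim unfolding I_def .
    also have "\<dots> \<le> limsup I" by (rule Liminf_le_Limsup) simp
    also have "\<dots> \<le> (SUP k. I k)" by (intro Limsup_bounded always_eventually allI SUP_upper) simp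
    finally show ?thesis .
  qed
  then have "green Z x (ball z r) * green Z z (ball y s) \<le> (SUP k. I k) * green Z z (ball y s)"
    by (rule mult_right_mono) simp
  also have "\<dots> = (SUP k. I k * green Z z (ball y s))"
    by (simp add: SUP_mult_right_ennreal)
  also have "\<dots> \<le> c1 * c2 * green Z x (ball y s)" by (rule SUP_least) (rule I)
  finally show ?thesis .
qed

end

subsection \<open>Estimates for Ancona processes\<close>

text \<open>Real-valued for the sake of cancelling factors. No information is lost, because (A1) and
  (A2) make these Green values finite.\<close>

definition green_ball :: "('w, 'h::metric_space) process \<Rightarrow> 'h \<Rightarrow> 'h \<Rightarrow> real" where
  "green_ball Z x y = enn2real (green Z x (ball y 1))"

lemma ancona_process_settingD: "ancona_process \<Gamma> \<phi> L Z G p \<Longrightarrow> transient_setting L Z G p"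
  unfolding ancona_process_def by (elim conjE)

context
  fixes \<Gamma> :: "('g, 'b) monoid_scheme" and \<phi> :: "'g \<Rightarrow> 'h::metric_space \<Rightarrow> 'h"
    and L :: "'h::metric_space measure" and Z :: "('w, 'h) process" and G p
  assumes anc: "ancona_process \<Gamma> \<phi> L Z G p"
    and far: "\<exists>a b :: 'h. 1 < dist a b"
begin

lemma ancona_decay:
  obtains \<alpha> C where "\<alpha> > 0" "C \<ge> 1"
    "\<And>x y. dist x y \<ge> 2 \<Longrightarrow>
       green Z x (ball y 1) * green Z y (ball x 1) \<le> ennreal (C * exp (- \<alpha> * dist x y))"
    "\<And>z. ennreal (1 / C) \<le> green Z z (ball z 1)" "\<And>z. green Z z (ball z 1) \<le> ennreal C"
proof -
  have "\<exists>\<alpha>>0. \<exists>C1\<ge>1.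
        (\<forall>x y. dist x y \<ge> 2 \<longrightarrow>
           green Z x (ball y 1) * green Z y (ball x 1) \<le> ennreal (C1 * exp (- \<alpha> * dist x y))) \<and>
        (\<forall>z. ennreal (1 / C1) \<le> green Z z (ball z 1) \<and> green Z z (ball z 1) \<le> ennreal C1)"
    using anc unfolding ancona_process_def by (elim conjE)
  with that show ?thesis by blast
qed

lemma ancona_harnack:
  assumes "r > 0"
  obtains C where "C > 0"
    "\<And>x y z. 1 < dist x y \<Longrightarrow> 1 < dist x z \<Longrightarrow> dist y z < r \<Longrightarrow> G x y \<le> C * G x z"
    "\<And>u v w. dist v w < r \<Longrightarrow> green Z v (ball u 1) \<le> ennreal C * green Z w (ball u 1)"
proof -
  have "\<forall>r>0. \<forall>\<epsilon>>0. \<exists>C2>0. \<forall>x y z u v w.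
        min (dist x y) (dist x z) > \<epsilon> \<and> max (dist y z) (dist v w) < r \<longrightarrow>
        G x y \<le> C2 * G x z \<and> green Z v (ball u 1) \<le> ennreal C2 * green Z w (ball u 1)"
    using anc unfolding ancona_process_def by (elim conjE)
  from this[rule_format, OF assms zero_less_one] have "\<exists>C2>0. \<forall>x y z u v w.
        min (dist x y) (dist x z) > 1 \<and> max (dist y z) (dist v w) < r \<longrightarrow>
        G x y \<le> C2 * G x z \<and> green Z v (ball u 1) \<le> ennreal C2 * green Z w (ball u 1)"
    by blast
  then obtain C where C: "C > 0" and *: "\<And>x y z u v w.
        min (dist x y) (dist x z) > 1 \<Longrightarrow> max (dist y z) (dist v w) < r \<Longrightarrow>
        G x y \<le> C * G x z \<and> green Z v (ball u 1) \<le> ennreal C * green Z w (ball u 1)"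
    by blast
  \<comment> \<open>(A2) asserts its two inequalities jointly, under one condition on all six
    points. To extract the inequality for balls, the places of \<open>x\<close>, \<open>y\<close>,
    \<open>z\<close> have to be filled by points at distance above 1.\<close>
  obtain a b :: 'h where ab: "1 < dist a b" using far by blast
  have "G x y \<le> C * G x z" if "1 < dist x y" "1 < dist x z" "dist y z < r" for x y z
    using *[of x y z undefined undefined] that assms by simp
  moreover have "green Z v (ball u 1) \<le> ennreal C * green Z w (ball u 1)" if "dist v w < r" for u v w
    using *[of a b b v w u] that assms ab by simp
  ultimately show ?thesis using that C by blast
qed

text \<open>(A1) controls the value at the centre \<open>y\<close>, and (A2) in the first argument
  carries it to \<open>x\<close>. The constant depends on \<open>dist x y\<close>, so the bounds are
  only qualitative.\<close>

lemma green_ball_bounds: "0 < green Z x (ball y 1)" "green Z x (ball y 1) < \<infinity>"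
proof -
  obtain \<alpha> C1 where C1: "C1 \<ge> 1" "\<And>z. ennreal (1 / C1) \<le> green Z z (ball z 1)"
    "\<And>z. green Z z (ball z 1) \<le> ennreal C1"
    by (rule ancona_decay) blast
  have "0 < dist x y + 1" by (simp add: add_nonneg_pos)
  then obtain C where C: "C > 0" "\<And>u v w. dist v w < dist x y + 1 \<Longrightarrow>
      green Z v (ball u 1) \<le> ennreal C * green Z w (ball u 1)"
    by (rule ancona_harnack) blast
  have "0 < ennreal (1 / C1)" using C1(1) by (simp add: ennreal_less_zero_iff)
  also have "\<dots> \<le> green Z y (ball y 1)" by (rule C1(2))
  also have "\<dots> \<le> ennreal C * green Z x (ball y 1)" using C(2)[of y x y] by (simp add: dist_commute)
  finally have "ennreal C * green Z x (ball y 1) \<noteq> 0" by (rule less_imp_neq[symmetric])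
  then have "green Z x (ball y 1) \<noteq> 0" by (rule contrapos_nn) simp
  then show "0 < green Z x (ball y 1)" by (simp only: not_gr_zero[symmetric] not_not)
  have "green Z x (ball y 1) \<le> ennreal C * green Z y (ball y 1)" using C(2)[of x y y] by simp
  also have "\<dots> \<le> ennreal C * ennreal C1" by (intro mult_left_mono C1(3)) simp
  also have "\<dots> < \<infinity>" by (simp add: ennreal_mult_less_top)
  finally show "green Z x (ball y 1) < \<infinity>" .
qed

lemma ennreal_green_ball: "ennreal (green_ball Z x y) = green Z x (ball y 1)"
  unfolding green_ball_def using green_ball_bounds(2)[of x y] by (intro ennreal_enn2real) simp

lemma green_ball_pos: "0 < green_ball Z x y"
  unfolding green_ball_def using green_ball_bounds[of x y] by (simp add: enn2real_positive_iff)

lemma green_ball_nonneg: "0 \<le> green_ball Z x y"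
  using green_ball_pos[of x y] by (rule less_imp_le)

lemma green_ball_decay:
  obtains \<alpha> C where "\<alpha> > 0" "C > 0"
    "\<And>x y. dist x y \<ge> 2 \<Longrightarrow> green_ball Z x y * green_ball Z y x \<le> C * exp (- \<alpha> * dist x y)"
proof -
  obtain \<alpha> C where C: "\<alpha> > 0" "C \<ge> 1" "\<And>x y. dist x y \<ge> 2 \<Longrightarrow>
       green Z x (ball y 1) * green Z y (ball x 1) \<le> ennreal (C * exp (- \<alpha> * dist x y))"
    by (rule ancona_decay) blast
  have "green_ball Z x y * green_ball Z y x \<le> C * exp (- \<alpha> * dist x y)" if "dist x y \<ge> 2" for x y
  proof -
    have "ennreal (green_ball Z x y * green_ball Z y x) \<le> ennreal (C * exp (- \<alpha> * dist x y))"
      using C(3)[OF that]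
      by (simp add: ennreal_mult ennreal_green_ball green_ball_nonneg)
    then show ?thesis using C(2) by (simp add: ennreal_le_iff)
  qed
  with C(1,2) show ?thesis using that[of \<alpha> C] by simp
qed

lemma green_ball_harnack:
  obtains C where "C > 0" "\<And>u v w. dist v w < r \<Longrightarrow> green_ball Z v u \<le> C * green_ball Z w u"
proof -
  obtain C where C: "C > 0" "\<And>u v w. dist v w < max r 1 \<Longrightarrow> green Z v (ball u 1) \<le> ennreal C * green Z w (ball u 1)"
    by (rule ancona_harnack[of "max r 1"]) (simp, blast)
  have "green_ball Z v u \<le> C * green_ball Z w u" if "dist v w < r" for u v w
  proof -
    have "ennreal (green_ball Z v u) \<le> ennreal (C * green_ball Z w u)"
      using C(2)[of v w u] that C(1) by (simp add: ennreal_mult ennreal_green_ball green_ball_nonneg)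
    then show ?thesis using C(1) green_ball_pos[of w u] by (subst (asm) ennreal_le_iff) auto
  qed
  with C(1) show ?thesis using that by blast
qed

lemma green_ball_submultiplicative:
  assumes "r \<ge> 0"
  obtains C where "C > 0" "\<And>x y z. dist x y \<ge> 2 \<Longrightarrow> gromov_product z x y \<le> r \<Longrightarrow>
    green_ball Z x y \<le> C * green_ball Z x z * green_ball Z z y"
proof -
  have "\<forall>r\<ge>0. \<exists>C3>0. \<forall>x y z. dist x y \<ge> 2 \<and> gromov_product z x y \<le> r \<longrightarrow>
           green Z x (ball y 1) \<le> ennreal C3 * green Z x (ball z 1) * green Z z (ball y 1)"
    using anc unfolding ancona_process_def by (elim conjE)
  then obtain C where C: "C > 0" "\<And>x y z. dist x y \<ge> 2 \<Longrightarrow> gromov_product z x y \<le> r \<Longrightarrow>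
      green Z x (ball y 1) \<le> ennreal C * green Z x (ball z 1) * green Z z (ball y 1)" using assms by blast
  have "green_ball Z x y \<le> C * green_ball Z x z * green_ball Z z y"
    if "dist x y \<ge> 2" "gromov_product z x y \<le> r" for x y z
  proof -
    have "ennreal (green_ball Z x y) \<le> ennreal (C * green_ball Z x z * green_ball Z z y)"
      using C(2)[OF that] C(1) by (simp add: ennreal_mult ennreal_green_ball green_ball_nonneg)
    then show ?thesis using C(1) green_ball_pos[of x z] green_ball_pos[of z y] by (subst (asm) ennreal_le_iff) auto
  qed
  with C(1) show ?thesis using that by blast
qed

text \<open>The first visit lands somewhere in the unit ball around \<open>z\<close>. (A2) makes
  both Green functions comparable over that ball, one factor \<open>C\<close> for each, and (A1)
  supplies \<open>C1\<close> for the value at its centre.\<close>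

lemma green_ball_mult_le:
  obtains C where "C > 0" "\<And>x y z. green_ball Z x z * green_ball Z z y \<le> C * green_ball Z x y"
proof -
  have adm: "admissible_process L Z"
    using ancona_process_settingD[OF anc] unfolding transient_setting_def by (elim conjE)
  obtain \<alpha> C1 where C1: "C1 \<ge> 1" "\<And>z. green Z z (ball z 1) \<le> ennreal C1"
    by (rule ancona_decay) blast
  obtain C where C: "C > 0" "\<And>u v w. dist v w < 1 \<Longrightarrow> green Z v (ball u 1) \<le> ennreal C * green Z w (ball u 1)"
    by (rule ancona_harnack[OF zero_less_one]) blast
  have "green_ball Z x z * green_ball Z z y \<le> (C * C1 * C) * green_ball Z x y" for x y z
  proof -
    have "green Z x (ball z 1) * green Z z (ball y 1) \<le> ennreal (C * C1) * ennreal C * green Z x (ball y 1)"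
    proof (rule green_ball_supermultiplicative[OF adm])
      fix w assume w: "w \<in> ball z 1"
      have "green Z w (ball z 1) \<le> ennreal C * green Z z (ball z 1)"
        using C(2)[of w z z] w by (simp add: dist_commute)
      also have "\<dots> \<le> ennreal C * ennreal C1" by (intro mult_left_mono C1(2)) simp
      finally show "green Z w (ball z 1) \<le> ennreal (C * C1)" using C(1) C1(1) by (simp add: ennreal_mult)
      show "green Z z (ball y 1) \<le> ennreal C * green Z w (ball y 1)" using C(2)[of z w y] w by simp
    qed
    then have "ennreal (green_ball Z x z * green_ball Z z y) \<le> ennreal ((C * C1 * C) * green_ball Z x y)"
      using C(1) C1(1) by (simp add: ennreal_mult ennreal_green_ball green_ball_nonneg)
    then show ?thesis using C(1) C1(1) green_ball_pos[of x y] by (subst (asm) ennreal_le_iff) auto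
  qed
  moreover have "C * C1 * C > 0" using C(1) C1(1) by simp
  ultimately show ?thesis using that by blast
qed

section \<open>Comparison of the Martin kernel with Green values of balls\<close>

context
  assumes proper: "proper_space (UNIV :: 'h set)" and radon: "radon_measure L"
    and L_pos: "\<forall>U. open U \<and> U \<noteq> {} \<longrightarrow> 0 < emeasure L U"
begin

text \<open>\<open>m y\<close> is the mass of the unit ball around \<open>y\<close>: its
  \<open>L\<close>-measure, or its cardinality in discrete time. It may vary with \<open>y\<close>
  and cancels in the Martin kernel. Distance above 2 keeps the whole ball at distance above 1 from
  \<open>x\<close>, where (A2) compares the values of \<open>G x\<close> on it.\<close>

lemma green_ball_density:
  obtains C m where "C > 0" "\<And>y. m y > 0"
    "\<And>x y. 2 < dist x y \<Longrightarrow> green_ball Z x y \<le> C * m y * G x y"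
    "\<And>x y. 2 < dist x y \<Longrightarrow> m y * G x y \<le> C * green_ball Z x y"
proof -
  have trans: "transient_process Z"
    using ancona_process_settingD[OF anc] unfolding transient_setting_def by (elim conjE)
  have green: "green_function L Z G"
    using ancona_process_settingD[OF anc] unfolding transient_setting_def by (elim conjE)
  obtain C where C: "C > 0"
    "\<And>x y z. 1 < dist x y \<Longrightarrow> 1 < dist x z \<Longrightarrow> dist y z < 1 \<Longrightarrow> G x y \<le> C * G x z"
    by (rule ancona_harnack[OF zero_less_one]) blast
  have near: "G x z \<le> C * G x y" "G x y \<le> C * G x z" if "2 < dist x y" "z \<in> ball y 1" for x y z
  proof -
    have "1 < dist x z" using that dist_triangle[of x y z] by (simp add: dist_commute)
    then show "G x z \<le> C * G x y" "G x y \<le> C * G x z"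
      using C(2)[of x z y] C(2)[of x y z] that by (auto simp: dist_commute)
  qed
  have G_nonneg: "0 \<le> G x y" for x y
    using green unfolding green_function_def kernel_density_def by (cases "clock Z") simp_all
  have "\<exists>m>0. \<forall>x. 2 < dist x y \<longrightarrow>
      green Z x (ball y 1) \<le> ennreal (C * m * G x y) \<and> ennreal (m * G x y) \<le> ennreal C * green Z x (ball y 1)" for y
  proof (cases "clock Z")
    case Discrete_Time
    have "Isolated.discrete (UNIV :: 'h set)"
      using ancona_process_settingD[OF anc] Discrete_Time
      unfolding transient_setting_def admissible_process_def by simp
    then have "Isolated.discrete (cball y 1)" unfolding Isolated.discrete_def isolated_in_def by auto
    moreover have "compact (cball y 1)" using proper unfolding proper_space_def by simp
    ultimately have "finite (cball y 1)" using discrete_compact_finite_iff by blast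
    then have fin: "finite (ball y 1)" by (rule finite_subset[OF ball_subset_cball])
    have eq: "green Z x (ball y 1) = ennreal (\<Sum>z\<in>ball y 1. G x z)" for x
    proof -
      obtain N where N: "radon_measure N" "\<And>A. A \<in> sets borel \<Longrightarrow> emeasure N A = green Z x A"
        using trans unfolding transient_process_def by blast
      have "green Z x (ball y 1) = (\<Sum>z\<in>ball y 1. emeasure N {z})"
        using N(1) emeasure_eq_sum_singleton[OF fin, of N] N(2)[of "ball y 1"]
        unfolding radon_measure_def by simp
      also have "\<dots> = (\<Sum>z\<in>ball y 1. ennreal (G x z))"
        using N(2) green Discrete_Time unfolding green_function_def by simp
      finally show ?thesis using G_nonneg by (simp add: sum_ennreal)
    qed
    show ?thesis
    proof (intro exI[of _ "real (card (ball y 1))"] conjI allI impI)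
      have "y \<in> ball y 1" by simp
      then show "0 < real (card (ball y 1))" using fin card_gt_0_iff by fastforce
      fix x assume x: "2 < dist x y"
      have "(\<Sum>z\<in>ball y 1. G x z) \<le> (\<Sum>z\<in>ball y 1. C * G x y)"
        by (rule sum_mono) (rule near(1)[OF x])
      then show "green Z x (ball y 1) \<le> ennreal (C * real (card (ball y 1)) * G x y)"
        unfolding eq by (intro ennreal_leI) (simp add: mult_ac)
      have "(\<Sum>z\<in>ball y 1. G x y) \<le> (\<Sum>z\<in>ball y 1. C * G x z)"
        by (rule sum_mono) (rule near(2)[OF x])
      then have "real (card (ball y 1)) * G x y \<le> C * (\<Sum>z\<in>ball y 1. G x z)"
        by (simp add: sum_distrib_left)
      then show "ennreal (real (card (ball y 1)) * G x y) \<le> ennreal C * green Z x (ball y 1)"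
        unfolding eq ennreal_mult'[OF less_imp_le[OF C(1)], symmetric] by (rule ennreal_leI)
    qed
  next
    case Continuous_Time
    have sets_L: "sets L = sets borel" using radon unfolding radon_measure_def by (elim conjE)
    have "compact (cball y 1)" using proper unfolding proper_space_def by simp
    moreover have "\<forall>C. compact C \<longrightarrow> emeasure L C < \<infinity>"
      using radon unfolding radon_measure_def by (elim conjE)
    ultimately have "emeasure L (cball y 1) < \<infinity>" by blast
    moreover have "emeasure L (ball y 1) \<le> emeasure L (cball y 1)"
      by (rule emeasure_mono) (auto simp: sets_L)
    ultimately have fin: "emeasure L (ball y 1) < \<infinity>" by (rule le_less_trans[rotated])
    have pos: "0 < emeasure L (ball y 1)" using L_pos by simp
    define m where "m = measure L (ball y 1)"
    have m: "emeasure L (ball y 1) = ennreal m" unfolding m_def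
      using fin by (intro emeasure_eq_ennreal_measure) simp
    then have m_pos: "0 < m" using pos by (simp add: ennreal_less_zero_iff)
    have eq: "green Z x (ball y 1) = (\<integral>\<^sup>+z. ennreal (G x z) * indicator (ball y 1) z \<partial>L)" for x
      using green Continuous_Time unfolding green_function_def kernel_density_def by simp
    show ?thesis
    proof (intro exI[of _ m] conjI allI impI)
      show "0 < m" by (rule m_pos)
      fix x assume x: "2 < dist x y"
      have "green Z x (ball y 1) \<le> (\<integral>\<^sup>+z. ennreal (C * G x y) * indicator (ball y 1) z \<partial>L)"
        unfolding eq using near(1)[OF x] by (intro nn_integral_mono) (auto simp: indicator_def intro!: ennreal_leI)
      also have "\<dots> = ennreal (C * G x y) * ennreal m"
        by (subst nn_integral_cmult_indicator) (auto simp: sets_L m)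
      finally show "green Z x (ball y 1) \<le> ennreal (C * m * G x y)"
        using C(1) G_nonneg[of x y] m_pos by (subst (asm) ennreal_mult[symmetric]) (auto simp: mult_ac)
      have "ennreal (m * G x y) = (\<integral>\<^sup>+z. ennreal (G x y) * indicator (ball y 1) z \<partial>L)"
        using G_nonneg[of x y] m_pos
        by (subst nn_integral_cmult_indicator) (simp_all add: sets_L m ennreal_mult mult.commute)
      also have "\<dots> \<le> (\<integral>\<^sup>+z. ennreal C * (ennreal (G x z) * indicator (ball y 1) z) \<partial>L)"
      proof (rule nn_integral_mono)
        fix z
        show "ennreal (G x y) * indicator (ball y 1) z \<le> ennreal C * (ennreal (G x z) * indicator (ball y 1) z)"
        proof (cases "z \<in> ball y 1")
          case True
          have "ennreal (G x y) \<le> ennreal (C * G x z)" by (rule ennreal_leI[OF near(2)[OF x True]])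
          then show ?thesis using True C(1) G_nonneg[of x z] by (simp add: ennreal_mult)
        qed simp
      qed
      also have "\<dots> = ennreal C * green Z x (ball y 1)"
        unfolding eq
      proof (rule nn_integral_cmult)
        \<comment> \<open>Measurability comes from continuity off the diagonal, as the ball avoids
          \<open>x\<close>.\<close>
        have "continuous_on {z. z \<noteq> x} (\<lambda>z. G x z)"
        proof -
          have "continuous_on {(x, y). x \<noteq> y} (\<lambda>(x, y). G x y)"
            using green Continuous_Time unfolding green_function_def kernel_density_def by simp
          then have "continuous_on {z. z \<noteq> x} (\<lambda>z. (\<lambda>(x, y). G x y) (x, z))"
            by (rule continuous_on_compose2) (auto intro!: continuous_intros)
          then show ?thesis by simp
        qed
        then have "continuous_on (ball y 1) (\<lambda>z. G x z)"
          by (rule continuous_on_subset) (use x in \<open>auto simp: dist_commute\<close>)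
        then have "(\<lambda>z. G x z * indicator (ball y 1) z) \<in> borel_measurable borel"
          using borel_measurable_continuous_on_indicator[of "ball y 1" "G x"] by (simp add: mult.commute)
        then have "(\<lambda>z. ennreal (G x z * indicator (ball y 1) z)) \<in> borel_measurable borel" by measurable
        also have "(\<lambda>z. ennreal (G x z * indicator (ball y 1) z)) = (\<lambda>z. ennreal (G x z) * indicator (ball y 1) z)"
          by (auto simp: fun_eq_iff indicator_def)
        finally show "(\<lambda>z. ennreal (G x z) * indicator (ball y 1) z) \<in> borel_measurable L"
          by (simp add: measurable_cong_sets[OF sets_L refl])
      qed
      finally show "ennreal (m * G x y) \<le> ennreal C * green Z x (ball y 1)" .
    qed
  qed
  then obtain m where m: "\<And>y. m y > 0"
    "\<And>x y. 2 < dist x y \<Longrightarrow> green Z x (ball y 1) \<le> ennreal (C * m y * G x y)"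
    "\<And>x y. 2 < dist x y \<Longrightarrow> ennreal (m y * G x y) \<le> ennreal C * green Z x (ball y 1)"
    by metis
  show ?thesis
  proof (rule that[OF C(1) m(1)])
    fix x y :: 'h assume xy: "2 < dist x y"
    have "0 \<le> C * m y * G x y" using C(1) m(1)[of y] G_nonneg[of x y] by simp
    then show "green_ball Z x y \<le> C * m y * G x y"
      using m(2)[OF xy] unfolding ennreal_green_ball[symmetric] by (subst (asm) ennreal_le_iff)
    have "0 \<le> C * green_ball Z x y" using C(1) green_ball_pos[of x y] by simp
    then show "m y * G x y \<le> C * green_ball Z x y"
      using m(3)[OF xy] C(1) unfolding ennreal_green_ball[symmetric]
      by (subst (asm) ennreal_mult'[symmetric]) (auto simp: ennreal_le_iff)
  qed
qed

text \<open>Both \<open>G x y\<close> and \<open>G p y\<close> are replaced by Green values of the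
  ball around \<open>y\<close>. The factor \<open>m y\<close> cancels, and each replacement
  contributes one factor to \<open>C^2\<close>.\<close>

lemma martin_kernel_bounds:
  obtains C where "C > 0"
    "\<And>x y. 2 < dist x y \<Longrightarrow> 2 < dist p y \<Longrightarrow> 0 \<le> martin_kernel G p x y"
    "\<And>x y. 2 < dist x y \<Longrightarrow> 2 < dist p y \<Longrightarrow> martin_kernel G p x y * green_ball Z p y \<le> C * green_ball Z x y"
    "\<And>x y. 2 < dist x y \<Longrightarrow> 2 < dist p y \<Longrightarrow> green_ball Z x y \<le> C * (martin_kernel G p x y * green_ball Z p y)"
proof -
  obtain C m where C: "C > 0" and m: "\<And>y. m y > 0"
    and le: "\<And>x y. 2 < dist x y \<Longrightarrow> green_ball Z x y \<le> C * m y * G x y"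
    and ge: "\<And>x y. 2 < dist x y \<Longrightarrow> m y * G x y \<le> C * green_ball Z x y"
    by (rule green_ball_density) blast
  have G_pos: "0 < G x y" if "2 < dist x y" for x y
  proof -
    have "0 < (C * m y) * G x y" using le[OF that] green_ball_pos[of x y] by simp
    moreover have "0 < C * m y" using C m[of y] by simp
    ultimately show ?thesis by (rule zero_less_mult_pos)
  qed
  have *: "martin_kernel G p x y * green_ball Z p y \<le> C^2 * green_ball Z x y"
    "green_ball Z x y \<le> C^2 * (martin_kernel G p x y * green_ball Z p y)"
    if xy: "2 < dist x y" "2 < dist p y" for x y
  proof -
    have K: "martin_kernel G p x y \<ge> 0" "martin_kernel G p x y * G p y = G x y"
      using G_pos[OF xy(1)] G_pos[OF xy(2)] by (auto simp: martin_kernel_def)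
    have "martin_kernel G p x y * green_ball Z p y \<le> martin_kernel G p x y * (C * m y * G p y)"
      using le[OF xy(2)] K(1) by (rule mult_left_mono)
    also have "\<dots> = C * (m y * (martin_kernel G p x y * G p y))" by (simp only: mult_ac)
    also have "\<dots> = C * (m y * G x y)" unfolding K(2) ..
    also have "\<dots> \<le> C * (C * green_ball Z x y)" using ge[OF xy(1)] C by (intro mult_left_mono) auto
    finally show "martin_kernel G p x y * green_ball Z p y \<le> C^2 * green_ball Z x y"
      by (simp add: power2_eq_square)
    have "green_ball Z x y \<le> C * m y * G x y" by (rule le[OF xy(1)])
    also have "\<dots> = C * m y * (martin_kernel G p x y * G p y)" unfolding K(2) ..
    also have "\<dots> = C * martin_kernel G p x y * (m y * G p y)" by (simp only: mult_ac)
    also have "\<dots> \<le> C * martin_kernel G p x y * (C * green_ball Z p y)"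
      using ge[OF xy(2)] C K(1) by (intro mult_left_mono) auto
    finally show "green_ball Z x y \<le> C^2 * (martin_kernel G p x y * green_ball Z p y)"
      by (simp add: power2_eq_square mult_ac)
  qed
  have nonneg: "0 \<le> martin_kernel G p x y" if "2 < dist x y" "2 < dist p y" for x y
    using G_pos[OF that(1)] G_pos[OF that(2)] by (simp add: martin_kernel_def)
  have "C^2 > 0" using C by simp
  from that[OF this nonneg *] show ?thesis .
qed

text \<open>(A2) moves \<open>x\<close> to \<open>p\<close>, where the kernel is normalised. The
  bound depends on \<open>x\<close> but not on \<open>y\<close>, which is the boundedness needed for
  extracting subsequences.\<close>

lemma martin_kernel_bounded:
  obtains B where "B > 0" "\<And>y. 2 < dist x y \<Longrightarrow> 2 < dist p y \<Longrightarrow> \<bar>martin_kernel G p x y\<bar> \<le> B"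
proof -
  obtain C where C: "C > 0"
    "\<And>x y. 2 < dist x y \<Longrightarrow> 2 < dist p y \<Longrightarrow> 0 \<le> martin_kernel G p x y"
    "\<And>x y. 2 < dist x y \<Longrightarrow> 2 < dist p y \<Longrightarrow> martin_kernel G p x y * green_ball Z p y \<le> C * green_ball Z x y"
    by (rule martin_kernel_bounds) blast
  obtain D where D: "D > 0" "\<And>u v w. dist v w < dist x p + 1 \<Longrightarrow> green_ball Z v u \<le> D * green_ball Z w u"
    by (rule green_ball_harnack) blast
  have "\<bar>martin_kernel G p x y\<bar> \<le> C * D" if "2 < dist x y" "2 < dist p y" for y
  proof -
    have "martin_kernel G p x y * green_ball Z p y \<le> C * green_ball Z x y" by (rule C(3)[OF that])
    also have "\<dots> \<le> C * (D * green_ball Z p y)" using D(2)[of x p y] C(1) by (intro mult_left_mono) auto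
    finally have "martin_kernel G p x y * green_ball Z p y \<le> (C * D) * green_ball Z p y" by (simp add: mult_ac)
    then have "martin_kernel G p x y \<le> C * D" using green_ball_pos[of p y] by simp
    then show ?thesis using C(2)[OF that] by simp
  qed
  moreover have "C * D > 0" using C D by simp
  ultimately show ?thesis using that by blast
qed

end

end

subsection \<open>Kernels on \<open>X\<close> separate radial limit points\<close>

text \<open>Radiality involves a supremum over sequences, but the estimates need it along the given
  \<open>s\<close>. If the product with \<open>s n\<close> stayed above the bound from
  \<open>N\<close> on, then \<open>s\<close> and the constant sequence \<open>u\<close> would push
  the supremum up to \<open>r\<close>; hence the bound recurs at arbitrarily late \<open>n\<close>.
  Moving \<open>u\<close> to \<open>p\<close> costs \<open>dist p u\<close>, and
  \<open>max 0\<close> makes the bound admissible in (A3).\<close>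

lemma radial_limit_setD:
  fixes s :: "nat \<Rightarrow> 'h::metric_space"
  assumes hyp: "gromov_hyperbolic \<delta> (UNIV :: 'h set)"
    and \<xi>: "\<xi> \<in> radial_limit_set UNIV" and s: "s \<in> \<xi>"
  obtains z r where "divergent_seq z" "r \<ge> 0"
    "\<And>m N. \<exists>n\<ge>N. gromov_product (z m) p (s n) \<le> r"
proof -
  obtain z u where z: "divergent_seq z"
    and lim: "limsup (\<lambda>m. ext_gromov_product (z m) (Inl u) (Inr \<xi>)) < \<infinity>"
    using \<xi> unfolding radial_limit_set_def by blast
  obtain r :: real where "limsup (\<lambda>m. ext_gromov_product (z m) (Inl u) (Inr \<xi>)) < ereal r"
    using ereal_dense2[OF lim] by blast
  then have "\<forall>\<^sub>F m in sequentially. ext_gromov_product (z m) (Inl u) (Inr \<xi>) < ereal r"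
    by (rule Limsup_lessD)
  then obtain K where K: "\<And>m. m \<ge> K \<Longrightarrow> ext_gromov_product (z m) (Inl u) (Inr \<xi>) < ereal r"
    unfolding eventually_sequentially by blast
  have bd: "\<exists>n\<ge>N. gromov_product (z m) p (s n) \<le> max 0 (r + dist p u)" if m: "m \<ge> K" for m N
  proof (rule ccontr)
    assume "\<not> ?thesis"
    then have gt: "\<And>n. n \<ge> N \<Longrightarrow> max 0 (r + dist p u) < gromov_product (z m) p (s n)" by force
    have "r \<le> gromov_product (z m) u (s n)" if "n \<ge> N" for n
      using gt[OF that] gromov_product_lipschitz[of "z m" p "s n" u] by linarith
    then have "ereal r \<le> ext_gromov_product (z m) (Inl u) (Inr \<xi>)"
      using s by (intro ext_gromov_product_ge[OF hyp, of "\<lambda>_. u" _ s _ N]) (auto simp: converges_to_def)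
    with K[OF m] show False by simp
  qed
  \<comment> \<open>Dropping the first \<open>K\<close> terms makes the bound hold for every
    \<open>m\<close>.\<close>
  have "strict_mono (\<lambda>m. K + m)" by (simp add: strict_mono_def)
  then have "divergent_seq (z \<circ> (\<lambda>m. K + m))" by (rule divergent_seq_subseq[OF z])
  then show ?thesis
  proof (rule that)
    show "\<exists>n\<ge>N. gromov_product ((z \<circ> (\<lambda>m. K + m)) m) p (s n) \<le> max 0 (r + dist p u)" for m N
      using bd[of "K + m" N] by simp
  qed simp
qed

context
  fixes \<Gamma> :: "('g, 'b) monoid_scheme" and \<phi> :: "'g \<Rightarrow> 'h::metric_space \<Rightarrow> 'h"
    and L :: "'h measure" and Z :: "('w, 'h) process" and G p
    and \<delta> :: real
  assumes anc: "ancona_process \<Gamma> \<phi> L Z G p"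
    and proper: "proper_space (UNIV :: 'h set)" and radon: "radon_measure L"
    and L_pos: "\<forall>U. open U \<and> U \<noteq> {} \<longrightarrow> 0 < emeasure L U"
    and hyp: "gromov_hyperbolic \<delta> (UNIV :: 'h set)"
begin

lemma divergent_seq_far:
  fixes x :: "nat \<Rightarrow> 'h"
  assumes "divergent_seq x"
  shows "\<exists>a b :: 'h. 1 < dist a b"
proof -
  have "\<forall>\<^sub>F n in sequentially. 1 < dist p (x n)" using assms divergent_seq_dist[OF proper] by blast
  then obtain n where "1 < dist p (x n)" using eventually_happens'[OF sequentially_bot] by blast
  then show ?thesis by blast
qed

text \<open>A point \<open>x\<close> of \<open>X\<close> deep in the direction of \<open>\<xi>\<close> and a radial point \<open>z\<close> with \<open>p\<close>, \<open>z\<close>, \<open>x\<close>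
  almost aligned satisfy \<open>K(x,\<xi>) \<ge> c G(x,z) / G(p,z)\<close> and \<open>K(x,\<eta>) \<le> C G(x,z) G(z,p)\<close>. By (A1) the
  two values cannot agree when \<open>z\<close> is far from \<open>p\<close>.\<close>

lemma martin_limits_separate:
  fixes s t :: "nat \<Rightarrow> 'h"
  assumes \<xi>: "\<xi> \<in> radial_limit_set UNIV" "s \<in> \<xi>" and \<eta>: "\<eta> \<in> gromov_boundary" "t \<in> \<eta>"
    and lim_s: "\<And>k. (\<lambda>n. martin_kernel G p (s k) (s n)) \<longlonglongrightarrow> \<kappa> (s k)"
    and lim_t: "\<And>k. (\<lambda>n. martin_kernel G p (s k) (t n)) \<longlonglongrightarrow> \<kappa> (s k)"
  shows "\<xi> = \<eta>"
proof (rule ccontr)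
  assume neq: "\<xi> \<noteq> \<eta>"
  have \<xi>': "\<xi> \<in> gromov_boundary" using \<xi>(1) unfolding radial_limit_set_def by blast
  have div_s: "divergent_seq s" by (rule gromov_boundary_divergent[OF hyp proper \<xi>' \<xi>(2)])
  have div_t: "divergent_seq t" by (rule gromov_boundary_divergent[OF hyp proper \<eta>])
  note far = divergent_seq_far[OF div_s]
  note pos = green_ball_pos[OF anc far]
  let ?K = "martin_kernel G p" and ?g = "green_ball Z"
  obtain z r0 where z: "divergent_seq z" "r0 \<ge> 0"
    and z_near: "\<And>m N. \<exists>n\<ge>N. gromov_product (z m) p (s n) \<le> r0"
    by (rule radial_limit_setD[OF hyp \<xi>, of p]) (rule that)
  obtain r1 N1 where r1: "\<And>m n. m \<ge> N1 \<Longrightarrow> n \<ge> N1 \<Longrightarrow> gromov_product p (s m) (t n) \<le> r1"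
    by (rule gromov_product_eventually_bounded[OF hyp \<xi>' \<eta>(1) \<xi>(2) \<eta>(2) neq]) (rule that)
  obtain C where C: "C > 0"
    and K_nonneg: "\<And>x y. 2 < dist x y \<Longrightarrow> 2 < dist p y \<Longrightarrow> 0 \<le> ?K x y"
    and K_upper: "\<And>x y. 2 < dist x y \<Longrightarrow> 2 < dist p y \<Longrightarrow> ?K x y * ?g p y \<le> C * ?g x y"
    and K_lower: "\<And>x y. 2 < dist x y \<Longrightarrow> 2 < dist p y \<Longrightarrow> ?g x y \<le> C * (?K x y * ?g p y)"
    by (rule martin_kernel_bounds[OF anc far proper radon L_pos]) (rule that)
  obtain C1 where C1: "C1 > 0"
    "\<And>x y z. dist x y \<ge> 2 \<Longrightarrow> gromov_product z x y \<le> max 0 r1 \<Longrightarrow> ?g x y \<le> C1 * ?g x z * ?g z y"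
    by (rule green_ball_submultiplicative[OF anc far max.cobounded1[of 0 r1]]) (rule that)
  obtain C0 where C0: "C0 > 0"
    "\<And>x y z. dist x y \<ge> 2 \<Longrightarrow> gromov_product z x y \<le> r0 \<Longrightarrow> ?g x y \<le> C0 * ?g x z * ?g z y"
    by (rule green_ball_submultiplicative[OF anc far z(2)]) (rule that)
  obtain D where D: "D > 0" "\<And>x y z. ?g x z * ?g z y \<le> D * ?g x y"
    by (rule green_ball_mult_le[OF anc far]) (rule that)
  obtain \<alpha> A where A: "\<alpha> > 0" "A > 0"
    "\<And>x y. dist x y \<ge> 2 \<Longrightarrow> ?g x y * ?g y x \<le> A * exp (- \<alpha> * dist x y)"
    by (rule green_ball_decay[OF anc far]) (rule that)
  have far_s: "\<forall>\<^sub>F n in sequentially. 2 < dist x (s n)" for x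
    using div_s divergent_seq_dist[OF proper] by blast
  have far_t: "\<forall>\<^sub>F n in sequentially. 2 < dist x (t n)" for x
    using div_t divergent_seq_dist[OF proper] by blast
  \<comment> \<open>Distinct boundary points have bounded products at \<open>p\<close>, so (A3)
    splits \<open>?g (s k) (t n)\<close> at \<open>p\<close>, and \<open>?g p (t n)\<close> cancels
    against the normalisation of the kernel.\<close>
  have upper: "\<kappa> (s k) \<le> C * C1 * ?g (s k) p" if k: "k \<ge> N1" for k
  proof (rule tendsto_upperbound[OF lim_t])
    show "\<forall>\<^sub>F n in sequentially. ?K (s k) (t n) \<le> C * C1 * ?g (s k) p"
      using far_t[of "s k"] far_t[of p] eventually_ge_at_top[of N1]
    proof eventually_elim
      fix n assume n: "2 < dist (s k) (t n)" "2 < dist p (t n)" "N1 \<le> n"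
      have "?K (s k) (t n) * ?g p (t n) \<le> C * ?g (s k) (t n)" by (rule K_upper[OF n(1,2)])
      also have "\<dots> \<le> C * (C1 * ?g (s k) p * ?g p (t n))"
        using C1(2)[of "s k" "t n" p] n r1[OF k n(3)] C by (intro mult_left_mono) auto
      finally have "?K (s k) (t n) * ?g p (t n) \<le> (C * C1 * ?g (s k) p) * ?g p (t n)"
        by (simp only: mult.assoc)
      then show "?K (s k) (t n) \<le> C * C1 * ?g (s k) p"
        using pos[of p "t n"] by (rule mult_right_le_imp_le)
    qed
  qed simp
  \<comment> \<open>The numerator is bounded below through \<open>z m\<close> by
    \<open>green_ball_mult_le\<close>, the denominator \<open>?g p (s n)\<close> above by (A3) at
    \<open>z m\<close>; the common factor \<open>?g (z m) (s n)\<close> cancels. The alignment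
    needed for (A3) holds only for infinitely many \<open>n\<close>.\<close>
  have lower: "?g (s k) (z m) \<le> C * C0 * D * ?g p (z m) * \<kappa> (s k)" for k m
  proof -
    let ?c = "C * C0 * D * ?g p (z m)"
    have "\<exists>\<^sub>F n in sequentially. ?g (s k) (z m) \<le> ?c * ?K (s k) (s n)"
    proof -
      have "\<exists>\<^sub>F n in sequentially. gromov_product (z m) p (s n) \<le> r0"
        unfolding frequently_sequentially using z_near by blast
      moreover have "\<forall>\<^sub>F n in sequentially. 2 < dist (s k) (s n) \<and> 2 < dist p (s n)"
        using far_s by (intro eventually_conj)
      ultimately have "\<exists>\<^sub>F n in sequentially. (2 < dist (s k) (s n) \<and> 2 < dist p (s n)) \<and>
          gromov_product (z m) p (s n) \<le> r0"
        by (rule frequently_eventually_conj)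
      then show ?thesis
      proof (rule frequently_elim1)
        fix n assume n: "(2 < dist (s k) (s n) \<and> 2 < dist p (s n)) \<and> gromov_product (z m) p (s n) \<le> r0"
        define a b c where "a = ?g (s k) (z m)" and "b = ?g (z m) (s n)" and "c = ?g p (s n)"
        have "a * b \<le> D * ?g (s k) (s n)" unfolding a_def b_def by (rule D(2))
        also have "\<dots> \<le> D * (C * (?K (s k) (s n) * c))"
          unfolding c_def using K_lower n D(1) by (intro mult_left_mono) auto
        finally have 1: "a * b \<le> D * C * ?K (s k) (s n) * c" by (simp only: mult.assoc)
        have 2: "c \<le> C0 * ?g p (z m) * b"
          unfolding c_def b_def using n by (intro C0(2)) auto
        have ab: "a > 0" "b > 0" "c > 0" unfolding a_def b_def c_def by (rule pos)+
        have "0 \<le> D * C * ?K (s k) (s n)" using K_nonneg[of "s k" "s n"] n C D(1) by simp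
        then have "D * C * ?K (s k) (s n) * c \<le> D * C * ?K (s k) (s n) * (C0 * ?g p (z m) * b)"
          using 2 by (rule mult_left_mono[rotated])
        with 1 have "a * b \<le> (?c * ?K (s k) (s n)) * b" by (simp only: mult_ac)
        then show "?g (s k) (z m) \<le> ?c * ?K (s k) (s n)"
          using ab(2) unfolding a_def by (rule mult_right_le_imp_le)
      qed
    qed
    moreover have "(\<lambda>n. ?c * ?K (s k) (s n)) \<longlonglongrightarrow> ?c * \<kappa> (s k)"
      by (intro tendsto_intros lim_s)
    \<comment> \<open>Since the sequence converges, a bound that holds frequently passes to the
      limit.\<close>
    ultimately show ?thesis
    proof (rule_tac ccontr)
      assume freq: "\<exists>\<^sub>F n in sequentially. ?g (s k) (z m) \<le> ?c * ?K (s k) (s n)"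
        and lim: "(\<lambda>n. ?c * ?K (s k) (s n)) \<longlonglongrightarrow> ?c * \<kappa> (s k)"
        and "\<not> ?g (s k) (z m) \<le> ?c * \<kappa> (s k)"
      then have "\<forall>\<^sub>F n in sequentially. ?c * ?K (s k) (s n) < ?g (s k) (z m)"
        using order_tendstoD(2)[OF lim] by simp
      then have "\<forall>\<^sub>F n in sequentially. \<not> ?g (s k) (z m) \<le> ?c * ?K (s k) (s n)"
        by (simp add: not_le)
      with freq show False unfolding frequently_def by blast
    qed
  qed
  \<comment> \<open>\<open>C * C0 * D\<close> comes from \<open>lower\<close>, \<open>C * C1\<close>
    from \<open>upper\<close>, and the last \<open>C0\<close> from splitting
    \<open>?g (s k) p\<close> at \<open>z m\<close>, after which \<open>?g (s k) (z m)\<close>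
    cancels.\<close>
  define E where "E = C * C0 * D * (C * C1) * C0"
  have key: "1 \<le> E * (?g p (z m) * ?g (z m) p)" for m
  proof -
    have "\<exists>\<^sub>F n in sequentially. gromov_product (z m) p (s n) \<le> r0"
      unfolding frequently_sequentially using z_near by blast
    moreover have "\<forall>\<^sub>F n in sequentially. 2 < dist p (s n) \<and> N1 \<le> n"
      by (intro eventually_conj far_s eventually_ge_at_top)
    ultimately have "\<exists>\<^sub>F n in sequentially. (2 < dist p (s n) \<and> N1 \<le> n) \<and> gromov_product (z m) p (s n) \<le> r0"
      by (rule frequently_eventually_conj)
    then obtain k where k: "gromov_product (z m) p (s k) \<le> r0" "2 < dist p (s k)" "N1 \<le> k"
      using frequently_ex by blast
    have "?g (s k) p \<le> C0 * ?g (s k) (z m) * ?g (z m) p"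
      using k by (intro C0(2)) (auto simp: dist_commute gromov_product_commute)
    then have "\<kappa> (s k) \<le> C * C1 * (C0 * ?g (s k) (z m) * ?g (z m) p)"
      using upper[OF k(3)] C C1(1) by (meson mult_left_mono mult_pos_pos less_imp_le order_trans)
    then have "C * C0 * D * ?g p (z m) * \<kappa> (s k)
        \<le> C * C0 * D * ?g p (z m) * (C * C1 * (C0 * ?g (s k) (z m) * ?g (z m) p))"
      using C C0(1) D(1) pos[of p "z m"] by (intro mult_left_mono) auto
    with lower[of k m] have "1 * ?g (s k) (z m) \<le> (E * (?g p (z m) * ?g (z m) p)) * ?g (s k) (z m)"
      unfolding E_def by (simp add: mult_ac)
    then show ?thesis using pos[of "s k" "z m"] by (rule mult_right_le_imp_le)
  qed
  have E: "E > 0" unfolding E_def using C C0(1) D(1) C1(1) by simp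
  \<comment> \<open>The 2 is the range of validity of (A1); the logarithm is chosen to make the
    exponential bound, multiplied by \<open>E\<close>, less than 1/2.\<close>
  define R where "R = max 2 (ln (2 * E * A) / \<alpha>)"
  have "\<forall>\<^sub>F m in sequentially. R < dist p (z m)"
    using z(1) divergent_seq_dist[OF proper] by blast
  then obtain m where m: "R < dist p (z m)" using eventually_happens'[OF sequentially_bot] by blast
  have "ln (2 * E * A) < \<alpha> * dist p (z m)"
    using m A(1) unfolding R_def by (simp add: pos_divide_less_eq mult.commute)
  then have "exp (- \<alpha> * dist p (z m)) < exp (- ln (2 * E * A))" by simp
  also have "\<dots> = 1 / (2 * E * A)" using E A(2) by (simp add: exp_minus inverse_eq_divide)
  finally have small: "E * (A * exp (- \<alpha> * dist p (z m))) < 1 / 2"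
    using E A(2) by (simp add: field_simps)
  have "?g p (z m) * ?g (z m) p \<le> A * exp (- \<alpha> * dist p (z m))"
    using m unfolding R_def by (intro A(3)) auto
  then have "E * (?g p (z m) * ?g (z m) p) \<le> E * (A * exp (- \<alpha> * dist p (z m)))"
    using E by (intro mult_left_mono) auto
  with key[of m] small show False by linarith
qed

end

subsection \<open>Compactness\<close>

text \<open>The sets \<open>{p. (p\<xi>)\<^sub>u > R}\<close> need not be open; complements of closed sets of interior points
  that stay away from a boundary point are convenient open neighbourhoods instead.\<close>

lemma openin_gromov_avoid:
  fixes Q :: "('h::metric_space + (nat \<Rightarrow> 'h) set) set"
  assumes hyp: "gromov_hyperbolic \<delta> (UNIV :: 'h set)" and Q: "Q \<subseteq> UNIV <+> gromov_boundary"
  shows "openin (gromov_topology u) (Inl ` (- closure (Inl -` Q)) \<union>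
    Inr ` {\<eta> \<in> gromov_boundary. \<exists>R::real. \<forall>q\<in>Q. ext_gromov_product u q (Inr \<eta>) \<le> ereal R})"
    (is "openin _ (Inl ` ?V \<union> Inr ` ?W)")
  unfolding openin_gromov_topology
proof (intro conjI ballI)
  let ?U = "Inl ` ?V \<union> Inr ` ?W"
  show "?U \<subseteq> UNIV <+> gromov_boundary" by auto
  have "Inl -` ?U = ?V" by auto
  then show "open (Inl -` ?U)" by (simp add: open_Compl)
  fix \<eta> assume "\<eta> \<in> Inr -` ?U"
  then obtain R :: real where \<eta>: "\<eta> \<in> gromov_boundary" and R: "\<forall>q\<in>Q. ext_gromov_product u q (Inr \<eta>) \<le> ereal R"
    by auto
  \<comment> \<open>At a boundary point \<open>3 * \<delta> + 4\<close> is lost in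
    \<open>ext_gromov_product_ultra\<close>, and 1 remains for the contradiction. At an interior
    point \<open>2 * \<delta> + 3\<close> is lost in choosing sequences and 1 in moving to a point
    of \<open>Q\<close>; again at least 1 remains.\<close>
  define S where "S = R + 3 * \<delta> + 5"
  have \<delta>: "0 \<le> \<delta>" by (rule hyperbolicity_constant_nonneg[OF hyp])
  have "q \<in> ?U" if q: "q \<in> UNIV <+> gromov_boundary" "ereal S < ext_gromov_product u q (Inr \<eta>)" for q
  proof (cases q)
    case (Inl x)
    have "x \<notin> closure (Inl -` Q)"
    proof
      assume "x \<in> closure (Inl -` Q)"
      then obtain x' where x': "Inl x' \<in> Q" "dist x' x < 1"
        unfolding closure_approachable by (metis vimage_eq zero_less_one)
      obtain s where s: "s \<in> \<eta>" using converges_to_ex[OF hyp, of "Inr \<eta>"] \<eta> by (auto simp: converges_to_def)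
      obtain N where N: "\<forall>m\<ge>N. \<forall>n\<ge>N. S - (2 * \<delta> + 3) < gromov_product u x (s n)"
        using ext_gromov_product_gtD[OF hyp q(1) _ q(2), of "\<lambda>_. x" s] Inl s \<eta>
        by (auto simp: converges_to_def)
      have "R + 1 \<le> gromov_product u x' (s n)" if "n \<ge> N" for n
        using N that gromov_product_lipschitz[of u x "s n" x'] x'(2) \<delta> unfolding S_def
        by (smt (verit) dist_commute)
      then have "ereal (R + 1) \<le> ext_gromov_product u (Inl x') (Inr \<eta>)"
        using s by (intro ext_gromov_product_ge[OF hyp, of "\<lambda>_. x'" _ s _ N]) (auto simp: converges_to_def)
      moreover have "ext_gromov_product u (Inl x') (Inr \<eta>) \<le> ereal R" using R x'(1) by blast
      ultimately have "ereal (R + 1) \<le> ereal R" by (rule order_trans)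
      then show False by simp
    qed
    then show ?thesis using Inl by blast
  next
    case (Inr \<zeta>)
    then have \<zeta>: "\<zeta> \<in> gromov_boundary" using q(1) by auto
    have "ext_gromov_product u q' (Inr \<zeta>) \<le> ereal S" if q': "q' \<in> Q" for q'
    proof (rule ccontr)
      assume "\<not> ?thesis"
      then have "ereal S < ext_gromov_product u q' (Inr \<zeta>)" by simp
      then have "ereal (S - (3 * \<delta> + 4)) < ext_gromov_product u q' (Inr \<eta>)"
        using ext_gromov_product_ultra[OF hyp, of q' "Inr \<zeta>" "Inr \<eta>" S u] q Inr \<zeta> \<eta> q' Q by auto
      also have "\<dots> \<le> ereal R" using R q' by blast
      finally show False unfolding S_def by simp
    qed
    then show ?thesis using Inr \<zeta> by blast
  qed
  then show "\<exists>R::real. {q \<in> UNIV <+> gromov_boundary. ereal R < ext_gromov_product u q (Inr \<eta>)} \<subseteq> ?U" by blast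
qed

lemma ext_gromov_product_self:
  assumes hyp: "gromov_hyperbolic \<delta> (UNIV :: 'h::metric_space set)" and \<xi>: "\<xi> \<in> gromov_boundary"
  shows "ereal R < ext_gromov_product (u::'h) (Inr \<xi>) (Inr \<xi>)"
proof -
  obtain s where s: "s \<in> \<xi>" using converges_to_ex[OF hyp, of "Inr \<xi>"] \<xi> by (auto simp: converges_to_def)
  then obtain N where "\<forall>m\<ge>N. \<forall>n\<ge>N. R + 1 < gromov_product u (s m) (s n)"
    using gromov_boundary_far[OF hyp \<xi> s s, of u] unfolding gromov_far_def by blast
  then have "ereal (R + 1) \<le> ext_gromov_product u (Inr \<xi>) (Inr \<xi>)"
    using s by (intro ext_gromov_product_ge[OF hyp, of s _ s _ N]) (auto simp: converges_to_def intro: less_imp_le)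
  then show ?thesis by (rule less_le_trans[rotated]) simp
qed

lemma proper_space_countable_dense:
  assumes "proper_space (UNIV :: 'h::metric_space set)"
  obtains D where "countable (D :: 'h set)" "\<And>x e. e > 0 \<Longrightarrow> \<exists>q\<in>D. dist q x < e"
proof -
  fix p :: 'h
  have "\<exists>k. finite k \<and> cball p (real n) \<subseteq> (\<Union>x\<in>k. ball x (1 / real (Suc i)))" for n i
  proof -
    have "compact (cball p (real n))" using assms unfolding proper_space_def by simp
    then show ?thesis unfolding compact_eq_totally_bounded by simp
  qed
  then obtain k where k: "\<And>n i. finite (k n i)"
    "\<And>n i. cball p (real n) \<subseteq> (\<Union>x\<in>k n i. ball x (1 / real (Suc i)))"
    by metis
  define D where "D = (\<Union>n. \<Union>i. k n i)"
  have "countable (k n i)" for n i using k(1) by (rule countable_finite)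
  then have "countable D" unfolding D_def by (intro countable_UN) auto
  moreover have "\<exists>q\<in>D. dist q x < e" if e: "e > 0" for x e
  proof -
    obtain n where n: "dist p x \<le> real n" using real_arch_simple by blast
    obtain i where i: "1 / real (Suc i) < e" using reals_Archimedean[OF e] by (auto simp: inverse_eq_divide)
    have "x \<in> cball p (real n)" using n by simp
    then obtain q where "q \<in> k n i" "dist q x < 1 / real (Suc i)" using k(2)[of n i] by (auto simp del: of_nat_Suc)
    then show ?thesis using i unfolding D_def by (intro bexI[of _ q]) auto
  qed
  ultimately show ?thesis using that by blast
qed

text \<open>The Arzela-Ascoli theorem in the library is about functions on Euclidean spaces.\<close>

lemma equicontinuous_subsequence:
  fixes K :: "'h::metric_space \<Rightarrow> nat \<Rightarrow> real"
  assumes proper: "proper_space (UNIV :: 'h set)"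
    and bdd: "\<And>x. Bseq (K x)"
    and equi: "\<And>x e. e > 0 \<Longrightarrow> \<exists>d>0. \<exists>N. \<forall>y\<in>ball x d. \<forall>n\<ge>N. \<bar>K x n - K y n\<bar> < e"
  obtains r \<kappa> where "strict_mono r" "\<And>C. compact C \<Longrightarrow> uniform_limit C (\<lambda>n x. K x (r n)) \<kappa> sequentially"
proof -
  obtain D :: "'h set" where D: "countable D" "\<And>x e. e > 0 \<Longrightarrow> \<exists>q\<in>D. dist q x < e"
    by (rule proper_space_countable_dense[OF proper]) (rule that)
  have "\<forall>x. \<exists>B>0. \<forall>n. norm (K x n) \<le> B" using bdd unfolding Bseq_def by blast
  then obtain B where B: "\<And>x. B x > 0" "\<And>x n. norm (K x n) \<le> B x" by metis
  \<comment> \<open>The diagonal argument wants one bound for all points of \<open>D\<close>, hence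
    the normalisation.\<close>
  have "norm (K x n / B x) \<le> 1" for x n using B[of x] by (simp add: divide_le_eq)
  then obtain r where r: "strict_mono (r :: nat \<Rightarrow> nat)" "\<And>x. x \<in> D \<Longrightarrow> \<exists>l. (\<lambda>n. K x (r n) / B x) \<longlonglongrightarrow> l"
    by (rule function_convergent_subsequence[OF D(1), of "\<lambda>n x. K x n / B x" 1]) (rule that)
  have conv: "Cauchy (\<lambda>n. K q (r n))" if q: "q \<in> D" for q
  proof -
    obtain l where "(\<lambda>n. K q (r n) / B q) \<longlonglongrightarrow> l" using r(2)[OF q] by blast
    then have "(\<lambda>n. K q (r n) / B q * B q) \<longlonglongrightarrow> l * B q" by (intro tendsto_intros)
    then have "(\<lambda>n. K q (r n)) \<longlonglongrightarrow> l * B q" using B(1)[of q] by simp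
    then show ?thesis by (rule LIMSEQ_imp_Cauchy)
  qed
  have unif: "uniformly_convergent_on C (\<lambda>n x. K x (r n))" if C: "compact C" for C
  proof (intro Cauchy_uniformly_convergent uniformly_Cauchy_onI)
    fix e :: real assume e: "e > 0"
    then have "e / 5 > 0" by simp
    \<comment> \<open>Five steps lead from \<open>K y (r m)\<close> to \<open>K y (r n)\<close>:
      from \<open>y\<close> to \<open>x\<close> and on to \<open>q x\<close>, across the indices at
      \<open>q x\<close>, and back again.\<close>
    then have "\<forall>x. \<exists>d N. d > 0 \<and> (\<forall>y\<in>ball x d. \<forall>n\<ge>N. \<bar>K x n - K y n\<bar> < e / 5)"
      using equi by blast
    then obtain d N where dN: "\<And>x. d x > 0" "\<And>x y n. y \<in> ball x (d x) \<Longrightarrow> n \<ge> N x \<Longrightarrow> \<bar>K x n - K y n\<bar> < e / 5"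
      by metis
    have "\<forall>x. \<exists>q M. q \<in> D \<and> q \<in> ball x (d x) \<and> (\<forall>m\<ge>M. \<forall>n\<ge>M. \<bar>K q (r m) - K q (r n)\<bar> < e / 5)"
    proof
      fix x
      obtain q where q: "q \<in> D" "dist q x < d x" using D(2)[OF dN(1)] by blast
      obtain M where "\<forall>m\<ge>M. \<forall>n\<ge>M. dist (K q (r m)) (K q (r n)) < e / 5"
        using conv[OF q(1)] \<open>e / 5 > 0\<close> unfolding Cauchy_def by blast
      then show "\<exists>q M. q \<in> D \<and> q \<in> ball x (d x) \<and> (\<forall>m\<ge>M. \<forall>n\<ge>M. \<bar>K q (r m) - K q (r n)\<bar> < e / 5)"
        using q by (auto simp: dist_real_def dist_commute)
    qed
    then obtain q M where qM: "\<And>x. q x \<in> ball x (d x)"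
      "\<And>x m n. m \<ge> M x \<Longrightarrow> n \<ge> M x \<Longrightarrow> \<bar>K (q x) (r m) - K (q x) (r n)\<bar> < e / 5"
      by metis
    obtain F where F: "F \<subseteq> C" "finite F" "C \<subseteq> (\<Union>x\<in>F. ball x (d x))"
    proof (rule compactE_image[OF C, of C "\<lambda>x. ball x (d x)"])
      show "C \<subseteq> (\<Union>x\<in>C. ball x (d x))" using dN(1) by auto
    qed (auto intro: that)
    define L where "L = (\<Sum>x\<in>F. N x + M x)"
    have L: "N x \<le> L" "M x \<le> L" if "x \<in> F" for x
      using member_le_sum[of x F "\<lambda>x. N x + M x"] that F(2) unfolding L_def by auto
    show "\<exists>M. \<forall>x\<in>C. \<forall>m\<ge>M. \<forall>n\<ge>M. dist (K x (r m)) (K x (r n)) < e"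
    proof (intro exI[of _ L] ballI allI impI)
      fix y m n assume y: "y \<in> C" and mn: "L \<le> m" "L \<le> n"
      obtain x where x: "x \<in> F" "y \<in> ball x (d x)" using F(3) y by blast
      have r': "N x \<le> r m" "N x \<le> r n" "M x \<le> m" "M x \<le> n"
        using L[OF x(1)] mn seq_suble[OF r(1), of m] seq_suble[OF r(1), of n] by linarith+
      have "\<bar>K x (r m) - K y (r m)\<bar> < e / 5" "\<bar>K x (r n) - K y (r n)\<bar> < e / 5"
        "\<bar>K x (r m) - K (q x) (r m)\<bar> < e / 5" "\<bar>K x (r n) - K (q x) (r n)\<bar> < e / 5"
        "\<bar>K (q x) (r m) - K (q x) (r n)\<bar> < e / 5"
        using dN(2)[OF x(2)] dN(2)[OF qM(1)] qM(2) r' by blast+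
      then show "dist (K y (r m)) (K y (r n)) < e" unfolding dist_real_def by linarith
    qed
  qed
  show ?thesis
  proof (rule that[OF r(1)])
    show "uniform_limit C (\<lambda>n x. K x (r n)) (\<lambda>x. lim (\<lambda>n. K x (r n))) sequentially" if "compact C" for C
      using unif[OF that] by (simp add: uniformly_convergent_uniform_limit_iff)
  qed
qed

section \<open>Convergent subsequences of Martin kernels\<close>

context
  fixes \<Gamma> :: "('g, 'b) monoid_scheme" and \<phi> :: "'g \<Rightarrow> 'h::metric_space \<Rightarrow> 'h"
    and L :: "'h measure" and Z :: "('w, 'h) process" and G p
  assumes anc: "ancona_process \<Gamma> \<phi> L Z G p"
    and proper: "proper_space (UNIV :: 'h set)" and radon: "radon_measure L"
    and L_pos: "\<forall>U. open U \<and> U \<noteq> {} \<longrightarrow> 0 < emeasure L U"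
begin

text \<open>Boundedness at each point comes from (A2). Equicontinuity is trivial at isolated points
  in discrete time; in continuous time it is assumed only for kernels whose second argument is far
  from the compact set, hence it holds from some index on.\<close>

lemma martin_kernel_subsequence:
  fixes y :: "nat \<Rightarrow> 'h"
  assumes y: "divergent_seq y"
  obtains r \<kappa> where "strict_mono r" "\<kappa> \<in> martin_boundary UNIV (Collect compact) (martin_kernel G p)"
    "\<And>C. compact C \<Longrightarrow> uniform_limit C (\<lambda>n x. martin_kernel G p x (y (r n))) \<kappa> sequentially"
proof -
  let ?K = "martin_kernel G p"
  have ev: "\<forall>\<^sub>F n in sequentially. R < dist x (y n)" for x R
    using y divergent_seq_dist[OF proper] by blast
  have far: "\<exists>a b :: 'h. 1 < dist a b"
    using eventually_happens'[OF sequentially_bot ev[of 1 p]] by blast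
  have bdd: "Bseq (\<lambda>n. ?K x (y n))" for x
  proof -
    obtain B where B: "B > 0" "\<And>y. 2 < dist x y \<Longrightarrow> 2 < dist p y \<Longrightarrow> \<bar>?K x y\<bar> \<le> B"
      by (rule martin_kernel_bounded[OF anc far proper radon L_pos]) (rule that)
    have "\<forall>\<^sub>F n in sequentially. norm (?K x (y n)) \<le> B"
      using ev[of 2 x] ev[of 2 p] by eventually_elim (simp add: B(2))
    then show ?thesis by (rule BfunI)
  qed
  have equi: "\<exists>d>0. \<exists>N. \<forall>x'\<in>ball x d. \<forall>n\<ge>N. \<bar>?K x (y n) - ?K x' (y n)\<bar> < e" if e: "e > 0" for x e
  proof (cases "clock Z")
    case Discrete_Time
    have "Isolated.discrete (UNIV :: 'h set)"
      using ancona_process_settingD[OF anc] Discrete_Time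
      unfolding transient_setting_def admissible_process_def by simp
    then obtain d where d: "d > 0" "\<forall>y. dist x y < d \<longrightarrow> y = x"
      unfolding Isolated.discrete_def isolated_in_dist_Ex_iff by auto
    then show ?thesis using e by (intro exI[of _ d] conjI exI[of _ 0]) auto
  next
    case Continuous_Time
    have "locally_equicontinuous_kernels ?K"
      using ancona_process_settingD[OF anc] Continuous_Time unfolding transient_setting_def by simp
    moreover have "compact (cball x 1)" using proper unfolding proper_space_def by simp
    ultimately have "\<forall>z\<in>cball x 1. \<forall>e>0. \<exists>d>0. \<forall>x'\<in>cball x 1. dist z x' < d \<longrightarrow>
        (\<forall>y. infdist y (cball x 1) \<ge> 1 \<longrightarrow> \<bar>?K z y - ?K x' y\<bar> < e)"
      unfolding locally_equicontinuous_kernels_def by blast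
    then obtain d where d: "d > 0" "\<forall>x'\<in>cball x 1. dist x x' < d \<longrightarrow>
        (\<forall>y. infdist y (cball x 1) \<ge> 1 \<longrightarrow> \<bar>?K x y - ?K x' y\<bar> < e)"
      using e by (meson centre_in_cball zero_le_one)
    obtain N where N: "\<forall>n\<ge>N. 2 < dist x (y n)" using ev[of 2 x] unfolding eventually_sequentially by blast
    \<comment> \<open>Distance above 2 from the centre leaves distance at least 1 from the unit
      ball, as local equicontinuity requires.\<close>
    have "1 \<le> infdist (y n) (cball x 1)" if "n \<ge> N" for n
    proof -
      have "1 \<le> dist (y n) c" if "c \<in> cball x 1" for c
        using N[rule_format, OF \<open>n \<ge> N\<close>] that dist_triangle[of x "y n" c] by (simp add: dist_commute)
      moreover have "cball x 1 \<noteq> {}" by simp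
      ultimately show ?thesis unfolding infdist_notempty[OF \<open>cball x 1 \<noteq> {}\<close>] by (intro cINF_greatest)
    qed
    then show ?thesis
      using d by (intro exI[of _ "min d 1"] conjI exI[of _ N]) auto
  qed
  obtain r \<kappa> where r: "strict_mono (r :: nat \<Rightarrow> nat)"
    and lim: "\<And>C. compact C \<Longrightarrow> uniform_limit C (\<lambda>n x. ?K x (y (r n))) \<kappa> sequentially"
    by (rule equicontinuous_subsequence[OF proper, of "\<lambda>x n. ?K x (y n)"]) (rule bdd, rule equi, assumption, rule that)
  have "divergent_seq (y \<circ> r)" by (rule divergent_seq_subseq[OF y r])
  then have "\<kappa> \<in> martin_boundary UNIV (Collect compact) ?K"
    unfolding martin_boundary_def using lim by (auto simp: extensional_def intro!: exI[of _ "y \<circ> r"])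
  from that[OF r this lim] show ?thesis .
qed

subsection \<open>Convergence in the two compactifications\<close>

context
  fixes f :: "(nat \<Rightarrow> 'h) set \<Rightarrow> 'h \<Rightarrow> real" and \<delta> :: real
  assumes hyp: "gromov_hyperbolic \<delta> (UNIV :: 'h set)"
    and homeo: "homeomorphic_map (gromov_topology p)
      (martin_topology UNIV (Collect compact) (martin_kernel G p)) (map_sum id f)"
begin

lemma boundary_map_image: "f ` gromov_boundary = martin_boundary UNIV (Collect compact) (martin_kernel G p)"
proof -
  have img: "map_sum (id :: 'h \<Rightarrow> 'h) f ` (UNIV <+> gromov_boundary)
      = UNIV <+> martin_boundary UNIV (Collect compact) (martin_kernel G p)"
    using homeomorphic_imp_surjective_map[OF homeo]
    by (simp add: topspace_gromov_topology topspace_martin_topology)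
  show ?thesis
  proof (intro equalityI subsetI)
    fix \<kappa> assume "\<kappa> \<in> f ` gromov_boundary"
    then have "Inr \<kappa> \<in> map_sum (id :: 'h \<Rightarrow> 'h) f ` (UNIV <+> gromov_boundary)" by force
    then show "\<kappa> \<in> martin_boundary UNIV (Collect compact) (martin_kernel G p)" unfolding img by auto
  next
    fix \<kappa> assume "\<kappa> \<in> martin_boundary UNIV (Collect compact) (martin_kernel G p)"
    then have "Inr \<kappa> \<in> map_sum (id :: 'h \<Rightarrow> 'h) f ` (UNIV <+> gromov_boundary)" unfolding img by auto
    then show "\<kappa> \<in> f ` gromov_boundary" by auto
  qed
qed

text \<open>If convergence failed, the offending terms of \<open>s\<close> would form a closed set
  \<open>bad\<close>. Its complement together with the kernels close to \<open>f \<xi>\<close> is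
  open in the Martin topology, and continuity of \<open>map_sum id f\<close> forces \<open>s\<close>
  into it eventually.\<close>

lemma gromov_imp_martin_limit:
  assumes \<xi>: "\<xi> \<in> gromov_boundary" "s \<in> \<xi>" and C: "compact C"
  shows "uniform_limit C (\<lambda>n x. martin_kernel G p x (s n)) (f \<xi>) sequentially"
proof (rule ccontr)
  let ?K = "martin_kernel G p"
  let ?M = "martin_boundary UNIV (Collect compact) ?K"
  assume "\<not> ?thesis"
  then obtain e where e: "e > 0" and "\<not> (\<forall>\<^sub>F n in sequentially. \<forall>x\<in>C. dist (?K x (s n)) (f \<xi> x) < e)"
    unfolding uniform_limit_iff by blast
  then have freq: "\<exists>\<^sub>F n in sequentially. \<exists>x\<in>C. e \<le> \<bar>?K x (s n) - f \<xi> x\<bar>"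
    unfolding not_eventually dist_real_def by (simp add: not_less)
  define bad where "bad = s ` {n. \<exists>x\<in>C. e \<le> \<bar>?K x (s n) - f \<xi> x\<bar>}"
  have "closed bad" unfolding bad_def
    by (rule divergent_seq_closed[OF proper gromov_boundary_divergent[OF hyp proper \<xi>]])
  \<comment> \<open>Asking for one \<open>e' < e\<close> uniformly on \<open>C\<close>, instead of
    \<open>< e\<close> at each point, leaves a margin; half of it is the radius of the neighbourhood
    that shows \<open>U\<close> to be open at boundary points.\<close>
  define U where "U = Inl ` (- bad) \<union> Inr ` {\<kappa> \<in> ?M. \<exists>e'<e. \<forall>x\<in>C. \<bar>\<kappa> x - f \<xi> x\<bar> \<le> e'}"
  have "openin (martin_topology UNIV (Collect compact) ?K) U"
    unfolding openin_martin_topology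
  proof (intro conjI ballI)
    show "U \<subseteq> UNIV <+> ?M" unfolding U_def by auto
    have "Inl -` U = - bad" unfolding U_def by auto
    then show "openin (top_of_set UNIV) (Inl -` U)" using \<open>closed bad\<close> by (simp add: open_Compl)
    fix \<kappa> assume "\<kappa> \<in> Inr -` U"
    then obtain e' where e': "e' < e" "\<forall>x\<in>C. \<bar>\<kappa> x - f \<xi> x\<bar> \<le> e'" unfolding U_def by auto
    have "martin_nbhd UNIV (Collect compact) ?K (\<Union>{C}) ((e - e') / 2) \<kappa> \<subseteq> U"
    proof
      fix q assume "q \<in> martin_nbhd UNIV (Collect compact) ?K (\<Union>{C}) ((e - e') / 2) \<kappa>"
      then consider (1) y where "q = Inl y" "\<forall>x\<in>C. \<bar>?K x y - \<kappa> x\<bar> < (e - e') / 2"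
        | (2) \<kappa>' where "q = Inr \<kappa>'" "\<kappa>' \<in> ?M" "\<forall>x\<in>C. \<bar>\<kappa>' x - \<kappa> x\<bar> < (e - e') / 2"
        unfolding martin_nbhd_def by auto
      then show "q \<in> U"
      proof cases
        case 1
        have "\<bar>?K x y - f \<xi> x\<bar> < e" if "x \<in> C" for x
          using 1(2)[rule_format, OF that] e'(2)[rule_format, OF that] e'(1)
            abs_triangle_ineq[of "?K x y - \<kappa> x" "\<kappa> x - f \<xi> x"] by simp
        then have "y \<notin> bad" unfolding bad_def by (fastforce simp: not_le[symmetric])
        then show ?thesis unfolding U_def 1 by blast
      next
        case 2
        have "\<bar>\<kappa>' x - f \<xi> x\<bar> \<le> (e + e') / 2" if "x \<in> C" for x
          using 2(3)[rule_format, OF that] e'(2)[rule_format, OF that]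
            abs_triangle_ineq[of "\<kappa>' x - \<kappa> x" "\<kappa> x - f \<xi> x"] by simp
        moreover have "(e + e') / 2 < e" using e'(1) by simp
        ultimately show ?thesis unfolding U_def 2(1) using 2(2) by blast
      qed
    qed
    then show "\<exists>\<F>. finite \<F> \<and> \<F> \<subseteq> Collect compact \<and>
        (\<exists>e>0. martin_nbhd UNIV (Collect compact) ?K (\<Union>\<F>) e \<kappa> \<subseteq> U)"
      using C e'(1) by (intro exI[of _ "{C}"] conjI exI[of _ "(e - e') / 2"]) auto
  qed
  then have "openin (gromov_topology p) {q \<in> UNIV <+> gromov_boundary. map_sum id f q \<in> U}"
    using openin_continuous_map_preimage[OF homeomorphic_imp_continuous_map[OF homeo]]
    by (simp add: topspace_gromov_topology)
  moreover have "Inr \<xi> \<in> {q \<in> UNIV <+> gromov_boundary. map_sum id f q \<in> U}"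
  proof -
    have "f \<xi> \<in> ?M" using \<xi>(1) by (simp only: boundary_map_image[symmetric] imageI)
    moreover have "\<exists>e'<e. \<forall>x\<in>C. \<bar>f \<xi> x - f \<xi> x\<bar> \<le> e'" using e by (intro exI[of _ 0]) simp
    ultimately have "Inr (f \<xi>) \<in> U" unfolding U_def by blast
    then show ?thesis using \<xi>(1) by (simp add: InrI)
  qed
  ultimately obtain R :: real where R: "{q \<in> UNIV <+> gromov_boundary. ereal R < ext_gromov_product p q (Inr \<xi>)}
      \<subseteq> {q \<in> UNIV <+> gromov_boundary. map_sum id f q \<in> U}"
    unfolding openin_gromov_topology by blast
  have "\<forall>\<^sub>F n in sequentially. s n \<notin> bad"
    using ext_gromov_product_tends[OF hyp \<xi>, of R p]
  proof eventually_elim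
    fix n assume "ereal R < ext_gromov_product p (Inl (s n)) (Inr \<xi>)"
    then have "Inl (s n) \<in> {q \<in> UNIV <+> gromov_boundary. ereal R < ext_gromov_product p q (Inr \<xi>)}"
      by (simp add: InlI)
    then have "map_sum id f (Inl (s n)) \<in> U" using subsetD[OF R] by blast
    then show "s n \<notin> bad" unfolding U_def by auto
  qed
  with freq have "\<exists>\<^sub>F n in sequentially. s n \<notin> bad \<and> (\<exists>x\<in>C. e \<le> \<bar>?K x (s n) - f \<xi> x\<bar>)"
    by (intro frequently_eventually_conj)
  then obtain n where "s n \<notin> bad" "\<exists>x\<in>C. e \<le> \<bar>?K x (s n) - f \<xi> x\<bar>" using frequently_ex by blast
  then show False unfolding bad_def by blast
qed

text \<open>H with its Gromov boundary is compact here because the Martin compactification is; a proper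
  hyperbolic space that is not geodesic may have divergent sequences without limit points.\<close>

lemma divergent_seq_gromov_subseq:
  fixes y :: "nat \<Rightarrow> 'h"
  assumes y: "divergent_seq y"
  obtains r \<xi> where "strict_mono r" "\<xi> \<in> gromov_boundary" "y \<circ> r \<in> \<xi>"
proof -
  let ?K = "martin_kernel G p"
  let ?M = "martin_boundary UNIV (Collect compact) ?K"
  obtain r \<kappa> where r: "strict_mono r" and \<kappa>: "\<kappa> \<in> ?M"
    and lim: "\<And>C. compact C \<Longrightarrow> uniform_limit C (\<lambda>n x. ?K x (y (r n))) \<kappa> sequentially"
    by (rule martin_kernel_subsequence[OF y]) (rule that)
  have "\<kappa> \<in> f ` gromov_boundary" using \<kappa> by (simp only: boundary_map_image)
  then obtain \<xi> where \<xi>: "\<kappa> = f \<xi>" "\<xi> \<in> gromov_boundary" by (rule imageE)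
  have div: "divergent_seq (y \<circ> r)" by (rule divergent_seq_subseq[OF y r])
  have "y \<circ> r \<in> \<xi>"
  proof (rule gromov_boundary_memI[OF hyp \<xi>(2), of p])
    fix R :: real
    \<comment> \<open>\<open>Q\<close> consists of the interior points outside the basic
      neighbourhood of \<xi> at level \<open>R\<close>. The open set \<open>U\<close> avoids
      \<open>Q\<close> and contains \<xi>; its image is open because \<open>map_sum id f\<close> is
      an open map, so convergence of the kernels drives the sequence into \<open>U\<close>.\<close>
    define Q :: "('h + (nat \<Rightarrow> 'h) set) set"
      where "Q = Inl ` {x. ext_gromov_product p (Inl x) (Inr \<xi>) \<le> ereal R}"
    define U where "U = Inl ` (- closure (Inl -` Q)) \<union>
      Inr ` {\<eta> \<in> gromov_boundary. \<exists>R::real. \<forall>q\<in>Q. ext_gromov_product p q (Inr \<eta>) \<le> ereal R}"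
    have U: "openin (gromov_topology p) U"
      unfolding U_def by (rule openin_gromov_avoid[OF hyp]) (auto simp: Q_def)
    have "Inr \<xi> \<in> U" unfolding U_def Q_def using \<xi>(2) by blast
    then have "Inr \<kappa> \<in> map_sum id f ` U" unfolding \<xi>(1) by (rule rev_image_eqI) simp
    moreover have "openin (martin_topology UNIV (Collect compact) ?K) (map_sum id f ` U)"
      using homeomorphic_imp_open_map[OF homeo] U unfolding open_map_def by blast
    ultimately obtain \<F> e where \<F>: "finite \<F>" "\<F> \<subseteq> Collect compact" and e: "e > 0"
      and nbhd: "martin_nbhd UNIV (Collect compact) ?K (\<Union>\<F>) e \<kappa> \<subseteq> map_sum id f ` U"
      unfolding openin_martin_topology by (metis vimageI)
    \<comment> \<open>Martin neighbourhoods contain only interior points outside the compact set, so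
      divergence is used along with convergence of the kernels.\<close>
    have "compact (\<Union>\<F>)" using \<F> by (intro compact_Union) auto
    then have "\<forall>\<^sub>F n in sequentially. \<forall>x\<in>\<Union>\<F>. dist (?K x (y (r n))) (\<kappa> x) < e"
      and "\<forall>\<^sub>F n in sequentially. (y \<circ> r) n \<notin> \<Union>\<F>"
      using lim e div unfolding uniform_limit_iff divergent_seq_def by blast+
    then show "\<forall>\<^sub>F n in sequentially. ereal R < ext_gromov_product p (Inl ((y \<circ> r) n)) (Inr \<xi>)"
    proof eventually_elim
      fix n assume n: "\<forall>x\<in>\<Union>\<F>. dist (?K x (y (r n))) (\<kappa> x) < e" "(y \<circ> r) n \<notin> \<Union>\<F>"
      have "Inl (y (r n)) \<in> martin_nbhd UNIV (Collect compact) ?K (\<Union>\<F>) e \<kappa>"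
        unfolding martin_nbhd_def using n by (intro InlI) (auto simp: dist_real_def)
      then have "Inl (y (r n)) \<in> map_sum id f ` U" by (rule subsetD[OF nbhd])
      then obtain q where "Inl (y (r n)) = map_sum id f q" "q \<in> U" by (rule imageE)
      then have "Inl (y (r n)) \<in> U" by (cases q) simp_all
      then have "y (r n) \<notin> closure (Inl -` Q)" unfolding U_def by auto
      then have "y (r n) \<notin> Inl -` Q" using closure_subset[of "Inl -` Q"] by blast
      then have "Inl (y (r n)) \<notin> Q" by simp
      then show "ereal R < ext_gromov_product p (Inl ((y \<circ> r) n)) (Inr \<xi>)" unfolding Q_def by auto
    qed
  qed
  from that[OF r \<xi>(2) this] show ?thesis .
qed

end

end

subsection \<open>The boundary of the random walk\<close>

lemma uniform_limit_finite_iff: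
  assumes "finite C"
  shows "uniform_limit C f g F \<longleftrightarrow> (\<forall>x\<in>C. ((\<lambda>n. f n x) \<longlongrightarrow> g x) F)"
proof
  assume "uniform_limit C f g F"
  then show "\<forall>x\<in>C. ((\<lambda>n. f n x) \<longlongrightarrow> g x) F" by (intro ballI tendsto_uniform_limitI)
next
  assume *: "\<forall>x\<in>C. ((\<lambda>n. f n x) \<longlongrightarrow> g x) F"
  show "uniform_limit C f g F"
    unfolding uniform_limit_iff
  proof (intro allI impI)
    fix e :: real assume "e > 0"
    then have "\<forall>x\<in>C. \<forall>\<^sub>F n in F. dist (f n x) (g x) < e" using tendstoD[OF bspec[OF *]] by simp
    then show "\<forall>\<^sub>F n in F. \<forall>x\<in>C. dist (f n x) (g x) < e"
      using assms by (simp add: eventually_ball_finite)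
  qed
qed

text \<open>Every point is charged by some step of the walk from one fixed point, and each step has
  countable support. Countability lets finite sets exhaust X.\<close>

lemma countable_irreducible_walk:
  assumes "irreducible_walk X \<mu>"
  shows "countable X"
proof (cases "X = {}")
  case False
  then obtain x where x: "x \<in> X" by blast
  have "X \<subseteq> (\<Union>n. set_pmf (walk \<mu> n x))"
  proof
    fix y assume "y \<in> X"
    then obtain n where "pmf (walk \<mu> n x) y > 0" using assms x unfolding irreducible_walk_def by blast
    then have "y \<in> set_pmf (walk \<mu> n x)" by (simp add: set_pmf_iff)
    then show "y \<in> (\<Union>n. set_pmf (walk \<mu> n x))" by blast
  qed
  then show ?thesis by (rule countable_subset) simp
qed simp

context
  fixes \<Gamma> :: "('g, 'b) monoid_scheme" and \<phi> :: "'g \<Rightarrow> 'h::metric_space \<Rightarrow> 'h"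
    and L :: "'h measure" and Z :: "('w, 'h) process" and G p
    and \<delta> :: real and X :: "'h set" and \<mu> :: "'h \<Rightarrow> 'h pmf" and f :: "(nat \<Rightarrow> 'h) set \<Rightarrow> 'h \<Rightarrow> real"
  assumes anc: "ancona_process \<Gamma> \<phi> L Z G p"
    and proper: "proper_space (UNIV :: 'h set)" and radon: "radon_measure L"
    and L_pos: "\<forall>U. open U \<and> U \<noteq> {} \<longrightarrow> 0 < emeasure L U"
    and hyp: "gromov_hyperbolic \<delta> (UNIV :: 'h set)"
    and homeo: "homeomorphic_map (gromov_topology p)
      (martin_topology UNIV (Collect compact) (martin_kernel G p)) (map_sum id f)"
    and discr: "Isolated.discrete X" and pX: "p \<in> X"
    and fls: "FLS_restriction \<Gamma> \<phi> G p X \<mu>"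
    and radial: "limit_set X \<subseteq> radial_limit_set (UNIV :: 'h set)"
begin

lemma limit_setD:
  assumes "\<xi> \<in> limit_set X"
  obtains s where "\<xi> \<in> gromov_boundary" "range s \<subseteq> X" "s \<in> \<xi>"
proof -
  have "\<xi> \<in> gromov_boundary \<and> (\<exists>s. range s \<subseteq> X \<and> s \<in> \<xi>)"
    using assms by (simp add: limit_set_def converges_to_def)
  then show ?thesis by (elim exE conjE) (rule that)
qed

text \<open>A divergent sequence leaves \<open>a\<close> and \<open>p\<close>, the two poles at
  which the kernels of walk and process may differ.\<close>

lemma walk_kernel_eventually:
  assumes "divergent_seq x" "range x \<subseteq> X" "a \<in> X"
  shows "\<forall>\<^sub>F n in sequentially. martin_kernel (walk_green \<mu>) p a (x n) = martin_kernel G p a (x n)"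
proof -
  have "\<forall>\<^sub>F n in sequentially. 0 < dist q (x n)" for q
    using assms(1) divergent_seq_dist[OF proper] by blast
  from this[of a] this[of p] show ?thesis
  proof eventually_elim
    fix n assume "0 < dist a (x n)" "0 < dist p (x n)"
    then have "x n \<noteq> a" "x n \<noteq> p" by auto
    moreover have "x n \<in> X" using assms(2) by blast
    ultimately show "martin_kernel (walk_green \<mu>) p a (x n) = martin_kernel G p a (x n)"
      using fls assms(3) unfolding FLS_restriction_def by simp
  qed
qed

lemma martin_kernel_limit:
  assumes "\<xi> \<in> gromov_boundary" "s \<in> \<xi>"
  shows "(\<lambda>n. martin_kernel G p a (s n)) \<longlonglongrightarrow> f \<xi> a"
proof -
  have "uniform_limit {a} (\<lambda>n x. martin_kernel G p x (s n)) (f \<xi>) sequentially"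
    by (rule gromov_imp_martin_limit[OF anc proper radon L_pos hyp homeo assms]) simp
  then show ?thesis by (rule tendsto_uniform_limitI) simp
qed

lemma walk_kernel_limit:
  assumes "\<xi> \<in> gromov_boundary" "s \<in> \<xi>" "range s \<subseteq> X" "a \<in> X"
  shows "(\<lambda>n. martin_kernel (walk_green \<mu>) p a (s n)) \<longlonglongrightarrow> f \<xi> a"
proof -
  have "divergent_seq s" by (rule gromov_boundary_divergent[OF hyp proper assms(1,2)])
  from tendsto_cong[OF walk_kernel_eventually[OF this assms(3,4)]] show ?thesis
    using martin_kernel_limit[OF assms(1,2), of a] by (rule iffD2)
qed

lemma restrict_in_walk_boundary:
  assumes "\<xi> \<in> limit_set X"
  shows "restrict (f \<xi>) X \<in> walk_boundary p X \<mu>"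
proof -
  obtain s where s: "\<xi> \<in> gromov_boundary" "range s \<subseteq> X" "s \<in> \<xi>"
    by (rule limit_setD[OF assms]) (rule that)
  have "uniform_limit C (\<lambda>n x. martin_kernel (walk_green \<mu>) p x (s n)) (restrict (f \<xi>) X) sequentially"
    if "C \<in> finite_subsets X" for C
  proof -
    have C: "finite C" "C \<subseteq> X" using that unfolding finite_subsets_def by auto
    have "(\<lambda>n. martin_kernel (walk_green \<mu>) p x (s n)) \<longlonglongrightarrow> restrict (f \<xi>) X x" if "x \<in> C" for x
      using walk_kernel_limit[OF s(1,3,2), of x] that C(2) by (simp add: subset_iff)
    then show ?thesis using C(1) by (simp add: uniform_limit_finite_iff)
  qed
  moreover have "divergent_seq s" by (rule gromov_boundary_divergent[OF hyp proper s(1,3)])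
  ultimately have "range s \<subseteq> X \<and> divergent_seq s \<and> (\<forall>C\<in>finite_subsets X.
      uniform_limit C (\<lambda>n x. martin_kernel (walk_green \<mu>) p x (s n)) (restrict (f \<xi>) X) sequentially)"
    using s(2) by simp
  then have "\<exists>s. range s \<subseteq> X \<and> divergent_seq s \<and> (\<forall>C\<in>finite_subsets X.
      uniform_limit C (\<lambda>n x. martin_kernel (walk_green \<mu>) p x (s n)) (restrict (f \<xi>) X) sequentially)"
    by (rule exI[of _ s])
  then show ?thesis unfolding walk_boundary_def martin_boundary_def by simp
qed

text \<open>Sequential compactness of X with its limit set, used for surjectivity and for the
  continuity of the inverse.\<close>

lemma divergent_in_X_subseq:
  assumes x: "divergent_seq x" "range x \<subseteq> X"
  obtains r \<xi> where "strict_mono r" "\<xi> \<in> limit_set X" "x \<circ> r \<in> \<xi>"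
    "\<And>a. a \<in> X \<Longrightarrow> (\<lambda>n. martin_kernel (walk_green \<mu>) p a (x (r n))) \<longlonglongrightarrow> f \<xi> a"
proof -
  obtain r \<xi> where r: "strict_mono r" and \<xi>: "\<xi> \<in> gromov_boundary" "x \<circ> r \<in> \<xi>"
    by (rule divergent_seq_gromov_subseq[OF anc proper radon L_pos hyp homeo x(1)]) (rule that)
  have ran: "range (x \<circ> r) \<subseteq> X" using x(2) by auto
  have "\<exists>s. range s \<subseteq> X \<and> s \<in> \<xi>" using ran \<xi>(2) by (intro exI[of _ "x \<circ> r"] conjI)
  then have "\<xi> \<in> limit_set X" using \<xi>(1) by (simp add: limit_set_def converges_to_def)
  moreover have "(\<lambda>n. martin_kernel (walk_green \<mu>) p a (x (r n))) \<longlonglongrightarrow> f \<xi> a" if "a \<in> X" for a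
    using walk_kernel_limit[OF \<xi> ran that] by simp
  ultimately show ?thesis using \<xi>(2) by (intro that[OF r]) auto
qed

lemma walk_boundary_surj:
  assumes "\<kappa> \<in> walk_boundary p X \<mu>"
  obtains \<xi> where "\<xi> \<in> limit_set X" "restrict (f \<xi>) X = \<kappa>"
proof -
  from assms obtain y where \<kappa>: "\<kappa> \<in> extensional X" and y: "range y \<subseteq> X" "divergent_seq y"
    and lim: "\<forall>C\<in>finite_subsets X. uniform_limit C (\<lambda>n x. martin_kernel (walk_green \<mu>) p x (y n)) \<kappa> sequentially"
    unfolding walk_boundary_def martin_boundary_def by auto
  obtain r \<xi> where r: "strict_mono r" and \<xi>: "\<xi> \<in> limit_set X"
    and lim': "\<And>a. a \<in> X \<Longrightarrow> (\<lambda>n. martin_kernel (walk_green \<mu>) p a (y (r n))) \<longlonglongrightarrow> f \<xi> a"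
    by (rule divergent_in_X_subseq[OF y(2,1)]) (rule that)
  have "restrict (f \<xi>) X a = \<kappa> a" if a: "a \<in> X" for a
  proof -
    have "{a} \<in> finite_subsets X" using a unfolding finite_subsets_def by simp
    then have "uniform_limit {a} (\<lambda>n x. martin_kernel (walk_green \<mu>) p x (y n)) \<kappa> sequentially"
      using lim by blast
    then have "(\<lambda>n. martin_kernel (walk_green \<mu>) p a (y n)) \<longlonglongrightarrow> \<kappa> a" by (simp add: uniform_limit_finite_iff)
    then have "(\<lambda>n. martin_kernel (walk_green \<mu>) p a (y (r n))) \<longlonglongrightarrow> \<kappa> a"
      using LIMSEQ_subseq_LIMSEQ[OF _ r] by (simp add: o_def)
    then have "f \<xi> a = \<kappa> a" using lim'[OF a] LIMSEQ_unique by blast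
    then show ?thesis using a by simp
  qed
  then have "restrict (f \<xi>) X = \<kappa>" using \<kappa> by (intro extensionalityI[of _ X]) auto
  with \<xi> show ?thesis by (rule that)
qed

text \<open>The kernels are compared only at the points \<open>s k\<close>, which lie in X, so
  agreement on X suffices.\<close>

lemma restrict_inj:
  assumes "\<xi> \<in> limit_set X" "\<eta> \<in> limit_set X" "\<And>a. a \<in> X \<Longrightarrow> f \<xi> a = f \<eta> a"
  shows "\<xi> = \<eta>"
proof -
  obtain s where s: "\<xi> \<in> gromov_boundary" "range s \<subseteq> X" "s \<in> \<xi>"
    by (rule limit_setD[OF assms(1)]) (rule that)
  obtain t where t: "\<eta> \<in> gromov_boundary" "range t \<subseteq> X" "t \<in> \<eta>"
    by (rule limit_setD[OF assms(2)]) (rule that)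
  have \<xi>: "\<xi> \<in> radial_limit_set UNIV" using assms(1) radial by (rule subsetD[rotated])
  have s_X: "s k \<in> X" for k using s(2) by (simp add: range_subsetD)
  show ?thesis
  proof (rule martin_limits_separate[OF anc proper radon L_pos hyp \<xi> s(3) t(1,3)])
    show "(\<lambda>n. martin_kernel G p (s k) (s n)) \<longlonglongrightarrow> f \<xi> (s k)" for k
      by (rule martin_kernel_limit[OF s(1,3)])
    show "(\<lambda>n. martin_kernel G p (s k) (t n)) \<longlonglongrightarrow> f \<xi> (s k)" for k
      using martin_kernel_limit[OF t(1,3), of "s k"] assms(3)[OF s_X] by simp
  qed
qed

text \<open>A boundary point is replaced by a point of X close to it both in the Gromov product and
  in the values of the kernel, so that sequences of boundary points can be treated as sequences in
  X.\<close>

lemma approximate_boundary_point: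
  assumes \<xi>: "\<xi> \<in> limit_set X" and A: "finite A" "A \<subseteq> X" and e: "e > 0"
  obtains x where "x \<in> X" "R < dist p x" "ereal R < ext_gromov_product p (Inl x) (Inr \<xi>)"
    "\<And>a. a \<in> A \<Longrightarrow> \<bar>martin_kernel (walk_green \<mu>) p a x - f \<xi> a\<bar> < e"
proof -
  obtain s where s: "\<xi> \<in> gromov_boundary" "range s \<subseteq> X" "s \<in> \<xi>"
    by (rule limit_setD[OF \<xi>]) (rule that)
  have "divergent_seq s" by (rule gromov_boundary_divergent[OF hyp proper s(1,3)])
  then have "\<forall>\<^sub>F n in sequentially. R < dist p (s n)" using divergent_seq_dist[OF proper] by blast
  moreover have "\<forall>\<^sub>F n in sequentially. ereal R < ext_gromov_product p (Inl (s n)) (Inr \<xi>)"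
    by (rule ext_gromov_product_tends[OF hyp s(1,3)])
  moreover have "\<forall>\<^sub>F n in sequentially. \<forall>a\<in>A. \<bar>martin_kernel (walk_green \<mu>) p a (s n) - f \<xi> a\<bar> < e"
  proof -
    have "\<forall>\<^sub>F n in sequentially. \<bar>martin_kernel (walk_green \<mu>) p a (s n) - f \<xi> a\<bar> < e" if "a \<in> A" for a
      using tendstoD[OF walk_kernel_limit[OF s(1,3,2)] e] that A(2) by (simp add: dist_real_def subset_iff)
    then show ?thesis using A(1) by (simp add: eventually_ball_finite)
  qed
  ultimately have "\<forall>\<^sub>F n in sequentially. R < dist p (s n) \<and> ereal R < ext_gromov_product p (Inl (s n)) (Inr \<xi>)
      \<and> (\<forall>a\<in>A. \<bar>martin_kernel (walk_green \<mu>) p a (s n) - f \<xi> a\<bar> < e)"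
    by (intro eventually_conj)
  then obtain n where n: "R < dist p (s n)" "ereal R < ext_gromov_product p (Inl (s n)) (Inr \<xi>)"
      "\<forall>a\<in>A. \<bar>martin_kernel (walk_green \<mu>) p a (s n) - f \<xi> a\<bar> < e"
    using eventually_happens'[OF sequentially_bot] by blast
  have "s n \<in> X" using s(2) by (simp add: range_subsetD)
  from that[OF this n(1,2) n(3)[rule_format]] show ?thesis .
qed

text \<open>Otherwise bad points \<open>q n\<close> would approach \<xi>. Points \<open>x n\<close>
  of X replace them; these converge to \<xi>, so their kernels converge to that of \<xi>. The
  replacement and the convergence cost \<open>e / 2\<close> each.\<close>

lemma martin_nbhd_near_boundary:
  assumes \<xi>: "\<xi> \<in> limit_set X" and A: "finite A" "A \<subseteq> X" and e: "e > 0"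
  obtains R :: real where "\<And>q. q \<in> Inl ` X \<union> Inr ` limit_set X \<Longrightarrow> ereal R < ext_gromov_product p q (Inr \<xi>) \<Longrightarrow>
    map_sum id (\<lambda>\<xi>. restrict (f \<xi>) X) q \<in>
      martin_nbhd X (finite_subsets X) (martin_kernel (walk_green \<mu>) p) A e (restrict (f \<xi>) X)"
proof (rule ccontr)
  let ?k = "martin_kernel (walk_green \<mu>) p"
  let ?N = "martin_nbhd X (finite_subsets X) ?k A e (restrict (f \<xi>) X)"
  let ?F = "\<lambda>\<xi>. restrict (f \<xi>) X"
  assume "\<not> thesis"
  then have "\<exists>q. q \<in> Inl ` X \<union> Inr ` limit_set X \<and> ereal (real n) < ext_gromov_product p q (Inr \<xi>) \<and>
      map_sum id ?F q \<notin> ?N" for n :: nat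
    using that by blast
  then have "\<exists>q. \<forall>n::nat. q n \<in> Inl ` X \<union> Inr ` limit_set X \<and>
      ereal (real n) < ext_gromov_product p (q n) (Inr \<xi>) \<and> map_sum id ?F (q n) \<notin> ?N"
    by (intro choice allI)
  then obtain q where "\<forall>n::nat. q n \<in> Inl ` X \<union> Inr ` limit_set X \<and>
      ereal (real n) < ext_gromov_product p (q n) (Inr \<xi>) \<and> map_sum id ?F (q n) \<notin> ?N"
    by (rule exE)
  then have q: "q n \<in> Inl ` X \<union> Inr ` limit_set X"
    "ereal (real n) < ext_gromov_product p (q n) (Inr \<xi>)" "map_sum id ?F (q n) \<notin> ?N" for n
    by simp_all
  have \<xi>': "\<xi> \<in> gromov_boundary" using \<xi> unfolding limit_set_def by simp
  have \<delta>: "0 \<le> \<delta>" by (rule hyperbolicity_constant_nonneg[OF hyp])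
  \<comment> \<open>An interior \<open>q n\<close> is kept; a boundary point is replaced by a nearby
    point of X, and this detour costs \<open>3 * \<delta> + 4\<close>.\<close>
  have "\<exists>x. x \<in> X \<and> ereal (real n - (3 * \<delta> + 4)) < ext_gromov_product p (Inl x) (Inr \<xi>) \<and>
      (\<forall>\<eta>. q n = Inr \<eta> \<longrightarrow> (\<forall>a\<in>A. \<bar>?k a x - f \<eta> a\<bar> < e / 2)) \<and> (\<forall>y. q n = Inl y \<longrightarrow> x = y)" for n
  proof (cases "q n")
    case (Inl y)
    have "ereal (real n - (3 * \<delta> + 4)) \<le> ereal (real n)" using \<delta> by simp
    also have "\<dots> < ext_gromov_product p (Inl y) (Inr \<xi>)" using q(2)[of n] Inl by simp
    finally show ?thesis using q(1)[of n] Inl by auto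
  next
    case (Inr \<eta>)
    then have \<eta>: "\<eta> \<in> limit_set X" using q(1)[of n] by auto
    then have \<eta>': "\<eta> \<in> gromov_boundary" unfolding limit_set_def by simp
    have "e / 2 > 0" using e by simp
    then obtain x where x: "x \<in> X" "ereal (real n) < ext_gromov_product p (Inl x) (Inr \<eta>)"
      "\<And>a. a \<in> A \<Longrightarrow> \<bar>?k a x - f \<eta> a\<bar> < e / 2"
      by (rule approximate_boundary_point[OF \<eta> A, where R = "real n"]) (rule that)
    have "ereal (real n - (3 * \<delta> + 4)) < ext_gromov_product p (Inl x) (Inr \<xi>)"
      using ext_gromov_product_ultra[OF hyp, of "Inl x" "Inr \<eta>" "Inr \<xi>" "real n" p] x(2) q(2)[of n] Inr \<xi>' \<eta>'
      by (simp add: InlI InrI)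
    then show ?thesis using x Inr by auto
  qed
  then have "\<exists>x. \<forall>n. x n \<in> X \<and> ereal (real n - (3 * \<delta> + 4)) < ext_gromov_product p (Inl (x n)) (Inr \<xi>) \<and>
      (\<forall>\<eta>. q n = Inr \<eta> \<longrightarrow> (\<forall>a\<in>A. \<bar>?k a (x n) - f \<eta> a\<bar> < e / 2)) \<and> (\<forall>y. q n = Inl y \<longrightarrow> x n = y)"
    by (intro choice allI)
  then obtain x where "\<forall>n. x n \<in> X \<and> ereal (real n - (3 * \<delta> + 4)) < ext_gromov_product p (Inl (x n)) (Inr \<xi>) \<and>
      (\<forall>\<eta>. q n = Inr \<eta> \<longrightarrow> (\<forall>a\<in>A. \<bar>?k a (x n) - f \<eta> a\<bar> < e / 2)) \<and> (\<forall>y. q n = Inl y \<longrightarrow> x n = y)"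
    by (rule exE)
  then have x: "x n \<in> X" "ereal (real n - (3 * \<delta> + 4)) < ext_gromov_product p (Inl (x n)) (Inr \<xi>)"
    "q n = Inr \<eta> \<Longrightarrow> a \<in> A \<Longrightarrow> \<bar>?k a (x n) - f \<eta> a\<bar> < e / 2" "q n = Inl y \<Longrightarrow> x n = y" for n \<eta> a y
    by simp_all
  have x_\<xi>: "x \<in> \<xi>"
  proof (rule gromov_boundary_memI[OF hyp \<xi>', of p])
    fix R :: real
    obtain N where N: "R + (3 * \<delta> + 4) \<le> real N" using real_arch_simple by blast
    show "\<forall>\<^sub>F n in sequentially. ereal R < ext_gromov_product p (Inl (x n)) (Inr \<xi>)"
      using eventually_ge_at_top[of N]
    proof eventually_elim
      fix n assume "N \<le> n"
      then have "ereal R \<le> ereal (real n - (3 * \<delta> + 4))" using N by simp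
      then show "ereal R < ext_gromov_product p (Inl (x n)) (Inr \<xi>)" using x(2)[of n] by (rule le_less_trans)
    qed
  qed
  have ran: "range x \<subseteq> X" using x(1) by blast
  have "\<forall>\<^sub>F n in sequentially. \<bar>?k a (x n) - f \<xi> a\<bar> < e / 2" if "a \<in> A" for a
    using tendstoD[OF walk_kernel_limit[OF \<xi>' x_\<xi> ran, of a], of "e / 2"] that A(2) e
    by (simp add: dist_real_def subset_iff)
  then have "\<forall>\<^sub>F n in sequentially. \<forall>a\<in>A. \<bar>?k a (x n) - f \<xi> a\<bar> < e / 2"
    using A(1) by (simp add: eventually_ball_finite)
  moreover have "divergent_seq x" by (rule gromov_boundary_divergent[OF hyp proper \<xi>' x_\<xi>])
  then have "\<forall>\<^sub>F n in sequentially. x n \<notin> A"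
    unfolding divergent_seq_def using finite_imp_compact[OF A(1)] by blast
  ultimately have "\<forall>\<^sub>F n in sequentially. (\<forall>a\<in>A. \<bar>?k a (x n) - f \<xi> a\<bar> < e / 2) \<and> x n \<notin> A"
    by (rule eventually_conj)
  then obtain n where n: "\<And>a. a \<in> A \<Longrightarrow> \<bar>?k a (x n) - f \<xi> a\<bar> < e / 2" "x n \<notin> A"
    using eventually_happens'[OF sequentially_bot] by blast
  have "map_sum id ?F (q n) \<in> ?N"
  proof (cases "q n")
    case (Inl y)
    have "x n = y" by (rule x(4)[OF Inl])
    moreover have "\<bar>?k a (x n) - restrict (f \<xi>) X a\<bar> < e" if "a \<in> A" for a
      using n(1)[OF that] that A(2) e by (auto simp: subset_iff)
    ultimately have "Inl y \<in> ?N"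
      unfolding martin_nbhd_def using n(2) x(1)[of n] by (intro InlI CollectI conjI DiffI ballI) simp_all
    then show ?thesis using Inl by simp
  next
    case (Inr \<eta>)
    then have "\<eta> \<in> limit_set X" using q(1)[of n] by auto
    then have "?F \<eta> \<in> martin_boundary X (finite_subsets X) ?k"
      using restrict_in_walk_boundary unfolding walk_boundary_def by blast
    moreover have "\<bar>?F \<eta> a - ?F \<xi> a\<bar> < e" if "a \<in> A" for a
    proof -
      have "\<bar>f \<eta> a - f \<xi> a\<bar> < e"
        using n(1)[OF that] x(3)[OF Inr that] by linarith
      then show ?thesis using that A(2) by (auto simp: subset_iff)
    qed
    ultimately have "Inr (?F \<eta>) \<in> ?N"
      unfolding martin_nbhd_def by (intro InrI CollectI conjI ballI)
    then show ?thesis using Inr by simp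
  qed
  with q(3) show False by blast
qed

text \<open>The preimage \<open>P\<close> of an open set is the trace of the open set
  \<open>T\<close> that avoids the rest of \<open>?S\<close>. That \<open>P\<close> lies in
  \<open>T\<close> uses discreteness of X at interior points and
  \<open>martin_nbhd_near_boundary\<close> at boundary points.\<close>

lemma restrict_continuous:
  "continuous_map (subtopology (gromov_topology p) (Inl ` X \<union> Inr ` limit_set X)) (walk_topology p X \<mu>)
    (map_sum id (\<lambda>\<xi>. restrict (f \<xi>) X))"
  unfolding continuous_map_def
proof (intro conjI funcsetI allI impI)
  let ?k = "martin_kernel (walk_green \<mu>) p"
  let ?F = "\<lambda>\<xi>. restrict (f \<xi>) X"
  let ?S = "Inl ` X \<union> Inr ` limit_set X"
  have S: "?S \<subseteq> UNIV <+> gromov_boundary" by (auto simp: limit_set_def)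
  then have top: "topspace (subtopology (gromov_topology p) ?S) = ?S"
    by (simp only: topspace_subtopology topspace_gromov_topology Int_absorb1)
  show "map_sum id ?F q \<in> topspace (walk_topology p X \<mu>)" if "q \<in> topspace (subtopology (gromov_topology p) ?S)" for q
    using that restrict_in_walk_boundary unfolding top walk_topology_def topspace_martin_topology walk_boundary_def
    by auto
  fix U assume U: "openin (walk_topology p X \<mu>) U"
  define P where "P = {q \<in> ?S. map_sum id ?F q \<in> U}"
  define T where "T = Inl ` (- closure (Inl -` (?S - P))) \<union>
    Inr ` {\<eta> \<in> gromov_boundary. \<exists>R::real. \<forall>q\<in>?S - P. ext_gromov_product p q (Inr \<eta>) \<le> ereal R}"
  have T: "openin (gromov_topology p) T"
    unfolding T_def using S by (intro openin_gromov_avoid[OF hyp]) blast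
  have "q \<in> T" if q: "q \<in> P" for q
  proof (cases q)
    case (Inl x)
    then have x: "x \<in> X" using q unfolding P_def by auto
    \<comment> \<open>As X is discrete, \<open>x\<close> is not in the closure of the other points
      of X.\<close>
    have sub: "Inl -` (?S - P) \<subseteq> X - {x}" using q Inl by auto
    obtain e where e: "e > 0" "\<forall>y\<in>X. dist x y < e \<longrightarrow> y = x"
      using discreteD[OF discr x] unfolding isolated_in_dist_Ex_iff by blast
    have "x \<notin> closure (X - {x})"
      unfolding closure_approachable using e by (auto simp: dist_commute)
    then have "x \<notin> closure (Inl -` (?S - P))" using closure_mono[OF sub] by blast
    then show ?thesis unfolding T_def Inl by blast
  next
    case (Inr \<xi>)
    then have \<xi>: "\<xi> \<in> limit_set X" "Inr (?F \<xi>) \<in> U" using q unfolding P_def by auto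
    then have "\<exists>\<F>. finite \<F> \<and> \<F> \<subseteq> finite_subsets X \<and>
        (\<exists>e>0. martin_nbhd X (finite_subsets X) ?k (\<Union>\<F>) e (?F \<xi>) \<subseteq> U)"
      using U unfolding walk_topology_def openin_martin_topology by simp
    then obtain \<F> e where \<F>: "finite \<F>" "\<F> \<subseteq> finite_subsets X" and e: "e > 0"
      and nbhd: "martin_nbhd X (finite_subsets X) ?k (\<Union>\<F>) e (?F \<xi>) \<subseteq> U"
      by (elim exE conjE)
    have A: "finite (\<Union>\<F>)" "\<Union>\<F> \<subseteq> X" using \<F> unfolding finite_subsets_def by auto
    obtain R :: real where R: "\<And>q. q \<in> ?S \<Longrightarrow> ereal R < ext_gromov_product p q (Inr \<xi>) \<Longrightarrow>
        map_sum id ?F q \<in> martin_nbhd X (finite_subsets X) ?k (\<Union>\<F>) e (?F \<xi>)"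
      by (rule martin_nbhd_near_boundary[OF \<xi>(1) A e]) (rule that)
    have "ext_gromov_product p q' (Inr \<xi>) \<le> ereal R" if "q' \<in> ?S - P" for q'
    proof (rule ccontr)
      assume "\<not> ?thesis"
      then have "map_sum id ?F q' \<in> U" using R[of q'] that nbhd by (simp add: subset_iff)
      then show False using that unfolding P_def by blast
    qed
    moreover have "\<xi> \<in> gromov_boundary" using \<xi>(1) unfolding limit_set_def by simp
    ultimately show ?thesis unfolding T_def Inr by blast
  qed
  \<comment> \<open>A point of \<open>?S - P\<close> does not avoid itself: an interior one lies in
    the closure, and a boundary one has infinite product with itself.\<close>
  moreover have "q \<in> P" if q: "q \<in> T" "q \<in> ?S" for q
  proof (rule ccontr)
    assume "q \<notin> P"
    then have bad: "q \<in> ?S - P" using q(2) by blast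
    show False
    proof (cases q)
      case (Inl x)
      then have "x \<in> closure (Inl -` (?S - P))" using bad closure_subset[of "Inl -` (?S - P)"] by blast
      then show False using q(1) unfolding T_def Inl by blast
    next
      case (Inr \<xi>)
      then obtain R :: real where "\<xi> \<in> gromov_boundary" "\<forall>q\<in>?S - P. ext_gromov_product p q (Inr \<xi>) \<le> ereal R"
        using q(1) unfolding T_def by blast
      then show False
        using bad ext_gromov_product_self[OF hyp, of \<xi> R p] unfolding Inr by (simp add: not_less[symmetric])
    qed
  qed
  moreover have "P \<subseteq> ?S" unfolding P_def by blast
  ultimately have "P = T \<inter> ?S" by blast
  then show "openin (subtopology (gromov_topology p) ?S)
      {q \<in> topspace (subtopology (gromov_topology p) ?S). map_sum id ?F q \<in> U}"
    unfolding top P_def[symmetric] openin_subtopology using T by blast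
qed

text \<open>The set contains all of X, so only its boundary points matter. If all neighbourhoods
  failed, points \<open>\<eta> n\<close> outside \<open>W\<close> would have kernels converging on X
  to that of \<xi>. Nearby points \<open>y n\<close> of X converge along a subsequence to some
  \<zeta> with the same kernel on X; injectivity gives \<zeta> = \<xi>, which puts some
  \<open>\<eta> (r n)\<close> into \<open>W\<close>.\<close>

lemma restrict_open:
  assumes W: "openin (gromov_topology p) W"
  shows "openin (walk_topology p X \<mu>) (Inl ` X \<union> Inr ` {restrict (f \<xi>) X | \<xi>. \<xi> \<in> limit_set X \<and> Inr \<xi> \<in> W})"
    (is "openin _ (Inl ` X \<union> Inr ` ?V)")
  unfolding walk_topology_def openin_martin_topology
proof (intro conjI ballI)
  let ?k = "martin_kernel (walk_green \<mu>) p"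
  let ?M = "martin_boundary X (finite_subsets X) ?k"
  let ?F = "\<lambda>\<xi>. restrict (f \<xi>) X"
  let ?U = "Inl ` X \<union> Inr ` ?V"
  have M: "?F \<xi> \<in> ?M" if "\<xi> \<in> limit_set X" for \<xi>
    using restrict_in_walk_boundary[OF that] unfolding walk_boundary_def .
  then show "?U \<subseteq> X <+> ?M" by auto
  have "Inl -` ?U = X" by auto
  then show "openin (top_of_set X) (Inl -` ?U)" by simp
  fix \<kappa> assume "\<kappa> \<in> Inr -` ?U"
  then obtain \<xi> where \<xi>: "\<xi> \<in> limit_set X" "Inr \<xi> \<in> W" and \<kappa>: "\<kappa> = ?F \<xi>" by auto
  have \<xi>': "\<xi> \<in> gromov_boundary" using \<xi>(1) unfolding limit_set_def by simp
  obtain R :: real where R: "{q \<in> UNIV <+> gromov_boundary. ereal R < ext_gromov_product p q (Inr \<xi>)} \<subseteq> W"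
    using W \<xi>(2) unfolding openin_gromov_topology by (auto simp: vimage_def)
  have "countable X"
    using fls unfolding FLS_restriction_def by (intro countable_irreducible_walk) (elim conjE)
  \<comment> \<open>Repetitions are allowed. The sets \<open>A n\<close> increase and eventually
    contain each point of X, so errors below \<open>1 / real (Suc n)\<close> on \<open>A n\<close>
    give pointwise convergence.\<close>
  then obtain a :: "nat \<Rightarrow> 'h" where a: "X = range a" using pX uncountable_def by (metis empty_iff)
  define A where "A = (\<lambda>n. a ` {..n})"
  have A: "finite (A n)" "A n \<subseteq> X" for n unfolding A_def a by auto
  show "\<exists>\<F>. finite \<F> \<and> \<F> \<subseteq> finite_subsets X \<and>
      (\<exists>e>0. martin_nbhd X (finite_subsets X) ?k (\<Union>\<F>) e \<kappa> \<subseteq> ?U)"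
  proof (rule ccontr)
    assume neg: "\<not> ?thesis"
    have "\<exists>\<eta>. \<eta> \<in> limit_set X \<and> Inr \<eta> \<notin> W \<and> (\<forall>x\<in>A n. \<bar>f \<eta> x - f \<xi> x\<bar> < 1 / real (Suc n))" for n
    proof -
      have "\<not> martin_nbhd X (finite_subsets X) ?k (\<Union>{A n}) (1 / real (Suc n)) \<kappa> \<subseteq> ?U"
      proof
        assume "martin_nbhd X (finite_subsets X) ?k (\<Union>{A n}) (1 / real (Suc n)) \<kappa> \<subseteq> ?U"
        then have "finite {A n} \<and> {A n} \<subseteq> finite_subsets X \<and>
            (\<exists>e>0. martin_nbhd X (finite_subsets X) ?k (\<Union>{A n}) e \<kappa> \<subseteq> ?U)"
          using A[of n] by (intro conjI exI[of _ "1 / real (Suc n)"]) (auto simp: finite_subsets_def)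
        with neg show False by blast
      qed
      then obtain q where q: "q \<in> martin_nbhd X (finite_subsets X) ?k (A n) (1 / real (Suc n)) \<kappa>" "q \<notin> ?U"
        by auto
      then obtain \<kappa>' where \<kappa>': "q = Inr \<kappa>'" "\<kappa>' \<in> ?M" "\<forall>x\<in>A n. \<bar>\<kappa>' x - \<kappa> x\<bar> < 1 / real (Suc n)"
        unfolding martin_nbhd_def by auto
      obtain \<eta> where \<eta>: "\<eta> \<in> limit_set X" "?F \<eta> = \<kappa>'"
        using \<kappa>'(2) by (rule_tac walk_boundary_surj[of \<kappa>']) (simp add: walk_boundary_def, rule that)
      have "Inr \<eta> \<notin> W"
      proof
        assume "Inr \<eta> \<in> W"
        then have "\<kappa>' \<in> ?V" using \<eta> by blast
        then show False using q(2) \<kappa>'(1) by blast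
      qed
      moreover have "\<bar>f \<eta> x - f \<xi> x\<bar> < 1 / real (Suc n)" if "x \<in> A n" for x
      proof -
        have "x \<in> X" using A(2) that by (rule subsetD)
        then show ?thesis using \<kappa>'(3)[rule_format, OF that] unfolding \<kappa> \<eta>(2)[symmetric] by simp
      qed
      ultimately show ?thesis using \<eta>(1) by blast
    qed
    then have "\<exists>\<eta>. \<forall>n. \<eta> n \<in> limit_set X \<and> Inr (\<eta> n) \<notin> W \<and> (\<forall>x\<in>A n. \<bar>f (\<eta> n) x - f \<xi> x\<bar> < 1 / real (Suc n))"
      by (intro choice allI)
    then obtain \<eta> where "\<forall>n. \<eta> n \<in> limit_set X \<and> Inr (\<eta> n) \<notin> W \<and> (\<forall>x\<in>A n. \<bar>f (\<eta> n) x - f \<xi> x\<bar> < 1 / real (Suc n))"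
      by (rule exE)
    then have \<eta>: "\<eta> n \<in> limit_set X" "Inr (\<eta> n) \<notin> W"
      "x \<in> A n \<Longrightarrow> \<bar>f (\<eta> n) x - f \<xi> x\<bar> < 1 / real (Suc n)" for n x
      by simp_all
    have "\<exists>y. y \<in> X \<and> real n < dist p y \<and> ereal (real n) < ext_gromov_product p (Inl y) (Inr (\<eta> n)) \<and>
        (\<forall>x\<in>A n. \<bar>?k x y - f (\<eta> n) x\<bar> < 1 / real (Suc n))" for n
    proof -
      have "0 < 1 / real (Suc n)" by simp
      then obtain y where "y \<in> X" "real n < dist p y" "ereal (real n) < ext_gromov_product p (Inl y) (Inr (\<eta> n))"
        "\<And>x. x \<in> A n \<Longrightarrow> \<bar>?k x y - f (\<eta> n) x\<bar> < 1 / real (Suc n)"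
        by (rule approximate_boundary_point[OF \<eta>(1) A, where R = "real n"]) (rule that)
      then show ?thesis by (intro exI[of _ y]) simp
    qed
    then have "\<exists>y. \<forall>n. y n \<in> X \<and> real n < dist p (y n) \<and> ereal (real n) < ext_gromov_product p (Inl (y n)) (Inr (\<eta> n)) \<and>
        (\<forall>x\<in>A n. \<bar>?k x (y n) - f (\<eta> n) x\<bar> < 1 / real (Suc n))"
      by (intro choice allI)
    then obtain y where "\<forall>n. y n \<in> X \<and> real n < dist p (y n) \<and> ereal (real n) < ext_gromov_product p (Inl (y n)) (Inr (\<eta> n)) \<and>
        (\<forall>x\<in>A n. \<bar>?k x (y n) - f (\<eta> n) x\<bar> < 1 / real (Suc n))"
      by (rule exE)
    then have y: "y n \<in> X" "real n < dist p (y n)" "ereal (real n) < ext_gromov_product p (Inl (y n)) (Inr (\<eta> n))"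
      "x \<in> A n \<Longrightarrow> \<bar>?k x (y n) - f (\<eta> n) x\<bar> < 1 / real (Suc n)" for n x
      by simp_all
    have "divergent_seq y"
      unfolding divergent_seq_dist[OF proper, of y p]
    proof
      fix R :: real
      obtain N where N: "R \<le> real N" using real_arch_simple by blast
      show "\<forall>\<^sub>F n in sequentially. R < dist p (y n)"
        using eventually_ge_at_top[of N]
      proof eventually_elim
        fix n assume "N \<le> n"
        then show "R < dist p (y n)" using N y(2)[of n] by linarith
      qed
    qed
    moreover have "range y \<subseteq> X" using y(1) by blast
    ultimately obtain r \<zeta> where r: "strict_mono r" and \<zeta>: "\<zeta> \<in> limit_set X" "y \<circ> r \<in> \<zeta>"
      and lim: "\<And>x. x \<in> X \<Longrightarrow> (\<lambda>n. ?k x (y (r n))) \<longlonglongrightarrow> f \<zeta> x"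
      by (rule divergent_in_X_subseq) (rule that)
    have "f \<xi> x = f \<zeta> x" if x: "x \<in> X" for x
    proof -
      obtain i where i: "x = a i" using x unfolding a by (rule imageE)
      have zero: "(\<lambda>n. 2 * (1 / real (Suc n))) \<longlonglongrightarrow> 0"
        using tendsto_mult_right_zero[OF LIMSEQ_inverse_real_of_nat, of 2] by (simp add: inverse_eq_divide)
      have "(\<lambda>n. ?k x (y n) - f \<xi> x) \<longlonglongrightarrow> 0"
      proof (rule Lim_null_comparison[OF _ zero])
        show "\<forall>\<^sub>F n in sequentially. norm (?k x (y n) - f \<xi> x) \<le> 2 * (1 / real (Suc n))"
          using eventually_ge_at_top[of i]
        proof eventually_elim
          fix n assume "i \<le> n"
          then have "x \<in> A n" unfolding A_def i by simp
          then show "norm (?k x (y n) - f \<xi> x) \<le> 2 * (1 / real (Suc n))"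
            using y(4)[of x n] \<eta>(3)[of x n] unfolding real_norm_def by linarith
        qed
      qed
      then have "(\<lambda>n. ?k x (y n)) \<longlonglongrightarrow> f \<xi> x" by (rule LIM_zero_cancel)
      then have "(\<lambda>n. ?k x (y (r n))) \<longlonglongrightarrow> f \<xi> x"
        using LIMSEQ_subseq_LIMSEQ[OF _ r] by (simp add: o_def)
      then show ?thesis using lim[OF x] by (rule LIMSEQ_unique)
    qed
    then have "\<xi> = \<zeta>" by (rule restrict_inj[OF \<xi>(1) \<zeta>(1)])
    with \<zeta>(2) have y_\<xi>: "y \<circ> r \<in> \<xi>" by simp
    \<comment> \<open>The passage from \<open>\<eta> (r n)\<close> through \<open>y (r n)\<close> to
      \<xi> loses \<open>3 * \<delta> + 4\<close> and must end above \<open>R\<close>.\<close>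
    define S where "S = R + (3 * \<delta> + 4)"
    obtain N where N: "S \<le> real N" using real_arch_simple by blast
    have "\<forall>\<^sub>F n in sequentially. ereal S < ext_gromov_product p (Inl ((y \<circ> r) n)) (Inr \<xi>) \<and> N \<le> n"
      by (intro eventually_conj ext_gromov_product_tends[OF hyp \<xi>' y_\<xi>] eventually_ge_at_top)
    then obtain n where n: "ereal S < ext_gromov_product p (Inl (y (r n))) (Inr \<xi>)" "N \<le> n"
      using eventually_happens'[OF sequentially_bot] by (auto simp: o_def)
    have "N \<le> r n" using n(2) seq_suble[OF r, of n] by simp
    then have "ereal S \<le> ereal (real (r n))" using N by simp
    also have "\<dots> < ext_gromov_product p (Inl (y (r n))) (Inr (\<eta> (r n)))" by (rule y(3))
    finally have "ereal S < ext_gromov_product p (Inr (\<eta> (r n))) (Inl (y (r n)))"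
      by (simp only: ext_gromov_product_commute[OF hyp, of p "Inl (y (r n))"])
    moreover have \<eta>': "\<eta> (r n) \<in> gromov_boundary" using \<eta>(1)[of "r n"] unfolding limit_set_def by simp
    ultimately have "ereal (S - (3 * \<delta> + 4)) < ext_gromov_product p (Inr (\<eta> (r n))) (Inr \<xi>)"
      using n(1) \<xi>' by (intro ext_gromov_product_ultra[OF hyp, of _ "Inl (y (r n))"]) (simp_all add: InlI InrI)
    then have "Inr (\<eta> (r n)) \<in> {q \<in> UNIV <+> gromov_boundary. ereal R < ext_gromov_product p q (Inr \<xi>)}"
      using \<eta>' unfolding S_def by (simp add: InrI)
    then have "Inr (\<eta> (r n)) \<in> W" by (rule subsetD[OF R])
    with \<eta>(2) show False by blast
  qed
qed

end

section \<open>Restriction of kernels as a homeomorphism of the boundaries\<close>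

theorem theorem4p17:
  fixes L :: "'h::metric_space measure"
    and Z :: "('w, 'h) process"
    and G :: "'h \<Rightarrow> 'h \<Rightarrow> real"
    and p :: 'h
    and \<Gamma> :: "('g, 'b) monoid_scheme"
    and \<phi> :: "'g \<Rightarrow> 'h \<Rightarrow> 'h"
    and X :: "'h set"
    and \<mu> :: "'h \<Rightarrow> 'h pmf"
    and \<delta> :: real
  assumes "proper_space (UNIV :: 'h set)"
    and "gromov_hyperbolic \<delta> (UNIV :: 'h set)"
    and "radon_measure L"
    and "\<And>U. open U \<Longrightarrow> U \<noteq> {} \<Longrightarrow> emeasure L U > 0"
    and "group \<Gamma>"
    and "group_action \<Gamma> UNIV \<phi>"
    and "properly_discontinuous \<Gamma> \<phi>"
    and "\<And>g. g \<in> carrier \<Gamma> \<Longrightarrow> process_automorphism L Z (\<phi> g)"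
    and "ancona_process \<Gamma> \<phi> L Z G p"
    and "Isolated.discrete X"
    and "p \<in> X"
    and "\<And>g. g \<in> carrier \<Gamma> \<Longrightarrow> \<phi> g ` X = X"
    and "FLS_restriction \<Gamma> \<phi> G p X \<mu>"
    and "limit_set X \<subseteq> radial_limit_set (UNIV :: 'h set)"
  shows "\<exists>f.
      equivariant_on \<Gamma> (\<lambda>g. gromov_act (\<phi> g)) (martin_act \<Gamma> \<phi> X p) (limit_set X) f \<and>
      homeomorphic_map
        (subtopology (gromov_topology p) (Inr ` limit_set X))
        (subtopology (walk_topology p X \<mu>) (Inr ` walk_boundary p X \<mu>))
        (map_sum id f) \<and>
      continuous_map
        (subtopology (gromov_topology p) (Inl ` X \<union> Inr ` limit_set X))
        (walk_topology p X \<mu>)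
        (map_sum id f)"
proof -
  let ?K = "martin_kernel G p"
  have "let K = ?K; M = martin_topology UNIV (Collect compact) K in
      \<exists>f. equivariant_on \<Gamma> (\<lambda>g. gromov_act (\<phi> g)) (martin_act \<Gamma> \<phi> UNIV p) gromov_boundary f \<and>
          homeomorphic_map
            (subtopology (gromov_topology p) (Inr ` gromov_boundary))
            (subtopology M (Inr ` martin_boundary UNIV (Collect compact) K)) (map_sum id f) \<and>
          homeomorphic_map (gromov_topology p) M (map_sum id f)"
    using assms(9) unfolding ancona_process_def by (elim conjE)
  then obtain f where equi: "equivariant_on \<Gamma> (\<lambda>g. gromov_act (\<phi> g)) (martin_act \<Gamma> \<phi> UNIV p) gromov_boundary f"
    and homeo: "homeomorphic_map (gromov_topology p) (martin_topology UNIV (Collect compact) ?K) (map_sum id f)"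
    unfolding Let_def by (elim exE conjE) (rule that)
  have L_pos: "\<forall>U. open U \<and> U \<noteq> {} \<longrightarrow> 0 < emeasure L U"
    using assms(4) by simp
  note setting = assms(9,1,3) L_pos assms(2) homeo assms(10,11,13,14)
  define F where "F = (\<lambda>\<xi>. restrict (f \<xi>) X)"
  let ?S = "Inl ` X \<union> Inr ` limit_set X"
  let ?B = "subtopology (gromov_topology p) (Inr ` limit_set X)"
  let ?W = "subtopology (walk_topology p X \<mu>) (Inr ` walk_boundary p X \<mu>)"
  have boundary: "limit_set X \<subseteq> gromov_boundary" unfolding limit_set_def by blast
  have F_image: "F ` limit_set X = walk_boundary p X \<mu>"
  proof (intro equalityI subsetI)
    show "\<kappa> \<in> walk_boundary p X \<mu>" if "\<kappa> \<in> F ` limit_set X" for \<kappa>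
      using that restrict_in_walk_boundary[OF setting] unfolding F_def by auto
    show "\<kappa> \<in> F ` limit_set X" if \<kappa>: "\<kappa> \<in> walk_boundary p X \<mu>" for \<kappa>
    proof -
      obtain \<xi> where "\<xi> \<in> limit_set X" "restrict (f \<xi>) X = \<kappa>"
        by (rule walk_boundary_surj[OF setting \<kappa>]) (rule that)
      then show ?thesis unfolding F_def by (intro image_eqI[of _ _ \<xi>]) simp_all
    qed
  qed
  have F_inj: "inj_on F (limit_set X)"
  proof (rule inj_onI)
    fix \<xi> \<eta> assume \<xi>\<eta>: "\<xi> \<in> limit_set X" "\<eta> \<in> limit_set X" "F \<xi> = F \<eta>"
    have "f \<xi> a = f \<eta> a" if "a \<in> X" for a
      using fun_cong[OF \<xi>\<eta>(3), of a] that unfolding F_def by simp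
    then show "\<xi> = \<eta>" by (rule restrict_inj[OF setting \<xi>\<eta>(1,2)])
  qed
  have top_B: "topspace ?B = Inr ` limit_set X"
    using boundary by (auto simp: topspace_gromov_topology)
  have top_W: "topspace ?W = Inr ` walk_boundary p X \<mu>"
    by (auto simp: walk_topology_def topspace_martin_topology walk_boundary_def)
  have image: "map_sum id F ` (Inr ` limit_set X) = Inr ` walk_boundary p X \<mu>"
    unfolding F_image[symmetric] by (simp add: image_image)
  have cont: "continuous_map (subtopology (gromov_topology p) ?S) (walk_topology p X \<mu>) (map_sum id F)"
    unfolding F_def by (rule restrict_continuous[OF setting])
  have "equivariant_on \<Gamma> (\<lambda>g. gromov_act (\<phi> g)) (martin_act \<Gamma> \<phi> X p) (limit_set X) F"
    unfolding equivariant_on_def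
  proof (intro ballI)
    fix g \<xi> assume g: "g \<in> carrier \<Gamma>" and \<xi>: "\<xi> \<in> limit_set X"
    have "inv\<^bsub>\<Gamma>\<^esub> g \<in> carrier \<Gamma>" using assms(5) g by (rule group.inv_closed)
    then have inv: "\<phi> (inv\<^bsub>\<Gamma>\<^esub> g) x \<in> X" if "x \<in> X" for x
      using assms(12) that by blast
    have "f (gromov_act (\<phi> g) \<xi>) = martin_act \<Gamma> \<phi> UNIV p g (f \<xi>)"
      using equi g \<xi> boundary unfolding equivariant_on_def by blast
    \<comment> \<open>The action evaluates kernels at translates of \<open>x\<close> and
      \<open>p\<close>, which stay in X by invariance; there restricted and full kernels
      agree.\<close>
    then show "F (gromov_act (\<phi> g) \<xi>) = martin_act \<Gamma> \<phi> X p g (F \<xi>)"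
      unfolding F_def martin_act_def using inv assms(11) by (auto simp: fun_eq_iff restrict_def)
  qed
  moreover have "homeomorphic_map ?B ?W (map_sum id F)"
  proof (rule bijective_open_imp_homeomorphic_map)
    have "continuous_map ?B (walk_topology p X \<mu>) (map_sum id F)"
      using cont by (rule continuous_map_from_subtopology_mono) blast
    then show "continuous_map ?B ?W (map_sum id F)"
      using image by (intro continuous_map_into_subtopology) (auto simp: top_B)
    show "map_sum id F ` topspace ?B = topspace ?W" unfolding top_B top_W by (rule image)
    show "inj_on (map_sum id F) (topspace ?B)"
      unfolding top_B using F_inj by (auto simp: inj_on_def)
    show "open_map ?B ?W (map_sum id F)"
      unfolding open_map_def
    proof (intro allI impI)
      fix V assume "openin ?B V"
      then obtain W where W: "openin (gromov_topology p) W" "V = W \<inter> Inr ` limit_set X"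
        unfolding openin_subtopology by blast
      let ?V = "{restrict (f \<xi>) X | \<xi>. \<xi> \<in> limit_set X \<and> Inr \<xi> \<in> W}"
      \<comment> \<open>Intersecting with the boundary removes the copy of X that
        \<open>restrict_open\<close> adds.\<close>
      have "map_sum id F ` V = (Inl ` X \<union> Inr ` ?V) \<inter> Inr ` walk_boundary p X \<mu>"
      proof -
        have "map_sum id F ` V = Inr ` ?V" unfolding W(2) F_def by force
        moreover have "?V \<subseteq> walk_boundary p X \<mu>" unfolding F_image[symmetric] F_def by blast
        ultimately show ?thesis by auto
      qed
      then show "openin ?W (map_sum id F ` V)"
        unfolding openin_subtopology using restrict_open[OF setting W(1)] by blast
    qed
  qed
  ultimately show ?thesis using cont by blast
qed

end
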